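(* Let $\Xi_1$ be the entire function (of order $1/2$) such that $\Xi(s)=\Xi_1(-s^2)$ for all $s\in\mathbb{C}$. The Riemann hypothesis holds if and only if there exists a Polya frequency function $\Lambda$ with support in $[0,\infty)$ and a real number $\alpha<0$ such that $$\frac{1}{\Xi_1(s)} = \int_0^\infty \Lambda(x)\, e^{-sx}\, dx \qquad \text{for all } s\in\mathbb{C} \text{ with } \mathrm{Re}\, s > \alpha.$$
   Context: A measurable function $\Lambda:\mathbb{R}\to\mathbb{R}$ is called totally positive if for every $n\in\mathbb{N}$ and all real numbers $x_1<x_2<\dots<x_n$ and $y_1<y_2<\dots<y_n$ one has $\det\big(\Lambda(x_j-y_k)\big)_{j,k=1,\dots,n}\ge 0$. A totally positive function that is moreover integrable on $\mathbb{R}$ is called a Polya frequency function. Let $\zeta$ be the Riemann zeta function, $\xi(s)=\tfrac12 s(s-1)\pi^{-s/2}\Gamma(s/2)\zeta(s)$ the Riemann xi-function, and $\Xi(s)=\xi(\tfrac12+is)$; by the functional equation $\Xi(s)=\Xi(-s)$, so $\Xi$ is an even entire function and hence of the form $\Xi(s)=\Xi_1(-s^2)$ for an entire function $\Xi_1$. The Riemann hypothesis is the assertion that all non-trivial zeros of $\zeta$ lie on the critical line $\{\tfrac12+it: t\in\mathbb{R}\}$, equivalently that $\Xi$ has only real zeros. *)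

theory Defs
  imports
    "HOL-Complex_Analysis.Complex_Analysis"
    "Jordan_Normal_Form.Determinant"
begin

(* JNF matrices are used because the order n of the minors varies inside the formula. *)
definition totally_positive :: "(real \<Rightarrow> real) \<Rightarrow> bool" where
  "totally_positive L \<longleftrightarrow>
     L \<in> borel_measurable lebesgue \<and>
     (\<forall>n (x :: nat \<Rightarrow> real) (y :: nat \<Rightarrow> real).
        strict_mono_on {..<n} x \<longrightarrow> strict_mono_on {..<n} y \<longrightarrow>
        Determinant.det (Matrix.mat n n (\<lambda>(j, k). L (x j - y k))) \<ge> 0)"

definition Polya_frequency :: "(real \<Rightarrow> real) \<Rightarrow> bool" where
  "Polya_frequency L \<longleftrightarrow> totally_positive L \<and> integrable lebesgue L"

(* The Riemann zeta function: the unique analytic continuation of the Dirichlet series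
   to the plane without the point 1. The value 0 at the pole is a mere convention, needed
   to make the description definite. *)
definition zeta :: "complex \<Rightarrow> complex" where
  "zeta = (THE f. f holomorphic_on UNIV - {1} \<and> f 1 = 0 \<and>
                  (\<forall>s. Re s > 1 \<longrightarrow> (\<lambda>n. 1 / of_nat (Suc n) powr s) sums f s))"

(* The product formula is degenerate at 0, 1, -2, -4, ..., where Gamma or zeta has a pole and
   its HOL value is a convention (Gamma is 0 at its poles); remove_sings replaces the values
   at these points by the limits, and changes nothing elsewhere. *)
definition Riemann_xi :: "complex \<Rightarrow> complex" where
  "Riemann_xi = remove_sings (\<lambda>s.
     1 / 2 * s * (s - 1) * complex_of_real pi powr (- s / 2) * Gamma (s / 2) * zeta s)"

definition Riemann_Xi :: "complex \<Rightarrow> complex" where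
  "Riemann_Xi s = Riemann_xi (1 / 2 + \<i> * s)"

(* The point 1 is excluded because it is the pole of zeta; the trivial zeros are -2, -4, ... *)
definition zeta_nontrivial_zero :: "complex \<Rightarrow> bool" where
  "zeta_nontrivial_zero s \<longleftrightarrow>
     s \<noteq> 1 \<and> zeta s = 0 \<and> (\<forall>n::nat. n \<ge> 1 \<longrightarrow> s \<noteq> - (2 * of_nat n))"

definition Riemann_hypothesis :: bool where
  "Riemann_hypothesis \<longleftrightarrow> (\<forall>s. zeta_nontrivial_zero s \<longrightarrow> Re s = 1 / 2)"

end

theory Submission
  imports Defs
begin

text \<open>
  Put \<open>\<xi>(z) = \<Xi>\<^sub>1((z - 1/2)\<^sup>2)\<close>; the Riemann hypothesis says that all zeros of \<open>\<Xi>\<^sub>1\<close> are real and negative.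
  If they are, then \<open>\<Xi>\<^sub>1\<close> grows slowly enough to be \<open>\<Xi>\<^sub>1(0) \<Prod> (1 + s / a\<^sub>k)\<close> with \<open>a\<^sub>k > 0\<close>, and
  \<open>1 / (1 + s / a)\<close> is the Laplace transform of an exponential density. Convolution with such a density
  is, up to exponential factors, a running integral, which preserves total positivity; the infinite
  convolution is the required function.

  Conversely, let \<open>1 / \<Xi>\<^sub>1\<close> be the Laplace transform of a totally positive \<open>\<Lambda>\<close>. Then convolution with \<open>\<Lambda>\<close>
  inverts the operator \<open>\<Xi>\<^sub>1(D)\<close> on polynomials, and it does not increase the number of sign changes.
  Hence \<open>\<Xi>\<^sub>1(D)\<close> maps polynomials with only real zeros to such polynomials. Applied to \<open>x\<^sup>n\<close> this gives
  the Jensen polynomials of \<open>\<Xi>\<^sub>1\<close>, which converge to \<open>\<Xi>\<^sub>1\<close>, so Hurwitz's theorem applies.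

  That \<open>\<xi>\<close> is entire and satisfies the functional equation is implicit in the existence of \<open>\<Xi>\<^sub>1\<close>; only the
  continuation of \<open>\<zeta>\<close> itself has to be constructed.
\<close>

section \<open>Determinants and sign changes\<close>

text \<open>Total positivity concerns values at points, so the infinite convolution has to converge
  at every point; convergence of transforms would not do. A single exponential density jumps at 0,
  one convolution makes it Lipschitz, and from then on each further factor moves the values by at
  most a constant times 1 / a_k. In the converse, variation diminution sees sign changes and not
  multiplicities, and x^n changes sign at most once. It is therefore replaced by a polynomial with n
  equally spaced simple zeros, and real-rootedness is recorded as a lower bound by a multiple of |Im
  z|^n, which survives when the spacing tends to 0. The condition \<alpha> < 0 has two effects: the
  half-plane contains a disc about 0, so all moments exist and the transform is a power series
  there; and real zeros of \<open>Xi1\<close> are forced to be negative. In the other direction a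
  zero at 0 has to be excluded by hand, through the sign of xi(1/2), and the existence of infinitely
  many zeros comes from the growth of xi at the even integers.\<close>

abbreviation fdet :: "nat \<Rightarrow> (nat \<Rightarrow> nat \<Rightarrow> real) \<Rightarrow> real" where
  "fdet n f \<equiv> Determinant.det (Matrix.mat n n (\<lambda>(j, k). f j k))"

lemma fdet_cong:
  assumes "\<And>j k. j < n \<Longrightarrow> k < n \<Longrightarrow> f j k = g j k"
  shows "fdet n f = fdet n g"
  by (rule arg_cong[where f = Determinant.det]) (auto intro!: eq_matI simp: assms)

lemma fdet_transpose: "fdet n (\<lambda>j k. f k j) = fdet n f"
proof -
  have "fdet n (\<lambda>j k. f k j) = Determinant.det (transpose_mat (Matrix.mat n n (\<lambda>(j, k). f j k)))"
    by (rule arg_cong[where f = Determinant.det]) (auto intro!: eq_matI)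
  also have "\<dots> = fdet n f"
    by (rule det_transpose) auto
  finally show ?thesis .
qed

lemma fdet_expand_column:
  assumes "s < n"
  shows "fdet n f = (\<Sum>j<n. f j s * ((-1) ^ (j + s) *
           fdet (n - 1) (\<lambda>i k. f (insert_index j i) (insert_index s k))))"
proof -
  let ?A = "Matrix.mat n n (\<lambda>(j, k). f j k)"
  have "Determinant.det ?A = (\<Sum>j<n. ?A $$ (j, s) * cofactor ?A j s)"
    by (rule laplace_expansion_column) (use assms in auto)
  also have "\<dots> = (\<Sum>j<n. f j s * ((-1) ^ (j + s) *
           fdet (n - 1) (\<lambda>i k. f (insert_index j i) (insert_index s k))))"
  proof (rule sum.cong)
    fix j assume "j \<in> {..<n}"
    moreover have "mat_delete ?A j s =
        Matrix.mat (n - 1) (n - 1) (\<lambda>(i, k). f (insert_index j i) (insert_index s k))"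
      by (rule eq_matI) (use assms \<open>j \<in> {..<n}\<close> in \<open>auto simp: mat_delete_def insert_index_def\<close>)
    ultimately show "?A $$ (j, s) * cofactor ?A j s = f j s * ((-1) ^ (j + s) *
           fdet (n - 1) (\<lambda>i k. f (insert_index j i) (insert_index s k)))"
      using assms by (simp add: cofactor_def)
  qed auto
  finally show ?thesis .
qed

text \<open>The coefficients are the cofactors of column \<open>s\<close>, in which that column does
  not occur.\<close>

lemma fdet_column_linear:
  assumes "s < n"
  obtains c where "\<And>h. fdet n (\<lambda>j k. if k = s then h j else f j k) = (\<Sum>j<n. h j * c j)"
proof -
  have ne: "insert_index s k \<noteq> s" for k by (simp add: insert_index_def)
  show thesis
    by (rule that, subst fdet_expand_column[OF assms]) (simp add: ne)
qed

text \<open>The determinant is a linear functional of each column, so it can be averaged one column at a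
  time.\<close>
lemma fdet_integral_nonneg:
  fixes K :: "nat \<Rightarrow> nat \<Rightarrow> 'a \<Rightarrow> real"
  assumes int: "\<And>j k. j < n \<Longrightarrow> k < n \<Longrightarrow> integrable M (K j k)"
    and zero: "\<And>j k t. j < n \<Longrightarrow> k < n \<Longrightarrow> t \<notin> I k \<Longrightarrow> K j k t = 0"
    and nonneg: "\<And>t. (\<And>k. k < n \<Longrightarrow> t k \<in> I k) \<Longrightarrow> fdet n (\<lambda>j k. K j k (t k)) \<ge> 0"
  shows "fdet n (\<lambda>j k. \<integral>t. K j k t \<partial>M) \<ge> 0"
proof -
  \<comment> \<open>The columns before \<open>s\<close> are already averaged, the others still
    evaluated at sample points, so each induction step integrates a single column.\<close>
  define S where "S s t = fdet n (\<lambda>j k. if k < s then (\<integral>u. K j k u \<partial>M) else K j k (t k))" for s t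
  have "s \<le> n \<Longrightarrow> (\<And>k. s \<le> k \<Longrightarrow> k < n \<Longrightarrow> t k \<in> I k) \<Longrightarrow> S s t \<ge> 0" for s t
  proof (induction s arbitrary: t)
    case 0
    then show ?case using nonneg[of t] by (simp add: S_def)
  next
    case (Suc s)
    then have s: "s < n" by simp
    obtain c where c: "\<And>h. fdet n (\<lambda>j k. if k = s then h j else
        if k < s then (\<integral>u. K j k u \<partial>M) else K j k (t k)) = (\<Sum>j<n. h j * c j)"
      using fdet_column_linear[OF s] by meson
    have eq1: "S (Suc s) t = (\<Sum>j<n. (\<integral>u. K j s u \<partial>M) * c j)"
      unfolding S_def c[symmetric] by (rule fdet_cong) (auto simp: less_Suc_eq)
    have eq2: "S s (t(s := u)) = (\<Sum>j<n. K j s u * c j)" for u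
      unfolding S_def c[symmetric] by (rule fdet_cong) auto
    have "(\<Sum>j<n. K j s u * c j) \<ge> 0" for u
    proof (cases "u \<in> I s")
      case True
      have "S s (t(s := u)) \<ge> 0"
        by (rule Suc.IH) (use Suc.prems True in \<open>auto simp: Suc_le_eq\<close>)
      then show ?thesis by (simp add: eq2)
    next
      case False
      then show ?thesis using zero s by simp
    qed
    then have "(\<integral>u. (\<Sum>j<n. K j s u * c j) \<partial>M) \<ge> 0" by (intro integral_nonneg_AE) auto
    also have "(\<integral>u. (\<Sum>j<n. K j s u * c j) \<partial>M) = S (Suc s) t"
      unfolding eq1 using int s by (subst Bochner_Integration.integral_sum) auto
    finally show ?case .
  qed
  from this[of n] have "S n t \<ge> 0" for t by simp
  \<comment> \<open>At \<open>s = n\<close> no sample point is left, so any \<open>t\<close> will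
    do.\<close>
  also have "S n undefined = fdet n (\<lambda>j k. \<integral>t. K j k t \<partial>M)"
    unfolding S_def by (rule fdet_cong) auto
  finally show ?thesis by this
qed

text \<open>Row summation is multiplication by a unitriangular matrix. Read from left to right, rows
  cumulated up to \<open>x j\<close> may be replaced by their increments, which is how both the step
  function and the running integral are handled.\<close>

lemma fdet_partial_sums: "fdet n (\<lambda>j k. \<Sum>i\<le>j. f i k) = fdet n f"
proof -
  let ?T = "Matrix.mat n n (\<lambda>(j, i). if i \<le> j then 1 else (0::real))"
  let ?A = "Matrix.mat n n (\<lambda>(j, k). f j k)"
  have "Matrix.mat n n (\<lambda>(j, k). \<Sum>i\<le>j. f i k) = ?T * ?A"
  proof (rule eq_matI)
    fix j k assume "j < dim_row (?T * ?A)" "k < dim_col (?T * ?A)"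
    then have jk: "j < n" "k < n" by auto
    then have "(?T * ?A) $$ (j, k) = (\<Sum>i = 0..<n. (if i \<le> j then 1 else 0) * f i k)"
      by (simp add: scalar_prod_def)
    also have "\<dots> = (\<Sum>i = 0..<n. if i \<le> j then f i k else 0)"
      by (intro sum.cong) auto
    also have "\<dots> = (\<Sum>i | i \<in> {0..<n} \<and> i \<le> j. f i k)"
      by (subst sum.inter_filter) auto
    also have "{i. i \<in> {0..<n} \<and> i \<le> j} = {..j}" using jk by auto
    finally show "Matrix.mat n n (\<lambda>(j, k). \<Sum>i\<le>j. f i k) $$ (j, k) = (?T * ?A) $$ (j, k)"
      using jk by simp
  qed auto
  moreover have "Determinant.det (?T * ?A) = Determinant.det ?T * Determinant.det ?A"
    by (rule det_mult) auto
  moreover have "Determinant.det ?T = 1"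
  proof -
    have "Determinant.det ?T = prod_list (diag_mat ?T)"
      by (rule det_lower_triangular[of n]) auto
    also have "\<dots> = 1" by (simp add: prod_list_diag_prod)
    finally show ?thesis .
  qed
  ultimately show ?thesis by simp
qed

lemma fdet_lower_triangular_nonneg:
  assumes "\<And>j k. j < k \<Longrightarrow> k < n \<Longrightarrow> f j k = 0" "\<And>j. j < n \<Longrightarrow> f j j \<ge> 0"
  shows "fdet n f \<ge> 0"
proof -
  have "fdet n f = prod_list (diag_mat (Matrix.mat n n (\<lambda>(j, k). f j k)))"
    by (rule det_lower_triangular[of n]) (use assms in auto)
  also have "\<dots> \<ge> 0" by (auto simp: prod_list_diag_prod intro!: prod_nonneg assms)
  finally show ?thesis .
qed

lemma fdet_identical_columns:
  assumes "k < n" "l < n" "k \<noteq> l" "\<And>j. j < n \<Longrightarrow> f j k = f j l"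
  shows "fdet n f = 0"
  by (rule det_identical_columns[of _ n k l]) (use assms in \<open>auto intro!: eq_vecI\<close>)

text \<open>In the Leibniz formula every term contains each row factor and each column factor
  exactly once.\<close>

lemma fdet_scale: "fdet n (\<lambda>j k. a j * b k * f j k) = (\<Prod>j<n. a j) * (\<Prod>k<n. b k) * fdet n f"
proof -
  have "(\<Prod>i = 0..<n. a i * b (p i) * f i (p i)) =
      (\<Prod>j<n. a j) * (\<Prod>k<n. b k) * (\<Prod>i = 0..<n. f i (p i))" if "p permutes {0..<n}" for p
  proof -
    have "(\<Prod>i = 0..<n. b (p i)) = (\<Prod>k = 0..<n. b k)"
      using prod.permute[OF that, of b] by (simp add: o_def)
    then show ?thesis by (simp add: prod.distrib lessThan_atLeast0)
  qed
  moreover have "fdet n g = (\<Sum>p | p permutes {0..<n}. signof p * (\<Prod>i = 0..<n. g i (p i)))" for g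
    by (subst det_def', auto intro!: sum.cong prod.cong arg_cong2[where f = "(*)"])
  ultimately show ?thesis
    by (simp add: sum_distrib_left mult_ac)
qed

lemma fdet_tendsto:
  assumes "\<And>j k. ((\<lambda>i. f i j k) \<longlongrightarrow> g j k) F"
  shows "((\<lambda>i. fdet n (f i)) \<longlongrightarrow> fdet n g) F"
  using assms
proof (induction n arbitrary: f g)
  case (Suc n)
  show ?case
    by (subst (1 2) fdet_expand_column[of 0]) (auto intro!: tendsto_intros Suc)
qed simp

text \<open>By induction on the number of columns. The determinant of the columns together with \<open>u\<close> vanishes,
  while all terms in its expansion along \<open>u\<close> have the same sign. So each minor is zero, which makes one of
  the columns redundant on the first \<open>m\<close> rows.\<close>
lemma tn_combination_not_alternating:
  fixes a :: "nat \<Rightarrow> nat \<Rightarrow> real"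
  assumes tn: "\<And>n r c. strict_mono r \<Longrightarrow> strict_mono c \<Longrightarrow> fdet n (\<lambda>j k. a (r j) (c k)) \<ge> 0"
    and c: "strict_mono c"
    and u: "\<And>j. j \<le> m \<Longrightarrow> u j = (\<Sum>i<m. v i * a j (c i))"
    and alt: "\<And>j. j \<le> m \<Longrightarrow> \<sigma> * (-1) ^ j * u j > 0"
  shows False
  using c u alt
proof (induction m arbitrary: c v)
  case 0
  then show ?case using "0"(2)[of 0] "0"(3)[of 0] by simp
next
  case (Suc m)
  let ?B = "\<lambda>j k. if k = Suc m then u j else a j (c k)"
  have ins: "strict_mono (insert_index j)" for j
    by (auto simp: strict_mono_def insert_index_def)
  define M where "M j = fdet (Suc m) (\<lambda>i k. a (insert_index j i) (c k))" for j
  have M_nonneg: "M j \<ge> 0" for j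
    unfolding M_def by (rule tn[OF ins Suc.prems(1)])
  \<comment> \<open>The last column depends linearly on the others: \<open>v\<close> followed by
    \<open>-1\<close> is a null vector.\<close>
  have "fdet (Suc (Suc m)) ?B = 0"
  proof -
    let ?w = "Matrix.vec (Suc (Suc m)) (\<lambda>i. if i = Suc m then -1 else v i)"
    have "\<exists>w. w \<in> carrier_vec (Suc (Suc m)) \<and> w \<noteq> 0\<^sub>v (Suc (Suc m)) \<and>
        Matrix.mat (Suc (Suc m)) (Suc (Suc m)) (\<lambda>(j, k). ?B j k) *\<^sub>v w = 0\<^sub>v (Suc (Suc m))"
    proof (intro exI conjI)
      show "?w \<noteq> 0\<^sub>v (Suc (Suc m))"
        by (auto simp: Matrix.vec_eq_iff intro!: exI[of _ "Suc m"])
      show "Matrix.mat (Suc (Suc m)) (Suc (Suc m)) (\<lambda>(j, k). ?B j k) *\<^sub>v ?w = 0\<^sub>v (Suc (Suc m))"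
        by (rule eq_vecI) (auto simp: scalar_prod_def Suc.prems(2) lessThan_atLeast0 mult.commute)
    qed auto
    then show ?thesis
      by (subst det_0_iff_vec_prod_zero[of _ "Suc (Suc m)"]) auto
  qed
  also have "fdet (Suc (Suc m)) ?B = (\<Sum>j<Suc (Suc m). u j * ((-1) ^ (j + Suc m) * M j))"
  proof (subst fdet_expand_column[of "Suc m"], simp, rule sum.cong)
    fix j
    have "fdet (Suc (Suc m) - 1) (\<lambda>i k. ?B (insert_index j i) (insert_index (Suc m) k)) = M j"
      unfolding M_def diff_Suc_1 by (rule fdet_cong) (simp add: insert_index_def)
    then show "?B j (Suc m) * ((-1) ^ (j + Suc m) *
        fdet (Suc (Suc m) - 1) (\<lambda>i k. ?B (insert_index j i) (insert_index (Suc m) k))) =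
        u j * ((-1) ^ (j + Suc m) * M j)" by simp
  qed simp
  finally have 0: "(\<Sum>j<Suc (Suc m). u j * ((-1) ^ (j + Suc m) * M j)) = 0" .
  \<comment> \<open>Up to one common sign all terms of the expansion are nonnegative, since
    \<open>u\<close> alternates exactly as the cofactor signs do; so each of them is zero.\<close>
  have "(\<sigma> * (-1) ^ j * u j) * M j = \<sigma> * (-1) ^ Suc m * (u j * ((-1) ^ (j + Suc m) * M j))" for j
    by (simp add: power_add)
  then have "(\<Sum>j<Suc (Suc m). (\<sigma> * (-1) ^ j * u j) * M j) = 0"
    by (simp only: sum_distrib_left[symmetric] 0 mult_zero_right)
  then have "\<forall>j\<in>{..<Suc (Suc m)}. (\<sigma> * (-1) ^ j * u j) * M j = 0"
    by (subst (asm) sum_nonneg_eq_0_iff)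
       (auto intro!: mult_nonneg_nonneg M_nonneg less_imp_le[OF Suc.prems(3)])
  then have "M (Suc m) = 0" using Suc.prems(3)[of "Suc m"] by force
  also have "M (Suc m) = fdet (Suc m) (\<lambda>j k. a j (c k))"
    unfolding M_def by (rule fdet_cong) (simp add: insert_index_def)
  finally obtain w where w: "w \<in> carrier_vec (Suc m)" "w \<noteq> 0\<^sub>v (Suc m)"
    "Matrix.mat (Suc m) (Suc m) (\<lambda>(j, k). a j (c k)) *\<^sub>v w = 0\<^sub>v (Suc m)"
    by (subst (asm) det_0_iff_vec_prod_zero[of _ "Suc m"]) auto
  define W where "W i = vec_index w i" for i
  obtain i0 where i0: "i0 \<le> m" "W i0 \<noteq> 0"
    using w(1,2) by (auto simp: W_def less_Suc_eq_le Matrix.vec_eq_iff)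
  have W: "(\<Sum>i<Suc m. W i * a j (c i)) = 0" if "j \<le> m" for j
  proof -
    have "vec_index (Matrix.mat (Suc m) (Suc m) (\<lambda>(j, k). a j (c k)) *\<^sub>v w) j = 0"
      using that w(3) by simp
    then show ?thesis
      using that w(1) by (simp add: scalar_prod_def W_def lessThan_atLeast0 mult.commute)
  qed
  \<comment> \<open>A multiple of the null vector \<open>W\<close> is subtracted to kill the
    coefficient at \<open>i0\<close>. The relation \<open>W\<close> holds only on the rows up to
    \<open>m\<close>, which is all that the induction hypothesis asks for.\<close>
  define v' where "v' i = v i - v i0 / W i0 * W i" for i
  have "v' i0 = 0" using i0 by (simp add: v'_def)
  show False
  proof (rule Suc.IH[of "c \<circ> insert_index i0" "v' \<circ> insert_index i0"])
    show "strict_mono (c \<circ> insert_index i0)"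
      using ins Suc.prems(1) by (auto simp: strict_mono_def)
    show "\<sigma> * (-1) ^ j * u j > 0" if "j \<le> m" for j using that Suc.prems(3) by simp
    fix j assume j: "j \<le> m"
    have "u j = (\<Sum>i<Suc m. v i * a j (c i)) - v i0 / W i0 * (\<Sum>i<Suc m. W i * a j (c i))"
      using Suc.prems(2)[of j] W[OF j] j by simp
    also have "\<dots> = (\<Sum>i<Suc m. v' i * a j (c i))"
      by (simp add: v'_def sum_subtractf algebra_simps sum_distrib_left)
    also have "\<dots> = (\<Sum>i\<in>{..<Suc m} - {i0}. v' i * a j (c i))"
      using i0 \<open>v' i0 = 0\<close> by (intro sum.mono_neutral_right) auto
    also have "{..<Suc m} - {i0} = insert_index i0 ` {..<m}"
      using insert_index_image[of i0 m] i0 by (auto simp: lessThan_atLeast0)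
    also have "(\<Sum>i\<in>insert_index i0 ` {..<m}. v' i * a j (c i)) =
        (\<Sum>i<m. (v' \<circ> insert_index i0) i * a j ((c \<circ> insert_index i0) i))"
      using insert_index_inj_on[of i0] by (subst sum.reindex) (auto intro: inj_on_subset)
    finally show "u j = \<dots>" .
  qed
qed

section \<open>Totally positive kernels\<close>

definition tp_kernel :: "(real \<Rightarrow> real) \<Rightarrow> bool" where
  "tp_kernel L \<longleftrightarrow> (\<forall>n (x :: nat \<Rightarrow> real) (y :: nat \<Rightarrow> real).
     strict_mono_on {..<n} x \<longrightarrow> strict_mono_on {..<n} y \<longrightarrow> fdet n (\<lambda>j k. L (x j - y k)) \<ge> 0)"

text \<open>An exponential of \<open>x j - y k\<close> is a row factor times a column factor, so the
  determinant is only multiplied by nonnegative numbers.\<close>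

lemma tp_kernel_exp_mult:
  assumes "tp_kernel L" "c \<ge> 0"
  shows "tp_kernel (\<lambda>x. c * exp (b * x) * L x)"
  unfolding tp_kernel_def
proof (intro allI impI)
  fix n :: nat and x y :: "nat \<Rightarrow> real"
  assume xy: "strict_mono_on {..<n} x" "strict_mono_on {..<n} y"
  have "fdet n (\<lambda>j k. c * exp (b * (x j - y k)) * L (x j - y k)) =
      fdet n (\<lambda>j k. (c * exp (b * x j)) * exp (- b * y k) * L (x j - y k))"
    by (rule fdet_cong) (simp add: right_diff_distrib exp_diff exp_minus field_simps)
  also have "\<dots> = (\<Prod>j<n. c * exp (b * x j)) * (\<Prod>k<n. exp (- b * y k)) * fdet n (\<lambda>j k. L (x j - y k))"
    by (rule fdet_scale)
  also have "\<dots> \<ge> 0"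
    using assms xy by (intro mult_nonneg_nonneg prod_nonneg) (auto simp: tp_kernel_def)
  finally show "fdet n (\<lambda>j k. c * exp (b * (x j - y k)) * L (x j - y k)) \<ge> 0" .
qed

text \<open>After differencing, column \<open>k\<close> has its only possible 1 in the row
  \<open>i\<close> with \<open>x (i - 1) < y k \<le> x i\<close>. If every \<open>y (Suc k)\<close>
  lies beyond \<open>x k\<close>, the matrix is lower triangular; at the first failure
  \<open>y k\<close> and \<open>y (Suc k)\<close> fall into the same gap and two columns
  coincide.\<close>

lemma tp_kernel_heaviside: "tp_kernel (\<lambda>x. if x \<ge> 0 then 1 else 0)"
  unfolding tp_kernel_def
proof (intro allI impI)
  fix n :: nat and x y :: "nat \<Rightarrow> real"
  assume x: "strict_mono_on {..<n} x" and y: "strict_mono_on {..<n} y"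
  define f where "f i k = (if y k \<le> x i \<and> (i = 0 \<or> x (i - 1) < y k) then 1 else 0 :: real)" for i k
  have x_le: "x i \<le> x j" if "i \<le> j" "j < n" for i j
    using that by (intro mono_onD[OF strict_mono_on_imp_mono_on[OF x]]) auto
  have "(\<Sum>i\<le>j. f i k) = (if y k \<le> x j then 1 else 0)" if "j < n" for j k
    using that
  proof (induction j)
    case (Suc j)
    then show ?case using x_le[of j "Suc j"] by (auto simp: f_def)
  qed (simp add: f_def)
  then have "fdet n (\<lambda>j k. if x j - y k \<ge> 0 then 1 else 0) = fdet n (\<lambda>j k. \<Sum>i\<le>j. f i k)"
    by (intro fdet_cong) simp
  also have "\<dots> = fdet n f" by (rule fdet_partial_sums)
  also have "\<dots> \<ge> 0"
  proof (cases "\<forall>k. Suc k < n \<longrightarrow> x k < y (Suc k)")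
    case True
    show ?thesis
    proof (rule fdet_lower_triangular_nonneg)
      fix j k assume jk: "j < k" "k < n"
      then obtain l where l: "k = Suc l" "j \<le> l" by (cases k) auto
      then show "f j k = 0" using x_le[of j l] True jk by (auto simp: f_def)
    qed (simp add: f_def)
  next
    case False
    define k where "k = (LEAST k. Suc k < n \<and> y (Suc k) \<le> x k)"
    have k: "Suc k < n" "y (Suc k) \<le> x k"
      using LeastI_ex[of "\<lambda>k. Suc k < n \<and> y (Suc k) \<le> x k"] False unfolding k_def by force+
    have ky: "y k < y (Suc k)" using y k by (auto simp: strict_mono_on_def)
    have kx: "x (k - 1) < y k" if "k > 0"
      using not_less_Least[of "k - 1" "\<lambda>k. Suc k < n \<and> y (Suc k) \<le> x k"] that k
      by (auto simp flip: k_def)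
    have "f j k = f j (Suc k)" if "j < n" for j
    proof (cases j k rule: linorder_cases)
      case less
      then have "x j \<le> x (k - 1)" using k by (intro x_le) auto
      then show ?thesis using kx less ky by (auto simp: f_def)
    next
      case equal
      then show ?thesis using kx ky k by (auto simp: f_def)
    next
      case greater
      then have "x k \<le> x (j - 1)" using that by (intro x_le) auto
      then show ?thesis using greater ky k by (auto simp: f_def)
    qed
    then have "fdet n f = 0" using k by (intro fdet_identical_columns[of k n "Suc k"]) auto
    then show ?thesis by simp
  qed
  finally show "fdet n (\<lambda>j k. if x j - y k \<ge> 0 then 1 else 0) \<ge> 0" .
qed

text \<open>After differencing, row \<open>i\<close> is an integral over the i-th gap cut out by the
  points \<open>x\<close>. Sample points from successive gaps are automatically increasing, so total
  positivity of \<open>F\<close> applies to each choice of them and is then averaged.\<close>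

lemma tp_kernel_integral:
  assumes F: "tp_kernel F" and int: "\<And>x. integrable lborel (\<lambda>t. indicator {..x} t * F t)"
  shows "tp_kernel (\<lambda>x. \<integral>t. indicator {..x} t * F t \<partial>lborel)"
  unfolding tp_kernel_def
proof (intro allI impI)
  fix n :: nat and x y :: "nat \<Rightarrow> real"
  assume x: "strict_mono_on {..<n} x" and y: "strict_mono_on {..<n} y"
  have x_le: "x i \<le> x j" if "i \<le> j" "j < n" for i j
    using that by (intro mono_onD[OF strict_mono_on_imp_mono_on[OF x]]) auto
  define I where "I i = (if i = 0 then {..x 0} else {x (i - 1)<..x i})" for i
  have I_sets [measurable]: "I i \<in> sets borel" for i by (simp add: I_def)
  define K where "K i k u = indicator (I i) u * F (u - y k)" for i k u
  have int': "integrable lborel (\<lambda>u. indicator {..x i} u * F (u - y k))" for i k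
  proof -
    have "integrable lborel (\<lambda>u. indicator {..x i - y k} (- y k + 1 * u) * F (- y k + 1 * u))"
      by (rule lborel_integrable_real_affine[OF int]) simp
    then show ?thesis by (simp add: indicator_def algebra_simps)
  qed
  have intK: "integrable lborel (K i k)" for i k
  proof -
    have "integrable lborel (\<lambda>u. indicator (I i) u *\<^sub>R (indicator {..x i} u * F (u - y k)))"
      by (rule integrable_mult_indicator[OF _ int']) simp
    moreover have "(\<lambda>u. indicator (I i) u *\<^sub>R (indicator {..x i} u * F (u - y k))) = K i k"
      by (auto simp: K_def I_def fun_eq_iff indicator_def)
    ultimately show ?thesis by simp
  qed
  have "(\<integral>t. indicator {..x j - y k} t * F t \<partial>lborel) = (\<Sum>i\<le>j. \<integral>u. K i k u \<partial>lborel)" if "j < n" for j k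
  proof -
    have "(\<integral>t. indicator {..x j - y k} t * F t \<partial>lborel) =
        (\<integral>u. indicator {..x j - y k} (- y k + 1 * u) * F (- y k + 1 * u) \<partial>lborel)"
      by (subst lborel_integral_real_affine[where c = 1 and t = "- y k"]) auto
    also have "\<dots> = (\<integral>u. (\<Sum>i\<le>j. K i k u) \<partial>lborel)"
    proof (rule Bochner_Integration.integral_cong)
      fix u
      have "(\<Sum>i\<le>j. indicator (I i) u) = (indicator {..x j} u :: real)" using that
      proof (induction j)
        case (Suc j)
        then show ?case using x_le[of j "Suc j"] by (auto simp: I_def indicator_def)
      qed (simp add: I_def)
      then show "indicator {..x j - y k} (- y k + 1 * u) * F (- y k + 1 * u) = (\<Sum>i\<le>j. K i k u)"
        by (simp add: K_def indicator_def algebra_simps flip: sum_distrib_left)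
    qed simp
    also have "\<dots> = (\<Sum>i\<le>j. \<integral>u. K i k u \<partial>lborel)"
      by (rule Bochner_Integration.integral_sum) (rule intK)
    finally show ?thesis .
  qed
  then have "fdet n (\<lambda>j k. \<integral>t. indicator {..x j - y k} t * F t \<partial>lborel) =
      fdet n (\<lambda>j k. \<Sum>i\<le>j. \<integral>u. K i k u \<partial>lborel)"
    by (intro fdet_cong) simp
  also have "\<dots> = fdet n (\<lambda>j k. \<integral>u. K j k u \<partial>lborel)" by (rule fdet_partial_sums)
  \<comment> \<open>Here the rows are to be averaged, whereas the averaging lemma works on
    columns.\<close>
  also have "\<dots> = fdet n (\<lambda>j k. \<integral>u. K k j u \<partial>lborel)" by (rule fdet_transpose[symmetric])
  also have "\<dots> \<ge> 0"
  proof (rule fdet_integral_nonneg[where I = I])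
    fix t assume t: "\<And>k. k < n \<Longrightarrow> t k \<in> I k"
    have tm: "strict_mono_on {..<n} t"
    proof (rule strict_mono_onI)
      fix i j assume ij: "i \<in> {..<n}" "j \<in> {..<n}" "i < j"
      have "t i \<le> x i" using t[of i] ij by (auto simp: I_def split: if_splits)
      also have "\<dots> \<le> x (j - 1)" using ij by (intro x_le) auto
      also have "\<dots> < t j" using t[of j] ij by (auto simp: I_def split: if_splits)
      finally show "t i < t j" .
    qed
    have "fdet n (\<lambda>j k. K k j (t k)) = fdet n (\<lambda>j k. K j k (t j))" by (rule fdet_transpose)
    also have "\<dots> = fdet n (\<lambda>j k. F (t j - y k))"
      using t by (intro fdet_cong) (simp add: K_def)
    also have "\<dots> \<ge> 0" using F tm y by (simp add: tp_kernel_def)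
    finally show "fdet n (\<lambda>j k. K k j (t k)) \<ge> 0" .
  qed (use intK in \<open>auto simp: K_def[abs_def]\<close>)
  finally show "fdet n (\<lambda>j k. \<integral>t. indicator {..x j - y k} t * F t \<partial>lborel) \<ge> 0" .
qed

lemma tp_kernel_tendsto:
  assumes "\<And>i. tp_kernel (f i)" "\<And>x. (\<lambda>i. f i x) \<longlonglongrightarrow> g x"
  shows "tp_kernel g"
  unfolding tp_kernel_def
proof (intro allI impI)
  fix n :: nat and x y :: "nat \<Rightarrow> real"
  assume "strict_mono_on {..<n} x" "strict_mono_on {..<n} y"
  then have "\<forall>i. fdet n (\<lambda>j k. f i (x j - y k)) \<ge> 0" using assms(1) by (simp add: tp_kernel_def)
  then show "fdet n (\<lambda>j k. g (x j - y k)) \<ge> 0"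
    by (intro LIMSEQ_le_const[OF fdet_tendsto[of "\<lambda>i j k. f i (x j - y k)"]]) (auto intro: assms)
qed

section \<open>Exponential densities and convolution with them\<close>

definition exp_dens :: "real \<Rightarrow> real \<Rightarrow> real" where
  "exp_dens a x = (if x \<ge> 0 then a * exp (- a * x) else 0)"

definition conv_exp :: "real \<Rightarrow> (real \<Rightarrow> real) \<Rightarrow> real \<Rightarrow> real" where
  "conv_exp a h x = (\<integral>u. exp_dens a u * h (x - u) \<partial>lborel)"

lemma exp_dens_measurable [measurable]: "exp_dens a \<in> borel_measurable borel"
  unfolding exp_dens_def by measurable

lemma exp_dens_nonneg: "a \<ge> 0 \<Longrightarrow> exp_dens a x \<ge> 0"
  by (simp add: exp_dens_def)

lemma tp_kernel_exp_dens: "a \<ge> 0 \<Longrightarrow> tp_kernel (exp_dens a)"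
  using tp_kernel_exp_mult[OF tp_kernel_heaviside, of a "- a"]
  by (simp add: exp_dens_def[abs_def] if_distrib cong: if_cong)

lemma has_bochner_integral_exp_complex:
  fixes z :: complex
  assumes z: "Re z > 0"
  shows "has_bochner_integral lborel (\<lambda>x. indicator {0..} x *\<^sub>R exp (- z * complex_of_real x)) (1 / z)"
proof -
  have z0: "z \<noteq> 0" using z by auto
  have "integrable lborel (\<lambda>x. indicator {0..} x *\<^sub>R exp (- Re z * x))"
  proof -
    have "((\<lambda>x. exp (- Re z * x)) has_integral exp (- Re z * 0) / Re z) {0..}"
      by (rule has_integral_exp_minus_to_infinity) (use z in auto)
    then have "(\<lambda>x. exp (- Re z * x)) absolutely_integrable_on {0..}"
      by (intro nonnegative_absolutely_integrable_1) auto
    then show ?thesis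
      by (auto simp: set_integrable_def intro!: integrable_completion[THEN iffD1])
  qed
  then have int: "integrable lborel (\<lambda>x. indicator {0..} x *\<^sub>R exp (- z * complex_of_real x))"
    by (rule Bochner_Integration.integrable_bound) (auto simp: indicator_def)
  have "(\<lambda>n. \<integral>x. indicator {0..real n} x *\<^sub>R exp (- z * complex_of_real x) \<partial>lborel) \<longlonglongrightarrow>
      (\<integral>x. indicator {0..} x *\<^sub>R exp (- z * complex_of_real x) \<partial>lborel)"
  proof (rule integral_dominated_convergence[where w = "\<lambda>x. norm (indicator {0..} x *\<^sub>R exp (- z * complex_of_real x))"])
    show "AE x in lborel. (\<lambda>n. indicator {0..real n} x *\<^sub>R exp (- z * complex_of_real x))
        \<longlonglongrightarrow> indicator {0..} x *\<^sub>R exp (- z * complex_of_real x)"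
    proof (rule AE_I2)
      fix x :: real
      have "\<forall>\<^sub>F n in sequentially. indicator {0..real n} x *\<^sub>R exp (- z * complex_of_real x) =
          indicator {0..} x *\<^sub>R exp (- z * complex_of_real x)"
        using eventually_ge_at_top[of "nat \<lceil>x\<rceil>"]
        by eventually_elim (auto simp: indicator_def nat_le_iff ceiling_le_iff)
      then show "(\<lambda>n. indicator {0..real n} x *\<^sub>R exp (- z * complex_of_real x))
          \<longlonglongrightarrow> indicator {0..} x *\<^sub>R exp (- z * complex_of_real x)"
        by (rule tendsto_eventually)
    qed
    show "integrable lborel (\<lambda>x. norm (indicator {0..} x *\<^sub>R exp (- z * complex_of_real x)))"
      by (rule integrable_norm[OF int])
  qed (auto simp: indicator_def)
  moreover have "(\<integral>x. indicator {0..real n} x *\<^sub>R exp (- z * complex_of_real x) \<partial>lborel) =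
      - exp (- z * of_nat n) / z - (- 1 / z)" for n
  proof -
    have "(\<integral>x. indicator {0..real n} x *\<^sub>R exp (- z * complex_of_real x) \<partial>lborel) =
      - exp (- z * of_real (real n)) / z - (- exp (- z * of_real 0) / z)"
    proof (rule integral_FTC_Icc)
      fix x :: real
      have "((\<lambda>w. - exp (- z * w) / z) has_field_derivative exp (- z * of_real x)) (at (of_real x))"
        using z0 by (auto intro!: derivative_eq_intros)
      then have "((\<lambda>x. - exp (- z * of_real x) / z) has_vector_derivative exp (- z * of_real x)) (at x)"
        by (rule has_vector_derivative_real_field)
      then show "((\<lambda>x. - exp (- z * of_real x) / z) has_vector_derivative exp (- z * of_real x))
          (at x within {0..real n})"
        by (rule has_vector_derivative_at_within)
    qed (auto intro!: continuous_intros)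
    then show ?thesis by simp
  qed
  moreover have "(\<lambda>n. - exp (- z * of_nat n) / z - (- 1 / z)) \<longlonglongrightarrow> - 0 / z - (- 1 / z)"
  proof (intro tendsto_intros)
    have "(\<lambda>n. exp (- Re z * real n)) \<longlonglongrightarrow> 0" using z by real_asymp
    then show "(\<lambda>n. exp (- z * of_nat n)) \<longlonglongrightarrow> 0"
      by (subst tendsto_norm_zero_iff[symmetric]) simp
  qed (use z0 in auto)
  ultimately have "(\<integral>x. indicator {0..} x *\<^sub>R exp (- z * complex_of_real x) \<partial>lborel) = 1 / z"
    by (auto dest: LIMSEQ_unique)
  then show ?thesis using int by (simp add: has_bochner_integral_iff)
qed

lemma has_bochner_integral_exp_dens_complex:
  fixes s :: complex
  assumes "Re s > - a"
  shows "has_bochner_integral lborel (\<lambda>x. exp (- s * of_real x) * of_real (exp_dens a x)) (a / (a + s))"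
proof -
  have "has_bochner_integral lborel
      (\<lambda>x. of_real a * (indicator {0..} x *\<^sub>R exp (- (a + s) * complex_of_real x))) (a * (1 / (a + s)))"
    by (intro has_bochner_integral_mult_right has_bochner_integral_exp_complex) (use assms in auto)
  moreover have "(\<lambda>x. of_real a * (indicator {0..} x *\<^sub>R exp (- (a + s) * complex_of_real x))) =
      (\<lambda>x. exp (- s * of_real x) * of_real (exp_dens a x))"
  proof
    fix x
    have "exp (- (a + s) * complex_of_real x) = exp (- s * of_real x) * of_real (exp (- a * x))"
      unfolding exp_of_real[symmetric] exp_add[symmetric] by (simp add: algebra_simps)
    then show "of_real a * (indicator {0..} x *\<^sub>R exp (- (a + s) * complex_of_real x)) =
      exp (- s * of_real x) * of_real (exp_dens a x)"
      by (simp add: exp_dens_def indicator_def)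
  qed
  ultimately show ?thesis by simp
qed

lemma has_bochner_integral_exp_dens_real:
  fixes s :: real
  assumes "s > - a"
  shows "has_bochner_integral lborel (\<lambda>x. exp (- s * x) * exp_dens a x) (a / (a + s))"
proof -
  have "has_bochner_integral lborel (\<lambda>x. Re (exp (- of_real s * of_real x) * of_real (exp_dens a x)))
      (Re (of_real a / (of_real a + of_real s)))"
    by (intro has_bochner_integral_Re has_bochner_integral_exp_dens_complex) (use assms in auto)
  moreover have "(\<lambda>x. Re (exp (- of_real s * of_real x) * of_real (exp_dens a x))) =
      (\<lambda>x. exp (- s * x) * exp_dens a x)"
    by (simp add: Re_exp)
  moreover have "Re (of_real a / (of_real a + of_real s)) = a / (a + s)"
    by (simp flip: of_real_add of_real_divide)
  ultimately show ?thesis by (simp only:)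
qed

lemma integrable_exp_dens: "a > 0 \<Longrightarrow> integrable lborel (exp_dens a)"
  and integral_exp_dens: "a > 0 \<Longrightarrow> (\<integral>x. exp_dens a x \<partial>lborel) = 1"
  using has_bochner_integral_exp_dens_real[of a 0] by (auto simp: has_bochner_integral_iff)

lemma integrable_shift_reflect:
  fixes f :: "real \<Rightarrow> 'a :: {banach, second_countable_topology}"
  assumes "integrable lborel f"
  shows "integrable lborel (\<lambda>u. f (x - u))"
  using lborel_integrable_real_affine[OF assms, of "-1" x] by simp

lemma integral_shift_reflect:
  fixes f :: "real \<Rightarrow> 'a :: {banach, second_countable_topology}"
  shows "(\<integral>u. f (x - u) \<partial>lborel) = (\<integral>u. f u \<partial>lborel)"
  using lborel_integral_real_affine[of "-1" f x] by simp

abbreviation laplace_term :: "complex \<Rightarrow> (real \<Rightarrow> real) \<Rightarrow> real \<Rightarrow> complex" where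
  "laplace_term s h x \<equiv> exp (- s * complex_of_real x) * complex_of_real (h x)"

text \<open>The rate \<delta> will be the same for all finite convolutions and only \<open>C\<close>
  varies, so that bounding the constants yields one integrable majorant.\<close>

definition exp_bounded :: "real \<Rightarrow> real \<Rightarrow> (real \<Rightarrow> real) \<Rightarrow> bool" where
  "exp_bounded \<delta> C h \<longleftrightarrow> h \<in> borel_measurable borel \<and> (\<forall>x<0. h x = 0) \<and>
     (\<forall>x. 0 \<le> h x \<and> h x \<le> C * exp (- \<delta> * x))"

lemma exp_bounded_integrable:
  assumes h: "exp_bounded \<delta> C h" and s: "Re s > - \<delta>"
  shows "integrable lborel (\<lambda>x. laplace_term s h x)"
proof -
  have [measurable]: "h \<in> borel_measurable borel" using h by (simp add: exp_bounded_def)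
  define b where "b = Re s + \<delta>"
  have b: "b > 0" using s by (simp add: b_def)
  show ?thesis
  proof (rule Bochner_Integration.integrable_bound[where f = "\<lambda>x. C / b * exp_dens b x"])
    show "integrable lborel (\<lambda>x. C / b * exp_dens b x)"
      using b by (intro integrable_mult_right integrable_exp_dens)
    have "norm (laplace_term s h x) \<le> norm (C / b * exp_dens b x)" for x
    proof (cases "x \<ge> 0")
      case True
      have "0 \<le> h x" "h x \<le> C * exp (- \<delta> * x)" using h by (auto simp: exp_bounded_def)
      moreover from this have "C \<ge> 0" by (meson exp_gt_zero order.trans zero_le_mult_iff linorder_not_le)
      ultimately have "exp (- (Re s * x)) * h x \<le> exp (- (Re s * x)) * (C * exp (- \<delta> * x))" "C \<ge> 0"
        by (auto intro!: mult_left_mono)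
      moreover have "exp (- (Re s * x)) * (C * exp (- \<delta> * x)) = C * (exp (- (Re s * x)) * exp (- \<delta> * x))"
        by simp
      moreover have "exp (- (Re s * x)) * exp (- \<delta> * x) = exp (- (b * x))"
        unfolding exp_add[symmetric] by (simp add: b_def algebra_simps)
      ultimately have "exp (- (Re s * x)) * h x \<le> C * exp (- (b * x))" "C \<ge> 0" by metis+
      then show ?thesis using True b \<open>0 \<le> h x\<close>
        by (simp add: norm_mult exp_dens_def abs_mult)
    next
      case False
      then show ?thesis using h by (simp add: exp_bounded_def)
    qed
    then show "AE x in lborel. norm (laplace_term s h x) \<le> norm (C / b * exp_dens b x)"
      by simp
  qed simp
qed

lemma exp_bounded_real_integrable:
  assumes h: "exp_bounded \<delta> C h" and s: "s > - \<delta>"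
  shows "integrable lborel (\<lambda>x. exp (- s * x) * h x)"
proof -
  have "integrable lborel (\<lambda>x. Re (exp (- of_real s * complex_of_real x) * complex_of_real (h x)))"
    by (intro integrable_Re exp_bounded_integrable[OF h]) (use s in auto)
  moreover have "(\<lambda>x. Re (exp (- of_real s * complex_of_real x) * of_real (h x))) = (\<lambda>x. exp (- s * x) * h x)"
    by (simp add: Re_exp)
  ultimately show ?thesis by (simp only:)
qed

lemma conv_exp_integrable:
  assumes h: "exp_bounded \<delta> C h" and d: "0 < \<delta>" "a > 0"
  shows "integrable lborel (\<lambda>u. exp_dens a u * h (x - u))"
proof (rule Bochner_Integration.integrable_bound)
  have [measurable]: "h \<in> borel_measurable borel" using h by (simp add: exp_bounded_def)
  show "(\<lambda>u. exp_dens a u * h (x - u)) \<in> borel_measurable lborel" by measurable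
  have "integrable lborel h" using exp_bounded_real_integrable[OF h, of 0] d by simp
  then show "integrable lborel (\<lambda>u. a * h (x - u))"
    by (intro integrable_mult_right integrable_shift_reflect)
  show "AE u in lborel. norm (exp_dens a u * h (x - u)) \<le> norm (a * h (x - u))"
    using d by (auto simp: exp_dens_def abs_mult intro!: mult_right_mono AE_I2 mult_left_le_one_le)
qed

text \<open>The factor \<open>a / (a - \<delta>)\<close> is the Laplace transform of
  \<open>exp_dens a\<close> at \<open>- \<delta>\<close>; it arises from exp (-\<delta> (x - u)) =
  exp (-\<delta> x) exp (\<delta> u).\<close>

lemma exp_bounded_conv_exp:
  assumes h: "exp_bounded \<delta> C h" and d: "0 < \<delta>" "\<delta> < a"
  shows "exp_bounded \<delta> (C * (a / (a - \<delta>))) (conv_exp a h)"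
proof -
  have hm [measurable]: "h \<in> borel_measurable borel" and h0: "\<And>x. x < 0 \<Longrightarrow> h x = 0"
    and hp: "\<And>x. 0 \<le> h x" and hb: "\<And>x. h x \<le> C * exp (- \<delta> * x)"
    using h by (auto simp: exp_bounded_def)
  have "conv_exp a h x \<ge> 0" for x
    unfolding conv_exp_def using d by (intro integral_nonneg_AE) (auto simp: exp_dens_nonneg hp)
  moreover have "conv_exp a h x = 0" if "x < 0" for x
  proof -
    have "(\<lambda>u. exp_dens a u * h (x - u)) = (\<lambda>u. 0)"
      using h0 that by (auto simp: exp_dens_def fun_eq_iff)
    then show ?thesis by (simp add: conv_exp_def)
  qed
  moreover have "conv_exp a h x \<le> C * (a / (a - \<delta>)) * exp (- \<delta> * x)" for x
  proof -
    have I: "has_bochner_integral lborel (\<lambda>u. exp (- (-\<delta>) * u) * exp_dens a u) (a / (a + (-\<delta>)))"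
      by (rule has_bochner_integral_exp_dens_real) (use d in auto)
    have "conv_exp a h x \<le> (\<integral>u. C * exp (- \<delta> * x) * (exp (- (-\<delta>) * u) * exp_dens a u) \<partial>lborel)"
      unfolding conv_exp_def
    proof (rule integral_mono)
      show "integrable lborel (\<lambda>u. exp_dens a u * h (x - u))"
        by (rule conv_exp_integrable[OF h]) (use d in auto)
      show "integrable lborel (\<lambda>u. C * exp (- \<delta> * x) * (exp (- (-\<delta>) * u) * exp_dens a u))"
        using I by (intro integrable_mult_right) (simp add: has_bochner_integral_iff)
      fix u
      have "exp_dens a u * h (x - u) \<le> exp_dens a u * (C * exp (- \<delta> * (x - u)))"
        using d by (intro mult_left_mono hb exp_dens_nonneg) auto
      also have "exp (- \<delta> * (x - u)) = exp (- \<delta> * x) * exp (- (-\<delta>) * u)"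
        unfolding exp_add[symmetric] by (simp add: algebra_simps)
      finally show "exp_dens a u * h (x - u) \<le> C * exp (- \<delta> * x) * (exp (- (-\<delta>) * u) * exp_dens a u)"
        by (simp add: mult_ac)
    qed
    also have "\<dots> = C * (a / (a - \<delta>)) * exp (- \<delta> * x)"
      using I by (simp add: has_bochner_integral_iff)
    finally show ?thesis .
  qed
  moreover have "conv_exp a h \<in> borel_measurable borel"
    unfolding conv_exp_def by measurable
  ultimately show ?thesis by (auto simp: exp_bounded_def)
qed

lemma tp_kernel_conv_exp:
  assumes h: "exp_bounded \<delta> C h" "tp_kernel h" and d: "0 < \<delta>" "0 < a"
  shows "tp_kernel (conv_exp a h)"
proof -
  have int: "integrable lborel (\<lambda>t. indicator {..x} t * (1 * exp (a * t) * h t))" for x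
  proof (rule Bochner_Integration.integrable_bound)
    show "integrable lborel (\<lambda>t. exp (a * x) * h t)"
      using exp_bounded_real_integrable[OF h(1), of 0] d by (intro integrable_mult_right) auto
    show "(\<lambda>t. indicator {..x} t * (1 * exp (a * t) * h t)) \<in> borel_measurable lborel"
      using h by (auto simp: exp_bounded_def)
    show "AE t in lborel. norm (indicator {..x} t * (1 * exp (a * t) * h t)) \<le> norm (exp (a * x) * h t)"
      using d by (auto simp: indicator_def abs_mult intro!: mult_right_mono)
  qed
  have "tp_kernel (\<lambda>x. a * exp (- a * x) * (\<integral>t. indicator {..x} t * (1 * exp (a * t) * h t) \<partial>lborel))"
    by (intro tp_kernel_exp_mult tp_kernel_integral h int) (use d in auto)
  moreover have "conv_exp a h x = a * exp (- a * x) * (\<integral>t. indicator {..x} t * (1 * exp (a * t) * h t) \<partial>lborel)" for x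
  proof -
    have "a * exp (- a * x) * (\<integral>t. indicator {..x} t * (1 * exp (a * t) * h t) \<partial>lborel) =
        a * exp (- a * x) * (\<integral>u. indicator {..x} (x - u) * (1 * exp (a * (x - u)) * h (x - u)) \<partial>lborel)"
      by (simp only: integral_shift_reflect[of "\<lambda>t. indicator {..x} t * (1 * exp (a * t) * h t)" x])
    also have "\<dots> = (\<integral>u. a * exp (- a * x) * (indicator {..x} (x - u) * (1 * exp (a * (x - u)) * h (x - u))) \<partial>lborel)"
      by (rule integral_mult_right_zero[symmetric])
    also have "\<dots> = conv_exp a h x"
      unfolding conv_exp_def
    proof (rule Bochner_Integration.integral_cong)
      fix u
      have "- a * x + a * (x - u) = - a * u" by (simp add: right_diff_distrib)
      then have eq: "exp (- a * x) * exp (a * (x - u)) = exp (- a * u)"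
        by (simp only: exp_add[symmetric])
      have "a * exp (- a * x) * (indicator {..x} (x - u) * (1 * exp (a * (x - u)) * h (x - u))) =
          a * (exp (- a * x) * exp (a * (x - u))) * (indicator {..x} (x - u) * h (x - u))"
        by (simp only: mult_ac mult_1_left)
      also have "\<dots> = exp_dens a u * h (x - u)"
        unfolding eq by (cases "u \<ge> 0") (simp_all add: exp_dens_def)
      finally show "a * exp (- a * x) * (indicator {..x} (x - u) * (1 * exp (a * (x - u)) * h (x - u))) =
          exp_dens a u * h (x - u)" .
    qed simp
    finally show ?thesis by (rule sym)
  qed
  ultimately show ?thesis by (simp add: tp_kernel_def)
qed

section \<open>Infinite convolutions of exponential densities\<close>

lemma laplace_conv_exp:
  fixes s :: complex
  assumes h: "exp_bounded \<delta> C h" and d: "0 < \<delta>" "\<delta> < a" and s: "Re s > - \<delta>"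
  shows "(\<integral>x. laplace_term s (conv_exp a h) x \<partial>lborel) =
    a / (a + s) * (\<integral>x. laplace_term s h x \<partial>lborel)"
proof -
  have hm [measurable]: "h \<in> borel_measurable borel" using h by (simp add: exp_bounded_def)
  define E where "E u = exp (- s * complex_of_real u) * complex_of_real (exp_dens a u)" for u
  define H where "H x = laplace_term s h x" for x
  have [measurable]: "E \<in> borel_measurable borel" "H \<in> borel_measurable borel"
    unfolding E_def H_def by measurable
  have E: "has_bochner_integral lborel E (a / (a + s))"
    unfolding E_def by (rule has_bochner_integral_exp_dens_complex) (use s d in auto)
  then have E': "integrable lborel E" "(\<integral>u. E u \<partial>lborel) = a / (a + s)"
    by (auto simp: has_bochner_integral_iff)
  have H: "integrable lborel H" unfolding H_def by (rule exp_bounded_integrable[OF h s])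
  have "laplace_term s (conv_exp a h) x = (\<integral>u. E u * H (x - u) \<partial>lborel)" for x
  proof -
    have "complex_of_real (conv_exp a h x) = (\<integral>u. complex_of_real (exp_dens a u * h (x - u)) \<partial>lborel)"
      unfolding conv_exp_def by (rule integral_complex_of_real[symmetric])
    then have "laplace_term s (conv_exp a h) x =
        (\<integral>u. exp (- s * complex_of_real x) * complex_of_real (exp_dens a u * h (x - u)) \<partial>lborel)"
      by (simp only: integral_mult_right_zero)
    moreover have "exp (- s * complex_of_real x) * complex_of_real (exp_dens a u * h (x - u)) = E u * H (x - u)" for u
    proof -
      have "exp (- s * complex_of_real x) = exp (- s * complex_of_real u) * exp (- s * complex_of_real (x - u))"
        by (simp only: exp_add[symmetric]) (simp add: algebra_simps)
      then show ?thesis by (simp add: E_def H_def)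
    qed
    ultimately show ?thesis by (simp only:)
  qed
  then have "(\<integral>x. laplace_term s (conv_exp a h) x \<partial>lborel) =
      (\<integral>x. \<integral>u. E u * H (x - u) \<partial>lborel \<partial>lborel)" by simp
  also have "\<dots> = (\<integral>u. \<integral>x. E u * H (x - u) \<partial>lborel \<partial>lborel)"
  proof (rule lborel_pair.Fubini_integral)
    show "integrable (lborel \<Otimes>\<^sub>M lborel) (\<lambda>(u, x). E u * H (x - u))"
    proof (rule lborel_pair.Fubini_integrable)
      have "integrable lborel (\<lambda>u. norm (E u) * (\<integral>x. norm (H x) \<partial>lborel))"
        using E'(1) by (intro integrable_mult_left integrable_norm)
      moreover have "(\<integral>x. norm (H (x - u)) \<partial>lborel) = (\<integral>x. norm (H x) \<partial>lborel)" for u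
        using lborel_integral_real_affine[of 1 "\<lambda>x. norm (H x)" "- u"] by simp
      ultimately show "integrable lborel (\<lambda>u. \<integral>x. norm (case (u, x) of (u, x) \<Rightarrow> E u * H (x - u)) \<partial>lborel)"
        by (simp add: norm_mult)
      have "integrable lborel (\<lambda>x. H (x - u))" for u
        using lborel_integrable_real_affine[OF H, of 1 "- u"] by simp
      then show "AE u in lborel. integrable lborel (\<lambda>x. case (u, x) of (u, x) \<Rightarrow> E u * H (x - u))"
        by (auto intro!: AE_I2)
    qed measurable
  qed
  also have "\<dots> = (\<integral>u. E u * (\<integral>x. H x \<partial>lborel) \<partial>lborel)"
  proof (rule Bochner_Integration.integral_cong)
    fix u
    have "(\<integral>x. H (x - u) \<partial>lborel) = (\<integral>x. H x \<partial>lborel)"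
      using lborel_integral_real_affine[of 1 H "- u"] by simp
    then show "(\<integral>x. E u * H (x - u) \<partial>lborel) = E u * (\<integral>x. H x \<partial>lborel)" by simp
  qed simp
  also have "\<dots> = a / (a + s) * (\<integral>x. H x \<partial>lborel)"
    using E' by simp
  finally show ?thesis by (simp add: H_def)
qed

text \<open>Both estimates average over a probability density. The displacement is at most
  \<open>K\<close> times its mean, which is bounded crudely through u \<le> (2 / a) exp (a u / 2),
  because the exponential moment at \<open>a / 2\<close> is already known to be 2; hence the
  4.\<close>

lemma conv_exp_lipschitz:
  assumes h: "exp_bounded \<delta> C h" and d: "0 < \<delta>" "0 < a"
    and lip: "\<And>x y. \<bar>h x - h y\<bar> \<le> K * \<bar>x - y\<bar>"
  shows "\<bar>conv_exp a h x - conv_exp a h y\<bar> \<le> K * \<bar>x - y\<bar>"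
    and "\<bar>conv_exp a h x - h x\<bar> \<le> 4 * K / a"
proof -
  note int = conv_exp_integrable[OF h d]
  have K: "K \<ge> 0" using lip[of 0 1] by (simp add: abs_le_iff) 
  have "\<bar>conv_exp a h x - conv_exp a h y\<bar> = \<bar>\<integral>u. exp_dens a u * h (x - u) - exp_dens a u * h (y - u) \<partial>lborel\<bar>"
    unfolding conv_exp_def using int by (simp add: Bochner_Integration.integral_diff)
  also have "\<dots> \<le> (\<integral>u. exp_dens a u * (K * \<bar>x - y\<bar>) \<partial>lborel)"
  proof (rule integral_abs_bound_integral)
    fix u
    have "exp_dens a u * h (x - u) - exp_dens a u * h (y - u) = exp_dens a u * (h (x - u) - h (y - u))"
      by (simp add: right_diff_distrib)
    then show "\<bar>exp_dens a u * h (x - u) - exp_dens a u * h (y - u)\<bar> \<le> exp_dens a u * (K * \<bar>x - y\<bar>)"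
      using lip[of "x - u" "y - u"] d by (simp add: abs_mult exp_dens_nonneg mult_left_mono)
  qed (use int d in \<open>auto intro!: integrable_exp_dens\<close>)
  also have "\<dots> = K * \<bar>x - y\<bar>" using d by (simp add: integral_exp_dens)
  finally show "\<bar>conv_exp a h x - conv_exp a h y\<bar> \<le> K * \<bar>x - y\<bar>" .
  have I: "has_bochner_integral lborel (\<lambda>u. exp (- (- (a/2)) * u) * exp_dens a u) (a / (a + (- (a/2))))"
    by (rule has_bochner_integral_exp_dens_real) (use d in auto)
  have "conv_exp a h x - h x = (\<integral>u. exp_dens a u * h (x - u) - exp_dens a u * h x \<partial>lborel)"
    unfolding conv_exp_def using int d integrable_exp_dens[of a]
    by (subst Bochner_Integration.integral_diff) (auto simp: integral_exp_dens)
  also have "\<bar>\<dots>\<bar> \<le> (\<integral>u. 2 * K / a * (exp (- (- (a/2)) * u) * exp_dens a u) \<partial>lborel)"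
  proof (rule integral_abs_bound_integral)
    show "integrable lborel (\<lambda>u. 2 * K / a * (exp (- (- (a/2)) * u) * exp_dens a u))"
      using I by (intro integrable_mult_right) (simp add: has_bochner_integral_iff)
    show "integrable lborel (\<lambda>u. exp_dens a u * h (x - u) - exp_dens a u * h x)"
      using int integrable_exp_dens[of a] d by (intro Bochner_Integration.integrable_diff integrable_mult_left) auto
    fix u
    show "\<bar>exp_dens a u * h (x - u) - exp_dens a u * h x\<bar> \<le> 2 * K / a * (exp (- (- (a/2)) * u) * exp_dens a u)"
    proof (cases "u \<ge> 0")
      case True
      have "exp_dens a u * h (x - u) - exp_dens a u * h x = exp_dens a u * (h (x - u) - h x)"
        by (simp add: right_diff_distrib)
      then have "\<bar>exp_dens a u * h (x - u) - exp_dens a u * h x\<bar> \<le> exp_dens a u * (K * u)"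
        using lip[of "x - u" x] d True by (simp add: abs_mult exp_dens_nonneg mult_left_mono)
      also have "a / 2 * u \<le> exp (a / 2 * u)" using exp_ge_add_one_self[of "a / 2 * u"] by linarith
      then have "u \<le> 2 / a * exp (a / 2 * u)" using d by (simp add: field_simps)
      then have "exp_dens a u * (K * u) \<le> exp_dens a u * (K * (2 / a * exp (a / 2 * u)))"
        using d K by (intro mult_left_mono) (auto simp: exp_dens_nonneg)
      also have "\<dots> = 2 * K / a * (exp (- (- (a/2)) * u) * exp_dens a u)" by simp
      finally show ?thesis .
    qed (simp add: exp_dens_def)
  qed
  also have "\<dots> = 4 * K / a" using I d by (simp add: has_bochner_integral_iff)
  finally show "\<bar>conv_exp a h x - h x\<bar> \<le> 4 * K / a" .
qed

lemma exp_bounded_exp_dens: "0 < a \<Longrightarrow> \<delta> \<le> a \<Longrightarrow> exp_bounded \<delta> a (exp_dens a)"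
  by (auto simp: exp_bounded_def exp_dens_def intro!: mult_right_mono)

text \<open>The density \<open>exp_dens a\<close> jumps by \<open>a\<close> at 0. To the right of
  the jump its slope is at most a^2, and averaging over the mass 1 of \<open>exp_dens b\<close>
  gives the first term. For \<open>u\<close> between \<open>x\<close> and \<open>y\<close> the jump
  is felt, against a density of at most \<open>b\<close>, which gives the second.\<close>

lemma conv_exp_exp_dens_lipschitz:
  assumes a: "0 < a" "0 < b"
  shows "\<bar>conv_exp b (exp_dens a) x - conv_exp b (exp_dens a) y\<bar> \<le> (a\<^sup>2 + a * b) * \<bar>x - y\<bar>"
proof -
  have lip: "\<bar>exp (- a * v) - exp (- a * w)\<bar> \<le> a * (w - v)" if "0 \<le> v" "v \<le> w" for v w
  proof -
    have "1 + (- a * (w - v)) \<le> exp (- a * (w - v))" by (rule exp_ge_add_one_self)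
    moreover have "exp (- a * w) = exp (- a * v) * exp (- a * (w - v))"
      unfolding exp_add[symmetric] by (simp add: algebra_simps)
    moreover have "exp (- a * v) \<le> 1" using a that by simp
    moreover have "exp (- a * (w - v)) \<le> 1" using a that by simp
    ultimately have "exp (- a * v) - exp (- a * w) = exp (- a * v) * (1 - exp (- a * (w - v)))"
      by (simp add: algebra_simps)
    also have "\<dots> \<le> 1 * (1 - exp (- a * (w - v)))"
      using \<open>exp (- a * v) \<le> 1\<close> \<open>exp (- a * (w - v)) \<le> 1\<close> by (intro mult_right_mono) auto
    also have "\<dots> \<le> a * (w - v)" using \<open>1 + (- a * (w - v)) \<le> exp (- a * (w - v))\<close> by simp
    finally show ?thesis using a that by (simp add: abs_le_iff)
  qed
  have *: "\<bar>conv_exp b (exp_dens a) y - conv_exp b (exp_dens a) x\<bar> \<le> (a\<^sup>2 + a * b) * (y - x)" if "x \<le> y" for x y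
  proof -
    have int: "integrable lborel (\<lambda>u. exp_dens b u * exp_dens a (x - u))" for x
      by (rule conv_exp_integrable[OF exp_bounded_exp_dens[of a a]]) (use a in auto)
    have intI: "integrable lborel (\<lambda>u. indicator {x<..y} u :: real)"
      by (simp add: integrable_indicator_iff that)
    have "\<bar>conv_exp b (exp_dens a) y - conv_exp b (exp_dens a) x\<bar> =
        \<bar>\<integral>u. exp_dens b u * exp_dens a (y - u) - exp_dens b u * exp_dens a (x - u) \<partial>lborel\<bar>"
      unfolding conv_exp_def using int by (simp add: Bochner_Integration.integral_diff)
    also have "\<dots> \<le> (\<integral>u. a\<^sup>2 * (y - x) * exp_dens b u + a * b * indicator {x<..y} u \<partial>lborel)"
    proof (rule integral_abs_bound_integral)
      show "integrable lborel (\<lambda>u. a\<^sup>2 * (y - x) * exp_dens b u + a * b * indicator {x<..y} u)"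
        using a intI by (intro Bochner_Integration.integrable_add integrable_mult_right integrable_exp_dens)
      fix u
      have eq: "exp_dens b u * exp_dens a (y - u) - exp_dens b u * exp_dens a (x - u) =
          exp_dens b u * (exp_dens a (y - u) - exp_dens a (x - u))"
        by (simp add: right_diff_distrib)
      consider "u \<le> x" | "x < u" "u \<le> y" | "y < u" by linarith
      then have "\<bar>exp_dens b u * (exp_dens a (y - u) - exp_dens a (x - u))\<bar>
          \<le> a\<^sup>2 * (y - x) * exp_dens b u + a * b * indicator {x<..y} u"
      proof cases
        case 1
        have "exp_dens a (y - u) - exp_dens a (x - u) = a * (exp (- a * (y - u)) - exp (- a * (x - u)))"
          using 1 that by (simp add: exp_dens_def right_diff_distrib)
        also have "\<bar>\<dots>\<bar> \<le> a * (a * (y - x))"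
          using lip[of "x - u" "y - u"] 1 that a by (simp add: abs_mult abs_minus_commute)
        finally have "\<bar>exp_dens b u\<bar> * \<bar>exp_dens a (y - u) - exp_dens a (x - u)\<bar> \<le> exp_dens b u * (a * (a * (y - x)))"
          using a by (intro mult_mono) (auto simp: exp_dens_nonneg)
        then show ?thesis using 1 by (simp add: abs_mult power2_eq_square mult_ac)
      next
        case 2
        have "\<bar>exp_dens b u\<bar> \<le> b" using a by (auto simp: exp_dens_def)
        moreover have "\<bar>exp_dens a (y - u) - exp_dens a (x - u)\<bar> \<le> a"
          using 2 a by (auto simp: exp_dens_def)
        ultimately have "\<bar>exp_dens b u\<bar> * \<bar>exp_dens a (y - u) - exp_dens a (x - u)\<bar> \<le> b * a"
          using a by (intro mult_mono) auto
        moreover have "a\<^sup>2 * (y - x) * exp_dens b u \<ge> 0" using a that by (simp add: exp_dens_nonneg)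
        ultimately show ?thesis using 2 by (simp add: abs_mult mult_ac)
      next
        case 3
        then have "exp_dens a (y - u) = 0" "exp_dens a (x - u) = 0" using that by (auto simp: exp_dens_def)
        then show ?thesis using 3 a that by (simp add: exp_dens_nonneg)
      qed
      then show "\<bar>exp_dens b u * exp_dens a (y - u) - exp_dens b u * exp_dens a (x - u)\<bar>
          \<le> a\<^sup>2 * (y - x) * exp_dens b u + a * b * indicator {x<..y} u"
        by (simp only: eq)
    qed (use int in auto)
    also have "\<dots> = a\<^sup>2 * (y - x) * 1 + a * b * (y - x)"
      using a intI that by (subst Bochner_Integration.integral_add)
        (auto intro!: integrable_exp_dens simp: integral_exp_dens)
    finally show ?thesis by (simp add: algebra_simps)
  qed
  show ?thesis using *[of x y] *[of y x] by (cases "x \<le> y") (auto simp: abs_minus_commute)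
qed

text \<open>The density of a sum of independent exponential variables with rates \<open>a 0\<close>,
  ..., \<open>a n\<close>.\<close>

primrec hypoexp :: "(nat \<Rightarrow> real) \<Rightarrow> nat \<Rightarrow> real \<Rightarrow> real" where
  "hypoexp a 0 = exp_dens (a 0)"
| "hypoexp a (Suc n) = conv_exp (a (Suc n)) (hypoexp a n)"

text \<open>Summability of \<open>1 / a k\<close> acts twice: it bounds the constants of the
  exponential majorants, and it makes the successive changes of value summable, so that the
  densities converge at every point.\<close>

lemma polya_frequency_limit:
  fixes a :: "nat \<Rightarrow> real"
  assumes a0: "0 < a 0" and a: "\<And>k. a 0 \<le> a k" and summ: "summable (\<lambda>k. 1 / a k)"
  obtains L \<delta> where "0 < \<delta>" "\<delta> < a 0" "L \<in> borel_measurable borel" "integrable lborel L" "tp_kernel L"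
    "\<And>x. x < 0 \<Longrightarrow> L x = 0"
    "\<And>s :: complex. Re s > - \<delta> \<Longrightarrow> integrable lborel (\<lambda>x. laplace_term s L x)"
    "\<And>s :: complex. Re s > - \<delta> \<Longrightarrow> (\<lambda>n. \<Prod>k<n. a k / (a k + s)) \<longlonglongrightarrow>
        (\<integral>x. laplace_term s L x \<partial>lborel)"
proof -
  \<comment> \<open>Half the smallest rate: then \<open>2 * \<delta> \<le> a k\<close>, which is
    what b / (b - \<delta>) \<le> 1 + 2 \<delta> / b amounts to below.\<close>
  define \<delta> where "\<delta> = a 0 / 2"
  have d: "0 < \<delta>" "\<delta> < a k" "0 < a k" for k using a0 a[of k] by (auto simp: \<delta>_def)
  \<comment> \<open>An upper bound, by 1 + t \<le> exp t, for \<open>a 0\<close> times the product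
    of the factors \<open>a k / (a k - \<delta>)\<close> over k = 1, ..., n.\<close>
  define C where "C n = a 0 * exp (2 * \<delta> * (\<Sum>k<n. 1 / a (Suc k)))" for n
  have C: "exp_bounded \<delta> (C n) (hypoexp a n)" for n
  proof (induction n)
    case 0
    show ?case using d by (simp add: C_def exp_bounded_exp_dens less_imp_le)
  next
    case (Suc n)
    define b where "b = a (Suc n)"
    have b: "\<delta> < b" "0 < b" "2 * \<delta> \<le> b" using d a by (auto simp: b_def \<delta>_def)
    have E: "exp_bounded \<delta> (C n * (b / (b - \<delta>))) (hypoexp a (Suc n))"
      using exp_bounded_conv_exp[OF Suc d(1) b(1)] by (simp add: b_def)
    have "b / (b - \<delta>) \<le> 1 + 2 * \<delta> / b"
    proof -
      have "b * b \<le> (b + 2 * \<delta>) * (b - \<delta>)"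
        using b d mult_left_mono[OF b(3), of \<delta>] by (simp add: algebra_simps)
      then show ?thesis using b by (simp add: field_simps)
    qed
    also have "\<dots> \<le> exp (2 * \<delta> / b)" by (rule exp_ge_add_one_self)
    finally have "C n * (b / (b - \<delta>)) \<le> C n * exp (2 * \<delta> / b)"
      using a0 by (intro mult_left_mono) (auto simp: C_def)
    also have "\<dots> = C (Suc n)"
      by (simp add: C_def b_def distrib_left exp_add)
    finally have "C n * (b / (b - \<delta>)) * exp (- \<delta> * x) \<le> C (Suc n) * exp (- \<delta> * x)" for x
      by (intro mult_right_mono) auto
    with E show ?case unfolding exp_bounded_def by (meson order.trans)
  qed
  define CC where "CC = a 0 * exp (2 * \<delta> * (\<Sum>k. 1 / a (Suc k)))"
  have summ': "summable (\<lambda>k. 1 / a (Suc k))" using summ by (subst summable_Suc_iff)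
  have CC: "C n \<le> CC" for n
    unfolding C_def CC_def using a0 d
    by (intro mult_left_mono iffD2[OF exp_le_cancel_iff] sum_le_suminf summ') (auto simp: less_imp_le)
  have bdd: "exp_bounded \<delta> CC (hypoexp a n)" for n
    using C[of n] mult_right_mono[OF CC[of n], of "exp (- \<delta> * x)" for x]
    unfolding exp_bounded_def by (meson order.trans exp_ge_zero)
  have tp: "tp_kernel (hypoexp a n)" for n
    using d by (induction n) (auto intro!: tp_kernel_exp_dens tp_kernel_conv_exp[OF bdd] simp: less_imp_le)
  \<comment> \<open>The Lipschitz constant of the convolution of the first two densities; later
    convolutions do not increase it.\<close>
  define K where "K = (a 0)\<^sup>2 + a 0 * a 1"
  have lip: "\<bar>hypoexp a (Suc n) x - hypoexp a (Suc n) y\<bar> \<le> K * \<bar>x - y\<bar>" for n x y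
  proof (induction n arbitrary: x y)
    case 0
    show ?case using conv_exp_exp_dens_lipschitz[of "a 0" "a 1" x y] d by (simp add: K_def)
  next
    case (Suc n)
    have "\<bar>conv_exp (a (Suc (Suc n))) (hypoexp a (Suc n)) x - conv_exp (a (Suc (Suc n))) (hypoexp a (Suc n)) y\<bar> \<le> K * \<bar>x - y\<bar>"
      by (rule conv_exp_lipschitz(1)[OF bdd d(1) d(3)]) (rule Suc.IH)
    then show ?case by simp
  qed
  have step: "\<bar>hypoexp a (Suc (Suc n)) x - hypoexp a (Suc n) x\<bar> \<le> 4 * K * (1 / a (Suc (Suc n)))" for n x
    using conv_exp_lipschitz(2)[OF bdd[of "Suc n"] d(1) d(3)[of "Suc (Suc n)"] lip] by simp
  have conv: "convergent (\<lambda>n. hypoexp a n x)" for x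
  proof -
    have "summable (\<lambda>n. 4 * K * (1 / a (Suc (Suc n))))"
      using summ' by (intro summable_mult) (subst summable_Suc_iff)
    then have "summable (\<lambda>n. hypoexp a (Suc (Suc n)) x - hypoexp a (Suc n) x)"
      by (rule summable_comparison_test') (use step in auto)
    then have "convergent (\<lambda>n. \<Sum>k<n. hypoexp a (Suc (Suc k)) x - hypoexp a (Suc k) x)"
      by (simp add: summable_iff_convergent)
    then have "convergent (\<lambda>n. hypoexp a (Suc n) x - hypoexp a (Suc 0) x)"
      by (subst (asm) sum_lessThan_telescope)
    then show ?thesis
      by (simp only: convergent_diff_const_right_iff convergent_Suc_iff[of "\<lambda>n. hypoexp a n x"])
  qed
  define L where "L x = lim (\<lambda>n. hypoexp a n x)" for x
  have L: "(\<lambda>n. hypoexp a n x) \<longlonglongrightarrow> L x" for x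
    using conv by (simp add: L_def convergent_LIMSEQ_iff)
  have hm [measurable]: "hypoexp a n \<in> borel_measurable borel" for n
    using bdd[of n] by (simp add: exp_bounded_def)
  have Lm [measurable]: "L \<in> borel_measurable borel"
    using L by (rule borel_measurable_LIMSEQ_real) simp
  have Lbdd: "exp_bounded \<delta> CC L"
    unfolding exp_bounded_def
  proof (intro conjI allI impI)
    fix x :: real
    show "0 \<le> L x" using L by (rule LIMSEQ_le_const) (use bdd in \<open>auto simp: exp_bounded_def\<close>)
    show "L x \<le> CC * exp (- \<delta> * x)"
      using L by (rule LIMSEQ_le_const2) (use bdd in \<open>auto simp: exp_bounded_def\<close>)
    show "L x = 0" if "x < 0"
      using L[of x] bdd that by (simp add: exp_bounded_def LIMSEQ_const_iff)
  qed simp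
  have lap: "(\<integral>x. laplace_term s (hypoexp a n) x \<partial>lborel) = (\<Prod>k<Suc n. a k / (a k + s))"
    if s: "Re s > - \<delta>" for s :: complex and n
  proof (induction n)
    case 0
    then show ?case
      using has_bochner_integral_exp_dens_complex[of "a 0" s] d(2)[of 0] s by (simp add: has_bochner_integral_iff)
  next
    case (Suc n)
    show ?case
      using laplace_conv_exp[OF bdd[of n] d(1) d(2)[of "Suc n"] s] Suc by (simp add: mult.commute)
  qed
  show thesis
  proof (rule that[of \<delta> L])
    show "integrable lborel L"
      using exp_bounded_real_integrable[OF Lbdd, of 0] d by simp
    show "tp_kernel L" using tp L by (rule tp_kernel_tendsto)
    show "L x = 0" if "x < 0" for x using Lbdd that by (simp add: exp_bounded_def)
    show "integrable lborel (\<lambda>x. laplace_term s L x)"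
      if "Re s > - \<delta>" for s :: complex
      by (rule exp_bounded_integrable[OF Lbdd that])
    show "(\<lambda>n. \<Prod>k<n. a k / (a k + s)) \<longlonglongrightarrow>
        (\<integral>x. laplace_term s L x \<partial>lborel)" if s: "Re s > - \<delta>" for s :: complex
    proof -
      \<comment> \<open>The common majorant satisfies the same predicate, so the same lemma gives
        its integrability against the exponential.\<close>
      have cb: "exp_bounded \<delta> CC (\<lambda>x. if x \<ge> 0 then CC * exp (- \<delta> * x) else 0)"
      proof -
        have "CC \<ge> 0" using a0 by (simp add: CC_def)
        then show ?thesis by (auto simp: exp_bounded_def)
      qed
      have "(\<lambda>n. \<integral>x. laplace_term s (hypoexp a n) x \<partial>lborel) \<longlonglongrightarrow>
          (\<integral>x. laplace_term s L x \<partial>lborel)"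
      proof (rule integral_dominated_convergence)
        show "integrable lborel (\<lambda>x. norm (exp (- s * complex_of_real x) *
            complex_of_real (if x \<ge> 0 then CC * exp (- \<delta> * x) else 0)))"
          by (intro integrable_norm exp_bounded_integrable[OF cb s])
        show "AE x in lborel. (\<lambda>n. laplace_term s (hypoexp a n) x) \<longlonglongrightarrow>
            laplace_term s L x"
          by (intro AE_I2 tendsto_intros L)
        show "AE x in lborel. norm (laplace_term s (hypoexp a n) x) \<le>
            norm (exp (- s * complex_of_real x) * complex_of_real (if x \<ge> 0 then CC * exp (- \<delta> * x) else 0))" for n
          using bdd[of n] by (intro AE_I2) (auto simp: norm_mult exp_bounded_def intro!: mult_left_mono order.trans[OF _ abs_ge_self])
      qed measurable
      then have "(\<lambda>n. \<Prod>k<Suc n. a k / (a k + s)) \<longlonglongrightarrow>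
          (\<integral>x. laplace_term s L x \<partial>lborel)"
        by (simp only: lap[OF s])
      then show ?thesis by (rule LIMSEQ_imp_Suc)
    qed
  qed (use d Lm in auto)
qed

section \<open>Entire functions of small growth\<close>

text \<open>The map sending v to v / (2 M - v) takes the half-plane Re v < M into the unit disc, so
  Schwarz's lemma applies to its composition with \<open>g\<close>, rescaled to the unit
  disc.\<close>

lemma borel_caratheodory_0:
  fixes g :: "complex \<Rightarrow> complex"
  assumes g: "g holomorphic_on ball 0 R" "g 0 = 0" and M: "M > 0" "\<And>z. norm z < R \<Longrightarrow> Re (g z) < M"
    and z: "norm z < R"
  shows "norm (g z) \<le> 2 * M * norm z / (R - norm z)"
proof -
  have R: "R > 0" using z norm_ge_zero[of z] by linarith
  have ne: "2 * M - g w \<noteq> 0" if "norm w < R" for w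
    using M(2)[OF that] M(1) by (metis Re_complex_of_real complex_Re_numeral diff_0_right eq_iff_diff_eq_0
        less_irrefl mult_2 of_real_add of_real_mult of_real_numeral add_less_cancel_right less_add_same_cancel1 less_trans)
  define h where "h w = g (of_real R * w) / (2 * M - g (of_real R * w))" for w
  have Rw: "of_real R * w \<in> ball 0 R" if "norm w < 1" for w :: complex
    using R that by (simp add: norm_mult)
  have "norm (h w) \<le> norm w" if w: "norm w < 1" for w
  proof (rule Schwarz_Lemma(1)[OF _ _ _ w])
    have "(\<lambda>w. g (of_real R * w)) holomorphic_on ball 0 1"
      by (rule holomorphic_on_compose_gen[OF _ g(1), of "\<lambda>w. of_real R * w", unfolded o_def])
         (use Rw in \<open>auto intro!: holomorphic_intros\<close>)
    then show "h holomorphic_on ball 0 1"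
      unfolding h_def using Rw ne by (intro holomorphic_intros) auto
    show "h 0 = 0" by (simp add: h_def g)
    fix w :: complex assume w: "norm w < 1"
    define v where "v = g (of_real R * w)"
    have v: "Re v < M" using M(2)[of "of_real R * w"] Rw[OF w] by (simp add: v_def)
    have "(norm v)\<^sup>2 < (norm (2 * M - v))\<^sup>2"
    proof -
      have "(norm v)\<^sup>2 = (Re v)\<^sup>2 + (Im v)\<^sup>2" "(norm (2 * M - v))\<^sup>2 = (2 * M - Re v)\<^sup>2 + (Im v)\<^sup>2"
        by (simp_all add: cmod_power2)
      then show ?thesis
        using mult_strict_left_mono[OF v M(1)] by (simp add: power2_eq_square algebra_simps)
    qed
    then have "norm v < norm (2 * M - v)" by (rule power2_less_imp_less) simp
    then show "norm (h w) < 1"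
      using le_less_trans[OF norm_ge_zero \<open>norm v < norm (2 * M - v)\<close>]
      by (simp add: h_def norm_divide divide_less_eq flip: v_def)
  qed
  from this[of "z / of_real R"] have "norm (h (z / of_real R)) \<le> norm z / R"
    using z R by (simp add: norm_divide)
  then have "norm (g z) / norm (2 * M - g z) \<le> norm z / R"
    using R by (simp add: h_def norm_divide)
  then have "norm (g z) * R \<le> norm z * norm (2 * M - g z)"
    using R ne[OF z] by (simp add: field_simps)
  also have "\<dots> \<le> norm z * (2 * M + norm (g z))"
    using norm_triangle_ineq4[of "2 * M" "g z"] M by (intro mult_left_mono) (auto simp: norm_mult)
  finally have "norm (g z) * (R - norm z) \<le> 2 * M * norm z" by (simp add: algebra_simps)
  then show ?thesis using z by (simp add: field_simps)
qed

lemma norm_bound_sphere_imp_cball: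
  fixes f :: "complex \<Rightarrow> complex"
  assumes "f holomorphic_on UNIV" "\<And>z. norm z = R \<Longrightarrow> norm (f z) \<le> B" "norm z \<le> R" "R > 0"
  shows "norm (f z) \<le> B"
proof (rule maximum_modulus_frontier[of f "cball 0 R"])
  show "f holomorphic_on interior (cball 0 R)" by (rule holomorphic_on_subset[OF assms(1)]) auto
  show "continuous_on (closure (cball 0 R)) f"
    using holomorphic_on_imp_continuous_on[OF assms(1)] by (rule continuous_on_subset) auto
qed (use assms in auto)

text \<open>The factor is 1 at 0, so that \<open>g\<close> and \<open>f\<close> agree there. The
  zero is written \<open>- a\<close> with a view to the negative zeros of
  \<open>Xi1\<close>.\<close>

lemma holomorphic_divide_zero:
  assumes f: "f holomorphic_on UNIV" and a: "a \<noteq> 0" "f (- a) = (0 :: complex)"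
  obtains g where "g holomorphic_on UNIV" "\<And>z. f z = (1 + z / a) * g z"
proof -
  define g where "g z = (if z = - a then deriv f (- a) else f z / (z - - a))" for z
  have "(\<lambda>z. if z = - a then deriv f (- a) else f z / (z - - a) - f (- a) / (z - - a)) holomorphic_on UNIV"
    by (rule pole_theorem_open[OF f]) (auto simp: eq_neg_iff_add_eq_0)
  then have "g holomorphic_on UNIV"
    unfolding g_def using a by (simp add: cong: if_cong)
  then have "(\<lambda>z. a * g z) holomorphic_on UNIV" by (intro holomorphic_intros)
  moreover have "f z = (1 + z / a) * (a * g z)" for z
  proof (cases "z = - a")
    case False
    then have "z + a \<noteq> 0" by (metis eq_neg_iff_add_eq_0)
    moreover have "1 + z / a = (z + a) / a" using a by (simp add: add_divide_distrib)
    ultimately show ?thesis using a False by (simp add: g_def)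
  qed (use a in simp)
  ultimately show thesis by (rule that)
qed

lemma exists_minimal_zero:
  assumes f: "f holomorphic_on UNIV" "f w = (0 :: complex)" "f 0 \<noteq> 0"
  obtains z where "f z = 0" "\<And>w. f w = 0 \<Longrightarrow> norm z \<le> norm w"
proof -
  define S where "S = cball 0 (norm w) \<inter> f -` {0}"
  have "closed (f -` {0})"
    using continuous_closed_vimage[of "{0}" f] holomorphic_on_imp_continuous_on[OF f(1)]
    by (auto simp: continuous_on_eq_continuous_at)
  then have "compact S" unfolding S_def by (intro compact_Int_closed) auto
  moreover have "w \<in> S" using f by (simp add: S_def)
  ultimately obtain z where z: "z \<in> S" "\<And>y. y \<in> S \<Longrightarrow> norm z \<le> norm y"
    using continuous_attains_inf[of S norm] by (auto intro: continuous_on_norm_id)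
  show thesis
  proof (rule that[of z])
    show "f z = 0" using z by (simp add: S_def)
    fix y assume "f y = 0"
    show "norm z \<le> norm y"
    proof (cases "norm y \<le> norm w")
      case True then show ?thesis using z(2)[of y] \<open>f y = 0\<close> by (simp add: S_def)
    next
      case False then show ?thesis using z(1) by (simp add: S_def)
    qed
  qed
qed

text \<open>A zero-free function on a disc is an exponential. The bound on its modulus bounds the
  real part of the logarithm, and Borel--Caratheodory turns this into a bound for the logarithm
  itself.\<close>

lemma zero_free_bound:
  fixes g :: "complex \<Rightarrow> complex"
  assumes g: "g holomorphic_on UNIV" "g 0 \<noteq> 0" and nz: "\<And>z. norm z < R \<Longrightarrow> g z \<noteq> 0"
    and B: "B > 0" "\<And>z. norm z < R \<Longrightarrow> norm (g z) < norm (g 0) * exp B" and z: "norm z < R"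
  obtains l where "g z = g 0 * exp l" "norm l \<le> 2 * B * norm z / (R - norm z)"
proof -
  have R: "R > 0" using z norm_ge_zero[of z] by linarith
  obtain l where l: "l holomorphic_on ball 0 R" "\<And>x. x \<in> ball 0 R \<Longrightarrow> exp (l x) = g x / g 0"
    by (rule holomorphic_logarithm_exists[of "ball 0 R" "\<lambda>x. g x / g 0" 0])
       (use g nz R in \<open>auto intro!: holomorphic_intros holomorphic_on_subset[OF g(1)]\<close>)
  \<comment> \<open>The logarithm vanishes at 0 only up to a multiple of 2 \<pi> i, hence the
    subtraction.\<close>
  have "norm (l z - l 0) \<le> 2 * B * norm z / (R - norm z)"
  proof (rule borel_caratheodory_0[of "\<lambda>z. l z - l 0"])
    fix w :: complex assume w: "norm w < R"
    have "exp (l 0) = 1" using l(2)[of 0] R g by simp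
    then have "norm (exp (l 0)) = 1" by simp
    then have "Re (l 0) = 0" by simp
    moreover have "exp (Re (l w)) = norm (g w / g 0)"
      using l(2)[of w] w by (metis norm_exp_eq_Re mem_ball_0)
    moreover have "norm (g w / g 0) < exp B"
      using B(2)[OF w] g by (simp add: norm_divide divide_less_eq mult.commute)
    ultimately have "Re (l 0) = 0" "exp (Re (l w)) < exp B" by simp_all
    then show "Re (l w - l 0) < B" by simp
  qed (use l B z in \<open>auto intro!: holomorphic_intros\<close>)
  moreover have "g z = g 0 * exp (l z - l 0)"
    using l(2)[of z] l(2)[of 0] z R g by (simp add: exp_diff)
  ultimately show thesis by (intro that) 
qed

text \<open>The zeros are split off one at a time, each time one of smallest modulus. The remaining factor is
  then free of zeros in a disc of growing radius, where Borel--Caratheodory forces it to be almost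
  constant.\<close>
lemma hadamard_small_order:
  fixes f :: "complex \<Rightarrow> complex"
  assumes f: "f holomorphic_on UNIV" "f 0 \<noteq> 0"
    and B: "\<And>z. norm (f z) \<le> exp (B (norm z))" "((\<lambda>R. B R / R) \<longlongrightarrow> 0) at_top"
    and nonpoly: "\<And>(n :: nat) a c. \<exists>z. f z \<noteq> c * (\<Prod>k<n. 1 + z / a k)"
  obtains a where "\<And>k. a k \<noteq> 0" "\<And>k. f (- a k) = 0" "\<And>k. norm (a k) \<le> norm (a (Suc k))"
    "\<And>z. (\<lambda>n. f 0 * (\<Prod>k<n. 1 + z / a k)) \<longlonglongrightarrow> f z"
proof -
  \<comment> \<open>The growth bound measured relative to \<open>f 0\<close>, and enlarged so as to
    be positive and strict.\<close>
  define M where "M R = \<bar>B R\<bar> + \<bar>ln (norm (f 0))\<bar> + 1" for R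
  have M: "M R > 0" for R by (simp add: M_def)
  have M_bound: "exp (B R) < norm (f 0) * exp (M R)" for R
  proof -
    have "norm (f 0) * exp (M R) = exp (ln (norm (f 0)) + M R)" using f by (simp add: exp_add)
    also have "\<dots> > exp (B R)" unfolding M_def by (subst exp_less_cancel_iff) linarith
    finally show ?thesis .
  qed
  have M_lim: "((\<lambda>R. M (2 * R) / R) \<longlongrightarrow> 0) at_top"
  proof -
    have "((\<lambda>R. B (2 * R) / (2 * R)) \<longlongrightarrow> 0) at_top"
      by (rule filterlim_compose[OF B(2)]) real_asymp
    then have "((\<lambda>R. 2 * \<bar>B (2 * R) / (2 * R)\<bar> + (\<bar>ln (norm (f 0))\<bar> + 1) / R) \<longlongrightarrow> 2 * \<bar>0\<bar> + 0) at_top"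
      by (intro tendsto_intros tendsto_divide_0[OF tendsto_const] filterlim_at_top_imp_at_infinity filterlim_ident)
    moreover have "\<forall>\<^sub>F R in at_top. 2 * \<bar>B (2 * R) / (2 * R)\<bar> + (\<bar>ln (norm (f 0))\<bar> + 1) / R = M (2 * R) / R"
      using eventually_gt_at_top[of 0] by eventually_elim (simp add: M_def field_simps)
    ultimately show ?thesis by (simp add: tendsto_cong)
  qed
  \<comment> \<open>On the circle of radius \<open>2 * R\<close> every factor split off so far has
    modulus at least 1, so \<open>f\<close> bounds \<open>g\<close> there. The maximum principle
    carries this to the disc of radius \<open>R\<close>, in which \<open>g\<close> has no
    zeros.\<close>
  have close: "\<exists>l. g z = f 0 * exp l \<and> norm l \<le> 2 * M (2 * R) * norm z / (R - norm z)"
    if g: "g holomorphic_on UNIV" "g 0 = f 0" and nz: "\<And>w. norm w < R \<Longrightarrow> g w \<noteq> 0"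
      and fg: "\<And>w. f w = (\<Prod>k<n. 1 + w / a k) * g w"
      and a: "\<And>k. k < n \<Longrightarrow> a k \<noteq> 0 \<and> norm (a k) \<le> R" and z: "norm z < R" for g R z a and n :: nat
  proof -
    have R: "R > 0" using z norm_ge_zero[of z] by linarith
    have sph: "norm (g w) \<le> exp (B (2 * R))" if w: "norm w = 2 * R" for w
    proof -
      have "1 \<le> norm (1 + w / a k)" if "k < n" for k
      proof -
        have "2 \<le> norm (w / a k)" using a[OF that] w R by (simp add: norm_divide field_simps)
        then show ?thesis using norm_diff_ineq[of "w / a k" 1] by (simp add: add.commute)
      qed
      then have "1 \<le> norm (\<Prod>k<n. 1 + w / a k)"
        by (subst prod_norm[symmetric]) (auto intro!: prod_ge_1)
      then have "norm (g w) \<le> norm (f w)" unfolding fg norm_mult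
        using mult_right_mono[of 1 _ "norm (g w)"] by simp
      then show ?thesis using B(1)[of w] w by simp
    qed
    have "norm (g w) < norm (g 0) * exp (M (2 * R))" if "norm w < R" for w
    proof -
      have "norm (g w) \<le> exp (B (2 * R))"
        by (rule norm_bound_sphere_imp_cball[where R = "2 * R" and f = g]) (use g(1) sph that R in auto)
      then show ?thesis using M_bound[of "2 * R"] g by simp
    qed
    then show ?thesis
      using zero_free_bound[of g R "M (2 * R)" z] g f nz z M by metis
  qed
  have lim0: "((\<lambda>R. 2 * M (2 * R) * norm z / (R - norm z)) \<longlongrightarrow> 0) at_top" for z :: complex
  proof -
    have "((\<lambda>R. 2 * norm z * (M (2 * R) / R) * (R / (R - norm z))) \<longlongrightarrow> 2 * norm z * 0 * 1) at_top"
      by (intro tendsto_intros M_lim) real_asymp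
    then have "((\<lambda>R. 2 * norm z * (M (2 * R) / R) * (R / (R - norm z))) \<longlongrightarrow> 0) at_top"
      by (simp only: mult_zero_right mult_zero_left)
    moreover have "\<forall>\<^sub>F R in at_top. 2 * norm z * (M (2 * R) / R) * (R / (R - norm z)) = 2 * M (2 * R) * norm z / (R - norm z)"
      using eventually_gt_at_top[of 0] eventually_gt_at_top[of "norm z"] by eventually_elim simp
    ultimately show ?thesis by (rule Lim_transform_eventually)
  qed
  define P where "P n a g \<longleftrightarrow> g holomorphic_on UNIV \<and> g 0 = f 0 \<and> (\<forall>w. f w = (\<Prod>k<n. 1 + w / a k) * g w) \<and>
      (\<forall>k<n. a k \<noteq> (0 :: complex))" for n :: nat and a and g :: "complex \<Rightarrow> complex"
  \<comment> \<open>Without zeros the estimate holds for all large \<open>R\<close>; letting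
    \<open>R\<close> tend to infinity makes \<open>g\<close> constant and \<open>f\<close> a
    polynomial, which is excluded.\<close>
  have has_zero: "\<exists>w. g w = 0" if P: "P n a g" for n a g
  proof (rule ccontr)
    assume "\<nexists>w. g w = 0"
    then have nz: "g w \<noteq> 0" for w by blast
    have g0: "g z = f 0" for z
    proof -
      define R0 where "R0 = (\<Sum>k<n. norm (a k))"
      have "\<forall>\<^sub>F R in at_top. \<exists>l. g z = f 0 * exp l \<and> norm l \<le> 2 * M (2 * R) * norm z / (R - norm z)"
        using eventually_gt_at_top[of "norm z"] eventually_ge_at_top[of R0]
      proof eventually_elim
        case (elim R)
        have "norm (a k) \<le> R0" if "k < n" for k
          unfolding R0_def by (rule member_le_sum) (use that in auto)
        then have "norm (a k) \<le> R" if "k < n" for k using elim that by force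
        then show ?case using P nz elim unfolding P_def
          by (intro close[where g = g and R = R and n = n and a = a and z = z]) blast+
      qed
      then obtain l where l: "\<forall>\<^sub>F R in at_top. g z = f 0 * exp (l R) \<and> norm (l R) \<le> 2 * M (2 * R) * norm z / (R - norm z)"
        by (auto simp: eventually_at_top_linorder) metis
      have "(l \<longlongrightarrow> 0) at_top"
        by (rule Lim_null_comparison[OF _ lim0]) (use l in \<open>auto elim: eventually_mono\<close>)
      then have "((\<lambda>R. f 0 * exp (l R)) \<longlongrightarrow> f 0 * exp 0) at_top" by (intro tendsto_intros)
      moreover have "((\<lambda>R. f 0 * exp (l R)) \<longlongrightarrow> g z) at_top"
        by (rule tendsto_eventually) (use l in \<open>auto elim: eventually_mono\<close>)
      ultimately show ?thesis using tendsto_unique trivial_limit_at_top_linorder by fastforce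
    qed
    have "f z = f 0 * (\<Prod>k<n. 1 + z / a k)" for z
      using P g0[of z] unfolding P_def by (metis mult.commute)
    then show False using nonpoly[where c = "f 0" and n = n and a = a] by blast
  qed
  define Q where "Q p q \<longleftrightarrow> snd q holomorphic_on UNIV \<and> fst q \<noteq> 0 \<and> snd p (- fst q) = 0 \<and>
      (\<forall>z. snd p z = (1 + z / fst q) * snd q z) \<and> (\<forall>w. snd p w = 0 \<longrightarrow> norm (fst q) \<le> norm w)"
    for p q :: "complex \<times> (complex \<Rightarrow> complex)"
  have ex_Q: "\<exists>q. Q (b, g) q" if P: "P n a g" for n a g b
  proof -
    obtain w where w: "g w = 0" using has_zero[OF P] by blast
    have g: "g holomorphic_on UNIV" "g 0 \<noteq> 0" using P f unfolding P_def by metis+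
    obtain z where z: "g z = 0" "\<And>w. g w = 0 \<Longrightarrow> norm z \<le> norm w"
      using exists_minimal_zero[OF g(1) w g(2)] by blast
    obtain h where "h holomorphic_on UNIV" "\<And>x. g x = (1 + x / (- z)) * h x"
      by (rule holomorphic_divide_zero[OF g(1), of "- z"]) (use z g in auto)
    then show ?thesis using z g(2) by (intro exI[of _ "(- z, h)"]) (auto simp: Q_def)
  qed
  \<comment> \<open>A state consists of the last zero split off, with its sign reversed, and the
    cofactor. The first component of the initial state is a dummy, hence the shift in the definition
    of \<open>a\<close>.\<close>
  define s where "s = rec_nat (0, f) (\<lambda>_ p. SOME q. Q p q)"
  have s_0: "s 0 = (0, f)" and s_Suc: "s (Suc n) = (SOME q. Q (s n) q)" for n
    by (simp_all add: s_def)
  define a where "a k = fst (s (Suc k))" for k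
  define g where "g n = snd (s n)" for n
  have PQ: "P n a (g n) \<and> Q (s n) (s (Suc n))" for n
  proof (induction n)
    case 0
    have "P 0 a (g 0)" using f by (simp add: P_def g_def s_0)
    then show ?case using ex_Q[of 0 a "g 0" "fst (s 0)"] by (simp add: s_Suc someI_ex g_def)
  next
    case (Suc n)
    have Q: "g (Suc n) holomorphic_on UNIV" "a n \<noteq> 0" "\<And>z. g n z = (1 + z / a n) * g (Suc n) z"
      using Suc by (auto simp: Q_def a_def g_def)
    have P: "f w = (\<Prod>k<n. 1 + w / a k) * g n w" "g n 0 = f 0" "k < n \<Longrightarrow> a k \<noteq> 0" for w k
      using Suc unfolding P_def by blast+
    have "P (Suc n) a (g (Suc n))"
      unfolding P_def
    proof (intro conjI allI impI)
      show "g (Suc n) 0 = f 0" using Q(3)[of 0] P(2) by simp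
      show "f w = (\<Prod>k<Suc n. 1 + w / a k) * g (Suc n) w" for w
        unfolding P(1)[of w] Q(3)[of w] by simp
    qed (use Q P(3) in \<open>auto simp: less_Suc_eq\<close>)
    then show ?case using ex_Q[of "Suc n" a "g (Suc n)" "fst (s (Suc n))"] by (simp add: s_Suc[of "Suc n"] someI_ex g_def)
  qed
  have ga: "g n (- a n) = 0" "\<And>w. g n w = 0 \<Longrightarrow> norm (a n) \<le> norm w" "a n \<noteq> 0"
    "\<And>z. g n z = (1 + z / a n) * g (Suc n) z" for n
    using PQ[of n] by (auto simp: Q_def a_def g_def)
  have g: "g n holomorphic_on UNIV" "g n 0 = f 0" "\<And>w. f w = (\<Prod>k<n. 1 + w / a k) * g n w" for n
    using PQ[of n] unfolding P_def by blast+
  have mono: "norm (a k) \<le> norm (a (Suc k))" for k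
    using ga(2)[of k "- a (Suc k)"] ga(1)[of "Suc k"] ga(4)[of k "- a (Suc k)"] by simp
  have a_le: "norm (a k) \<le> norm (a n)" if "k \<le> n" for k n
    using that mono by (rule lift_Suc_mono_le[of "\<lambda>k. norm (a k)", rotated])
  \<comment> \<open>If all the zeros lay in the disc of radius \<open>R\<close>, then on the circle
    of radius \<open>3 * R\<close> each factor would have modulus at least 2, and
    \<open>2 ^ n * norm (f 0)\<close> would be bounded for all \<open>n\<close>.\<close>
  have unbdd: "\<exists>n. norm (a n) > R" for R
  proof (rule ccontr)
    assume "\<nexists>n. norm (a n) > R"
    then have aR: "norm (a n) \<le> R" for n by (simp add: not_less)
    have R: "R > 0" using aR[of 0] ga(3)[of 0] by (meson less_le_trans zero_less_norm_iff)
    have "2 ^ n * norm (f 0) \<le> exp (B (3 * R))" for n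
    proof -
      have "norm (g n 0) \<le> exp (B (3 * R)) / 2 ^ n"
      proof (rule norm_bound_sphere_imp_cball[where R = "3 * R" and f = "g n"])
        fix w :: complex assume w: "norm w = 3 * R"
        have "2 \<le> norm (1 + w / a k)" for k
        proof -
          have "3 \<le> norm (w / a k)" using aR[of k] ga(3)[of k] w R by (simp add: norm_divide field_simps)
          then show ?thesis using norm_diff_ineq[of "w / a k" 1] by (simp add: add.commute)
        qed
        then have "(\<Prod>k<n. 2) \<le> (\<Prod>k<n. norm (1 + w / a k))" by (intro prod_mono) auto
        then have "2 ^ n \<le> norm (\<Prod>k<n. 1 + w / a k)" by (simp add: prod_norm)
        then have "2 ^ n * norm (g n w) \<le> norm (f w)"
          unfolding g(3)[of w n] norm_mult by (rule mult_right_mono) simp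
        then show "norm (g n w) \<le> exp (B (3 * R)) / 2 ^ n"
          using B(1)[of w] w by (simp add: field_simps)
      qed (use R g in auto)
      then show ?thesis by (simp add: g field_simps)
    qed
    moreover obtain n where "exp (B (3 * R)) / norm (f 0) < 2 ^ n"
      using real_arch_pow[of 2 "exp (B (3 * R)) / norm (f 0)"] by auto
    ultimately show False using f by (simp add: field_simps not_less[symmetric]) 
  qed
  have a_inf: "filterlim (\<lambda>n. norm (a n)) at_top sequentially"
    unfolding filterlim_at_top
  proof
    fix Z
    obtain N where "norm (a N) > Z" using unbdd by blast
    then show "\<forall>\<^sub>F n in sequentially. Z \<le> norm (a n)"
      unfolding eventually_sequentially by (meson a_le less_imp_le order.trans)
  qed
  show thesis
  proof (rule that[of a])
    show "a k \<noteq> 0" for k by (rule ga)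
    show "norm (a k) \<le> norm (a (Suc k))" for k by (rule mono)
    show "f (- a k) = 0" for k using g(3)[of "- a k" k] ga(1)[of k] by simp
    fix z
    have "\<forall>\<^sub>F n in sequentially. \<exists>l. g n z = f 0 * exp l \<and>
        norm l \<le> 2 * M (2 * norm (a n)) * norm z / (norm (a n) - norm z)"
      using filterlim_at_top_dense[THEN iffD1, OF a_inf, rule_format, of "norm z"]
    proof eventually_elim
      case (elim n)
      then show ?case
        by (intro close[where g = "g n" and R = "norm (a n)" and n = n and a = a and z = z] g)
          (use ga(3) a_le ga(2)[of n] in \<open>auto simp: not_le[symmetric] less_imp_le\<close>)
    qed
    then obtain l where l: "\<forall>\<^sub>F n in sequentially. g n z = f 0 * exp (l n) \<and>
        norm (l n) \<le> 2 * M (2 * norm (a n)) * norm z / (norm (a n) - norm z)"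
      by (auto simp: eventually_sequentially) metis
    have "l \<longlonglongrightarrow> 0"
      by (rule Lim_null_comparison[OF _ filterlim_compose[OF lim0 a_inf]]) (use l in \<open>auto elim: eventually_mono\<close>)
    then have "(\<lambda>n. f z * exp (- l n)) \<longlonglongrightarrow> f z * exp (- 0)" by (intro tendsto_intros)
    moreover have "\<forall>\<^sub>F n in sequentially. f z * exp (- l n) = f 0 * (\<Prod>k<n. 1 + z / a k)"
      using l
    proof eventually_elim
      case (elim n)
      then show ?case using g(3)[of z n] by (simp add: exp_minus field_simps)
    qed
    ultimately show "(\<lambda>n. f 0 * (\<Prod>k<n. 1 + z / a k)) \<longlonglongrightarrow> f z"
      by (simp add: tendsto_cong)
  qed
qed

section \<open>Reciprocals of Laplace transforms of totally positive kernels\<close>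

lemma tp_kernel_nonneg:
  assumes "tp_kernel L"
  shows "L x \<ge> 0"
proof -
  have "fdet 1 (\<lambda>j k. L (x - 0)) \<ge> 0"
  proof -
    have "strict_mono_on {..<1::nat} (\<lambda>_. y :: real)" for y by (auto intro!: strict_mono_onI)
    then show ?thesis using assms unfolding tp_kernel_def by blast
  qed
  then show ?thesis by (subst (asm) det_single) auto
qed

text \<open>If \<open>p\<close> had fewer than \<open>m\<close> real zeros, they would cut the line into at most \<open>m\<close> intervals on which
  \<open>p\<close> does not change sign, so that \<open>u\<close> would be, at the \<open>m + 1\<close> points \<open>x j\<close>, a combination of at most
  \<open>m\<close> columns of a totally nonnegative matrix.\<close>
lemma variation_diminishing_poly:
  fixes p :: "real poly"
  assumes L: "tp_kernel L" and p: "p \<noteq> 0"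
    and int: "\<And>x. integrable lebesgue (\<lambda>t. L (x - t) * poly p t)"
    and u: "\<And>x. u x = (\<integral>t. L (x - t) * poly p t \<partial>lebesgue)"
    and x: "strict_mono x" and alt: "\<And>j. j \<le> m \<Longrightarrow> \<sigma> * (-1) ^ j * u (x j) > 0"
  shows "card {t. poly p t = 0} \<ge> m"
proof (rule ccontr)
  define S where "S = {t. poly p t = 0}"
  have S: "finite S" unfolding S_def using p by (rule poly_roots_finite)
  assume "\<not> card {t. poly p t = 0} \<ge> m"
  then have m: "Suc (card S) \<le> m" by (simp add: S_def)
  \<comment> \<open>Counting the roots to the left indexes the root-free intervals from left to
    right; for \<open>i > card S\<close> the set \<open>I i\<close> is empty.\<close>
  define N where "N t = card {\<tau> \<in> S. \<tau> < t}" for t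
  define I where "I i = {t. t \<notin> S \<and> N t = i}" for i
  have N_mono: "N s \<le> N t" if "s \<le> t" for s t
    unfolding N_def using S that by (intro card_mono) auto
  have N_le: "N t \<le> card S" for t
    unfolding N_def using S by (intro card_mono) auto
  have I_less: "s < t" if "s \<in> I i" "t \<in> I j" "i < j" for s t i j
    using that N_mono[of t s] by (auto simp: I_def not_less[symmetric])
  have I_sets [measurable]: "I i \<in> sets borel" for i
  proof -
    have "real (N t) = (\<Sum>\<tau>\<in>S. indicator {\<tau><..} t)" for t
      unfolding N_def using S by (simp add: indicator_def Int_def conj_commute flip: sum.inter_filter)
    then have "(\<lambda>t. real (N t)) = (\<lambda>t. \<Sum>\<tau>\<in>S. indicator {\<tau><..} t)" by blast
    moreover have "(\<lambda>t :: real. \<Sum>\<tau>\<in>S. indicator {\<tau><..} t :: real) \<in> borel_measurable borel"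
      by measurable
    ultimately have N: "(\<lambda>t. real (N t)) \<in> borel_measurable borel" by simp
    have "S \<in> sets borel" using S by (simp add: sets.countable uncountable_infinite borel_closed finite_imp_closed)
    moreover have "(\<lambda>t. real (N t)) -` {real i} \<inter> space borel \<in> sets borel" by (rule measurable_sets[OF N]) auto
    moreover have "I i = ((\<lambda>t. real (N t)) -` {real i} \<inter> space borel) - S" by (auto simp: I_def)
    ultimately show ?thesis by simp
  qed
  define v where "v i = (if \<exists>t\<in>I i. poly p t < 0 then -1 else 1 :: real)" for i
  have sign: "poly p t = v i * \<bar>poly p t\<bar>" if t: "t \<in> I i" for i t
  proof -
    have no: False if pn: "s \<in> I i" "s' \<in> I i" "poly p s < 0" "poly p s' > 0" for s s'
    proof -
      have *: False if "a < b" "a \<in> I i" "b \<in> I i" "poly p c = 0" "a < c" "c < b" for a b c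
      proof -
        have "{\<tau> \<in> S. \<tau> < a} \<subseteq> {\<tau> \<in> S. \<tau> < b}" using that(1) by auto
        moreover have "c \<in> {\<tau> \<in> S. \<tau> < b}" "c \<notin> {\<tau> \<in> S. \<tau> < a}" using that(4-6) by (auto simp: S_def)
        ultimately have "{\<tau> \<in> S. \<tau> < a} \<subset> {\<tau> \<in> S. \<tau> < b}" by blast
        then have "N a < N b" unfolding N_def by (intro psubset_card_mono finite_Collect_conjI disjI1) (simp_all add: S)
        moreover have "N a = i" "N b = i" using that(2,3) by (simp_all add: I_def)
        ultimately show False by simp
      qed
      have "s \<noteq> s'" using that(3,4) by auto
      then consider "s < s'" | "s' < s" by linarith
      then show False
      proof cases
        case 1
        then obtain c where "s < c" "c < s'" "poly p c = 0" using poly_IVT_pos[of s s' p] pn by auto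
        then show False using *[of s s' c] 1 pn by simp
      next
        case 2
        then obtain c where "s' < c" "c < s" "poly p c = 0" using poly_IVT_neg[of s' s p] pn by auto
        then show False using *[of s' s c] 2 pn by simp
      qed
    qed
    have p0: "poly p t \<noteq> 0" using t by (simp add: I_def S_def)
    show ?thesis
    proof (cases "poly p t < 0")
      case True
      then have "v i = -1" using t unfolding v_def by auto
      then show ?thesis using True by simp
    next
      case False
      then have "poly p t > 0" using p0 by simp
      then have "\<not> (\<exists>s\<in>I i. poly p s < 0)" using no t by blast
      then have "v i = 1" unfolding v_def by (rule if_not_P)
      then show ?thesis using False by simp
    qed
  qed
  \<comment> \<open>With the nonnegative weight |p| each column is an average of columns of the
    kernel, so the minors stay nonnegative; the signs of \<open>p\<close> become the coefficients
    \<open>v i\<close> in the expansion of \<open>u\<close>.\<close>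
  define a where "a j i = (\<integral>t. indicator (I i) t * (L (x j - t) * \<bar>poly p t\<bar>) \<partial>lebesgue)" for j i
  have intK: "integrable lebesgue (\<lambda>t. indicator (I i) t * (L (y - t) * \<bar>poly p t\<bar>))" for i y
  proof -
    have "integrable lebesgue (\<lambda>t. indicator (I i) t *\<^sub>R \<bar>L (y - t) * poly p t\<bar>)"
      by (intro integrable_mult_indicator integrable_abs int) auto
    then show ?thesis using tp_kernel_nonneg[OF L] by (simp add: abs_mult)
  qed
  show False
  proof (rule tn_combination_not_alternating[of a id "Suc (card S)" "\<lambda>j. u (x j)" v \<sigma>])
    fix n r c assume r: "strict_mono (r :: nat \<Rightarrow> nat)" and c: "strict_mono (c :: nat \<Rightarrow> nat)"
    show "fdet n (\<lambda>j k. a (r j) (c k)) \<ge> 0"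
      unfolding a_def
    proof (rule fdet_integral_nonneg[where I = "\<lambda>k. I (c k)"])
      fix t assume t: "\<And>k. k < n \<Longrightarrow> t k \<in> I (c k)"
      have "strict_mono_on {..<n} t"
        using t c by (auto intro!: strict_mono_onI I_less simp: strict_mono_def)
      moreover have "strict_mono_on {..<n} (\<lambda>j. x (r j))"
        using x r by (auto simp: strict_mono_on_def strict_mono_def)
      ultimately have "fdet n (\<lambda>j k. L (x (r j) - t k)) \<ge> 0" using L by (simp add: tp_kernel_def)
      then have "fdet n (\<lambda>j k. 1 * \<bar>poly p (t k)\<bar> * L (x (r j) - t k)) \<ge> 0"
        unfolding fdet_scale by (auto intro!: mult_nonneg_nonneg prod_nonneg)
      also have "fdet n (\<lambda>j k. 1 * \<bar>poly p (t k)\<bar> * L (x (r j) - t k)) =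
          fdet n (\<lambda>j k. indicator (I (c k)) (t k) * (L (x (r j) - t k) * \<bar>poly p (t k)\<bar>))"
        using t by (intro fdet_cong) simp
      finally show "fdet n (\<lambda>j k. indicator (I (c k)) (t k) * (L (x (r j) - t k) * \<bar>poly p (t k)\<bar>)) \<ge> 0" .
    qed (auto simp: intK)
  next
    fix j
    have "u (x j) = (\<integral>t. (\<Sum>i<Suc (card S). v i * (indicator (I i) t * (L (x j - t) * \<bar>poly p t\<bar>))) \<partial>lebesgue)"
      unfolding u
    proof (rule Bochner_Integration.integral_cong)
      fix t
      have "(\<Sum>i<Suc (card S). v i * (indicator (I i) t * (L (x j - t) * \<bar>poly p t\<bar>))) =
          (\<Sum>i<Suc (card S). if i = N t \<and> t \<notin> S then v i * (L (x j - t) * \<bar>poly p t\<bar>) else 0)"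
        by (intro sum.cong) (auto simp: I_def indicator_def)
      also have "\<dots> = L (x j - t) * poly p t"
      proof (cases "t \<in> S")
        case True
        then show ?thesis by (simp add: S_def)
      next
        case False
        then have "poly p t = v (N t) * \<bar>poly p t\<bar>" by (intro sign) (simp add: I_def)
        then have "L (x j - t) * poly p t = v (N t) * (L (x j - t) * \<bar>poly p t\<bar>)"
          by (metis mult.left_commute)
        moreover have "(\<Sum>i<Suc (card S). if i = N t \<and> t \<notin> S then v i * (L (x j - t) * \<bar>poly p t\<bar>) else 0) =
            v (N t) * (L (x j - t) * \<bar>poly p t\<bar>)"
          using False N_le[of t] by (simp add: less_Suc_eq_le del: sum.lessThan_Suc)
        ultimately show ?thesis by (simp only:)
      qed
      finally show "L (x j - t) * poly p t = (\<Sum>i<Suc (card S). v i * (indicator (I i) t * (L (x j - t) * \<bar>poly p t\<bar>)))" ..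
    qed simp
    also have "\<dots> = (\<Sum>i<Suc (card S). v i * a j i)"
      unfolding a_def using intK by (subst Bochner_Integration.integral_sum) auto
    finally show "u (x j) = (\<Sum>i<Suc (card S). v i * a j (id i))" by simp
  qed (use m alt in \<open>auto simp: strict_mono_def\<close>)
qed

text \<open>With as many distinct real roots as its degree, a nonzero \<open>P\<close> splits into
  linear factors with real roots t, and |z - t| \<ge> |Im z|. An inequality is stated, and not the
  location of the roots, because it passes to limits.\<close>

lemma poly_norm_lower_bound:
  fixes P :: "complex poly"
  assumes S: "finite S" "card S = degree P" and roots: "\<And>t. t \<in> S \<Longrightarrow> poly P (complex_of_real t) = 0"
  shows "norm (lead_coeff P) * \<bar>Im z\<bar> ^ degree P \<le> norm (poly P z)"
proof (cases "P = 0")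
  case False
  define D where "D = (\<Prod>t\<in>S. [:- complex_of_real t, 1:])"
  have "(\<Prod>t\<in>T. [:- complex_of_real t, 1:]) dvd P" if "T \<subseteq> S" for T
    using finite_subset[OF that S(1)] that
  proof (induction T rule: finite_induct)
    case (insert t T)
    then obtain r where r: "P = (\<Prod>t\<in>T. [:- complex_of_real t, 1:]) * r" by (auto elim: dvdE)
    have "poly (\<Prod>t\<in>T. [:- complex_of_real t, 1:]) (of_real t) \<noteq> 0"
      using insert by (auto simp: poly_prod prod_zero_iff)
    moreover have "poly P (of_real t) = 0" using insert roots by auto
    ultimately have "poly r (of_real t) = 0" by (simp add: r)
    then have "[:- of_real t, 1:] dvd r" by (simp add: poly_eq_0_iff_dvd)
    then have "[:- of_real t, 1:] * (\<Prod>t\<in>T. [:- complex_of_real t, 1:]) dvd r * (\<Prod>t\<in>T. [:- complex_of_real t, 1:])"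
      by (rule mult_dvd_mono) simp
    then show ?case unfolding prod.insert[OF insert.hyps(1,2)] r by (simp only: mult.commute)
  qed simp
  then obtain r where r: "P = D * r" unfolding D_def by blast
  have "degree D = card S" unfolding D_def by (subst degree_prod_eq_sum_degree) auto
  moreover have "D \<noteq> 0" "r \<noteq> 0" using False r by auto
  ultimately have "degree r = 0" using S(2) by (simp add: r degree_mult_eq)
  then obtain c where c: "r = [:c:]" by (metis degree_eq_zeroE)
  have "lead_coeff D = 1" unfolding D_def by (simp add: lead_coeff_prod)
  then have lc: "lead_coeff P = c" by (simp add: r c)
  have "norm (poly P z) = norm c * (\<Prod>t\<in>S. norm (z - of_real t))"
    by (simp add: r c D_def poly_prod norm_mult prod_norm[symmetric])
  moreover have "(\<Prod>t\<in>S. \<bar>Im z\<bar>) \<le> (\<Prod>t\<in>S. norm (z - of_real t))"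
    using abs_Im_le_cmod[of "z - of_real t" for t] by (intro prod_mono) auto
  ultimately show ?thesis using S(2) lc by (simp add: mult_left_mono)
qed simp

section \<open>Appell and Jensen polynomials of the reciprocal series\<close>

lemma integrable_lebesgue_reflect:
  fixes f :: "real \<Rightarrow> real"
  shows "integrable lebesgue (\<lambda>t. f (x - t)) \<longleftrightarrow> integrable lebesgue f"
    and "(\<integral>t. f (x - t) \<partial>lebesgue) = (\<integral>t. f t \<partial>lebesgue)"
  using lebesgue_integrable_real_affine_iff[of "-1" f x] lebesgue_integral_real_affine[of "-1" f x] by simp_all

text \<open>The power series \<open>\<Sum>k. c k z ^ k\<close> is the formal reciprocal of the Laplace transform of \<open>L\<close>.\<close>
locale reciprocal_moments =
  fixes L :: "real \<Rightarrow> real" and c :: "nat \<Rightarrow> real"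
  assumes L: "tp_kernel L"
    and moment: "\<And>k. integrable lebesgue (\<lambda>x. L x * x ^ k)"
    and recip: "Abs_fps c * Abs_fps (\<lambda>k. (-1) ^ k * (\<integral>x. L x * x ^ k \<partial>lebesgue) / fact k) = 1"
begin

definition m :: "nat \<Rightarrow> real" where
  "m k = (-1) ^ k * (\<integral>x. L x * x ^ k \<partial>lebesgue) / fact k"

lemma c_0: "c 0 \<noteq> 0"
proof
  assume "c 0 = 0"
  moreover have "fps_nth (Abs_fps c * Abs_fps m) 0 = 1"
    unfolding m_def[abs_def] recip by simp
  ultimately show False by (simp add: fps_mult_nth)
qed

text \<open>The Appell polynomials f(D) x^l of the series f(z) = \<Sum> c i z^i, with exponential
  generating function f(t) exp (x t).\<close>

definition appell :: "nat \<Rightarrow> real poly" where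
  "appell l = (\<Sum>i=0..l. monom (fact l * c i / fact (l - i)) (l - i))"

lemma poly_appell: "poly (appell l) x = fact l * (\<Sum>i=0..l. c i * (x ^ (l - i) / fact (l - i)))"
  by (simp add: appell_def poly_sum poly_monom sum_distrib_left mult_ac)

lemma integrable_poly: "integrable lebesgue (\<lambda>x. L x * poly p x)"
  by (simp add: poly_altdef sum_distrib_left mult.left_commute[of "L _"] moment)

lemma integral_power_shift:
  "(\<integral>u. L u * ((x - u) ^ j / fact j) \<partial>lebesgue) = (\<Sum>i=0..j. m i * (x ^ (j - i) / fact (j - i)))"
proof -
  have "L u * ((x - u) ^ j / fact j) = (\<Sum>i=0..j. ((-1) ^ i / fact i * (x ^ (j - i) / fact (j - i))) * (L u * u ^ i))" for u
  proof -
    have "(x - u) ^ j = (\<Sum>i\<le>j. of_nat (j choose i) * (- u) ^ i * x ^ (j - i))"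
      using binomial_ring[of "- u" x j] by simp
    also have "\<dots> / fact j = (\<Sum>i=0..j. (-1) ^ i / fact i * (x ^ (j - i) / fact (j - i)) * u ^ i)"
      unfolding sum_divide_distrib atLeast0AtMost
      by (intro sum.cong) (auto simp: binomial_fact power_minus[of u] field_simps)
    finally show ?thesis by (simp add: sum_distrib_left mult_ac)
  qed
  then have "(\<integral>u. L u * ((x - u) ^ j / fact j) \<partial>lebesgue) =
      (\<Sum>i=0..j. ((-1) ^ i / fact i * (x ^ (j - i) / fact (j - i))) * (\<integral>u. L u * u ^ i \<partial>lebesgue))"
    using moment by (simp add: Bochner_Integration.integral_sum)
  then show ?thesis by (simp add: m_def mult_ac)
qed

text \<open>On generating functions, convolution with \<open>L\<close> multiplies exp (x t) by the
  Laplace transform of \<open>L\<close>, and passing to Appell polynomials multiplies it by the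
  reciprocal series. The two cancel.\<close>

lemma integral_appell: "(\<integral>u. L u * poly (appell l) (x - u) \<partial>lebesgue) = x ^ l"
proof -
  define E where "E = Abs_fps (\<lambda>j. x ^ j / fact j)"
  have "integrable lebesgue (\<lambda>u. L u * poly ([:x, -1:] ^ j) u)" for j by (rule integrable_poly)
  then have int: "integrable lebesgue (\<lambda>u. L u * ((x - u) ^ j))" for j by (simp add: poly_power)
  have "L u * poly (appell l) (x - u) = (\<Sum>i=0..l. fact l * c i * (L u * ((x - u) ^ (l - i) / fact (l - i))))" for u
    by (simp add: poly_appell sum_distrib_left mult_ac)
  then have "(\<integral>u. L u * poly (appell l) (x - u) \<partial>lebesgue) =
      (\<Sum>i=0..l. fact l * c i * (\<integral>u. L u * ((x - u) ^ (l - i) / fact (l - i)) \<partial>lebesgue))"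
    using int by (simp add: Bochner_Integration.integral_sum)
  also have "\<dots> = fact l * fps_nth (Abs_fps c * (Abs_fps m * E)) l"
    unfolding integral_power_shift fps_mult_nth by (simp add: E_def sum_distrib_left mult.assoc)
  also have "Abs_fps c * (Abs_fps m * E) = E"
    using recip by (simp add: m_def[abs_def] flip: mult.assoc)
  finally show ?thesis by (simp add: E_def)
qed

lemma degree_appell: "degree (appell l) = l" and coeff_appell: "coeff (appell l) l = c 0"
proof -
  have le: "degree (appell l) \<le> l" unfolding appell_def
    by (intro degree_sum_le) (auto intro: order.trans[OF degree_monom_le])
  have "coeff (appell l) l = (\<Sum>i=0..l. if i = 0 then c 0 else 0)"
    unfolding appell_def coeff_sum by (intro sum.cong) auto
  then show "coeff (appell l) l = c 0" by simp
  then show "degree (appell l) = l" using le c_0 by (metis le_degree order.antisym)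
qed

text \<open>The inverse of convolution with \<open>L\<close>, on polynomials.\<close>
definition deconv :: "real poly \<Rightarrow> real poly" where
  "deconv q = (\<Sum>l\<le>degree q. Polynomial.smult (coeff q l) (appell l))"

lemma integral_deconv: "(\<integral>t. L (x - t) * poly (deconv q) t \<partial>lebesgue) = poly q x"
proof -
  have int: "integrable lebesgue (\<lambda>u. L u * poly (appell l) (x - u))" for l
    using integrable_poly[of "pcompose (appell l) [:x, -1:]"] by (simp add: poly_pcompose)
  have "(\<integral>t. L (x - t) * poly (deconv q) t \<partial>lebesgue) = (\<integral>u. L u * poly (deconv q) (x - u) \<partial>lebesgue)"
    using integrable_lebesgue_reflect(2)[of "\<lambda>u. L u * poly (deconv q) (x - u)" x] by simp
  also have "\<dots> = (\<integral>u. (\<Sum>l\<le>degree q. coeff q l * (L u * poly (appell l) (x - u))) \<partial>lebesgue)"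
    by (simp add: deconv_def poly_sum sum_distrib_left mult_ac)
  also have "\<dots> = (\<Sum>l\<le>degree q. coeff q l * x ^ l)"
    using int by (simp add: Bochner_Integration.integral_sum integral_appell)
  finally show ?thesis by (simp add: poly_altdef)
qed

lemma degree_deconv: "degree (deconv q) = degree q" and lead_coeff_deconv: "coeff (deconv q) (degree q) = lead_coeff q * c 0"
proof -
  have le: "degree (deconv q) \<le> degree q" unfolding deconv_def
    by (intro degree_sum_le) (auto intro: order.trans[OF degree_smult_le] simp: degree_appell)
  have "coeff (deconv q) (degree q) = (\<Sum>l\<le>degree q. if l = degree q then coeff q l * c 0 else 0)"
    unfolding deconv_def coeff_sum
    by (intro sum.cong) (auto simp: coeff_appell degree_appell coeff_eq_0)
  then show *: "coeff (deconv q) (degree q) = lead_coeff q * c 0" by simp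
  show "degree (deconv q) = degree q"
  proof (cases "q = 0")
    case True then show ?thesis by (simp add: deconv_def)
  next
    case False
    then have "coeff (deconv q) (degree q) \<noteq> 0" using * c_0 by simp
    then show ?thesis using le le_degree by (metis order.antisym)
  qed
qed

text \<open>A monic substitute for x^n, to which it tends as \<epsilon> goes to 0, with
  \<open>n\<close> simple zeros. Variation diminution applied to x^n itself would yield at most one
  real zero.\<close>

definition nodal :: "real \<Rightarrow> nat \<Rightarrow> real poly" where
  "nodal \<epsilon> n = (\<Prod>i<n. [:- (\<epsilon> * real i), 1:])"

lemma degree_nodal: "degree (nodal \<epsilon> n) = n" and lead_coeff_nodal: "coeff (nodal \<epsilon> n) n = 1"
proof -
  show *: "degree (nodal \<epsilon> n) = n" unfolding nodal_def by (subst degree_prod_eq_sum_degree) auto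
  have "lead_coeff (nodal \<epsilon> n) = 1" unfolding nodal_def by (simp add: lead_coeff_prod)
  then show "coeff (nodal \<epsilon> n) n = 1" by (simp add: *)
qed

text \<open>The points \<epsilon> (j - 1/2) interlace the zeros 0, \<epsilon>, ..., (n - 1)
  \<epsilon>, with one point beyond each end.\<close>

lemma nodal_sign:
  assumes "\<epsilon> > 0" "j \<le> n"
  shows "(-1) ^ n * (-1) ^ j * poly (nodal \<epsilon> n) (\<epsilon> * (real j - 1 / 2)) > 0"
  using assms(2)
proof (induction n rule: dec_induct)
  case base
  have "poly (nodal \<epsilon> j) (\<epsilon> * (real j - 1 / 2)) = (\<Prod>i<j. \<epsilon> * (real j - 1 / 2 - real i))"
    by (simp add: nodal_def poly_prod algebra_simps)
  also have "\<dots> > 0" using assms(1) by (intro prod_pos) auto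
  finally show ?case by (simp flip: power_add mult.assoc)
next
  case (step n)
  have P: "poly (nodal \<epsilon> (Suc n)) (\<epsilon> * (real j - 1 / 2)) =
      poly (nodal \<epsilon> n) (\<epsilon> * (real j - 1 / 2)) * (\<epsilon> * (real j - 1 / 2 - real n))"
    by (simp add: nodal_def algebra_simps)
  have "b * a * (A * (\<epsilon> * (real j - 1 / 2 - real n))) = - b * a * A * (\<epsilon> * (real n + 1 / 2 - real j))"
    for A a b :: real by (simp add: algebra_simps)
  from this[of "(-1) ^ Suc n" "(-1) ^ j"]
  have "(-1) ^ Suc n * (-1) ^ j * poly (nodal \<epsilon> (Suc n)) (\<epsilon> * (real j - 1 / 2)) =
      (-1) ^ n * (-1) ^ j * poly (nodal \<epsilon> n) (\<epsilon> * (real j - 1 / 2)) * (\<epsilon> * (real n + 1 / 2 - real j))"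
    unfolding P by simp
  moreover have "\<epsilon> * (real n + 1 / 2 - real j) > 0" using step assms by simp
  ultimately show ?case using mult_pos_pos[OF step.IH, of "\<epsilon> * (real n + 1 / 2 - real j)"]
    by (simp only:)
qed

text \<open>Convolution with \<open>L\<close> turns \<open>deconv (nodal \<epsilon> n)\<close> into
  \<open>nodal \<epsilon> n\<close>, which alternates at \<open>n + 1\<close> points. So the former
  has \<open>n\<close> distinct real zeros, as many as its degree. What matters is that the bound
  does not depend on \<epsilon>.\<close>

lemma deconv_nodal_bound:
  assumes \<epsilon>: "\<epsilon> > 0"
  shows "\<bar>c 0\<bar> * \<bar>Im z\<bar> ^ n \<le> norm (poly (map_poly complex_of_real (deconv (nodal \<epsilon> n))) z)"
proof -
  let ?p = "deconv (nodal \<epsilon> n)"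
  have deg: "degree ?p = n" "coeff ?p n = c 0"
    using degree_deconv[of "nodal \<epsilon> n"] lead_coeff_deconv[of "nodal \<epsilon> n"]
    by (simp_all add: degree_nodal lead_coeff_nodal)
  then have p: "?p \<noteq> 0" using c_0 by auto
  have int: "integrable lebesgue (\<lambda>t. L (x - t) * poly ?p t)" for x
    using integrable_poly[of "pcompose ?p [:x, -1:]"]
      integrable_lebesgue_reflect(1)[of "\<lambda>u. L u * poly ?p (x - u)" x] by (simp add: poly_pcompose)
  have "n \<le> card {t. poly ?p t = 0}"
  proof (rule variation_diminishing_poly[OF L p int])
    show "strict_mono (\<lambda>j. \<epsilon> * (real j - 1 / 2))" using \<epsilon> by (auto simp: strict_mono_def)
    show "poly (nodal \<epsilon> n) x = (\<integral>t. L (x - t) * poly ?p t \<partial>lebesgue)" for x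
      by (rule integral_deconv[symmetric])
    show "(-1) ^ n * (-1) ^ j * poly (nodal \<epsilon> n) (\<epsilon> * (real j - 1 / 2)) > 0" if "j \<le> n" for j
      by (rule nodal_sign[OF \<epsilon> that])
  qed
  moreover have "card {t. poly ?p t = 0} \<le> n"
    using card_poly_roots_bound[OF p] deg by simp
  ultimately have card: "card {t. poly ?p t = 0} = n" by simp
  have deg': "degree (map_poly complex_of_real ?p) = n" using deg by (simp add: degree_map_poly)
  have "norm (lead_coeff (map_poly complex_of_real ?p)) * \<bar>Im z\<bar> ^ degree (map_poly complex_of_real ?p) \<le>
      norm (poly (map_poly complex_of_real ?p) z)"
  proof (rule poly_norm_lower_bound)
    show "finite {t. poly ?p t = 0}" using p by (rule poly_roots_finite)
    fix t assume t: "t \<in> {t. poly ?p t = 0}"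
    have "poly (map_poly complex_of_real ?p) (of_real t) = of_real (poly ?p t)"
      by (simp add: poly_altdef degree_map_poly coeff_map_poly)
    then show "poly (map_poly complex_of_real ?p) (of_real t) = 0" using t by simp
  qed (simp add: card deg')
  then show ?thesis by (simp add: deg' coeff_map_poly deg)
qed

lemma nodal_coeff_tendsto: "((\<lambda>\<epsilon>. coeff (nodal \<epsilon> n) l) \<longlongrightarrow> (if l = n then 1 else 0)) (at_right 0)"
proof (induction n arbitrary: l)
  case 0
  show ?case by (simp add: nodal_def)
next
  case (Suc n)
  have eq: "coeff (nodal \<epsilon> (Suc n)) l = - (\<epsilon> * real n) * coeff (nodal \<epsilon> n) l +
      (case l of 0 \<Rightarrow> 0 | Suc k \<Rightarrow> coeff (nodal \<epsilon> n) k)" for \<epsilon>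
  proof -
    have "nodal \<epsilon> (Suc n) = [:- (\<epsilon> * real n), 1:] * nodal \<epsilon> n" by (simp add: nodal_def mult.commute)
    then show ?thesis by (simp add: coeff_pCons split: nat.split)
  qed
  show ?case
  proof (cases l)
    case 0
    have "((\<lambda>\<epsilon>. - (\<epsilon> * real n) * coeff (nodal \<epsilon> n) l + 0) \<longlongrightarrow> - (0 * real n) * (if l = n then 1 else 0) + 0) (at_right 0)"
      by (intro tendsto_intros Suc)
    then show ?thesis unfolding eq by (simp add: 0)
  next
    case (Suc k)
    have "((\<lambda>\<epsilon>. - (\<epsilon> * real n) * coeff (nodal \<epsilon> n) l + coeff (nodal \<epsilon> n) k) \<longlongrightarrow>
        - (0 * real n) * (if l = n then 1 else 0) + (if k = n then 1 else 0)) (at_right 0)"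
      by (intro tendsto_intros Suc.IH)
    then show ?thesis unfolding eq by (simp add: Suc)
  qed
qed

text \<open>\<open>deconv\<close> is linear in the coefficients, so the uniform bound survives the
  limit \<epsilon> to 0, in which the zeros of \<open>nodal\<close> merge.\<close>

lemma appell_bound: "\<bar>c 0\<bar> * \<bar>Im z\<bar> ^ n \<le> norm (poly (map_poly complex_of_real (appell n)) z)"
proof -
  have "poly (map_poly complex_of_real (deconv (nodal \<epsilon> n))) z =
      (\<Sum>l\<le>n. of_real (coeff (nodal \<epsilon> n) l) * poly (map_poly complex_of_real (appell l)) z)" for \<epsilon>
  proof -
    have *: "poly (map_poly complex_of_real p) z = (\<Sum>k\<le>n. of_real (coeff p k) * z ^ k)" if "degree p \<le> n" for p
    proof -
      have "(\<Sum>k\<le>degree p. of_real (coeff p k) * z ^ k) = (\<Sum>k\<le>n. of_real (coeff p k) * z ^ k)"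
        using that by (intro sum.mono_neutral_left) (auto simp: coeff_eq_0)
      then show ?thesis by (simp add: poly_altdef degree_map_poly coeff_map_poly)
    qed
    have "poly (map_poly complex_of_real (deconv (nodal \<epsilon> n))) z =
        (\<Sum>k\<le>n. of_real (\<Sum>l\<le>n. coeff (nodal \<epsilon> n) l * coeff (appell l) k) * z ^ k)"
      by (subst *) (simp_all add: degree_deconv degree_nodal, simp add: deconv_def coeff_sum degree_nodal)
    also have "\<dots> = (\<Sum>k\<le>n. \<Sum>l\<le>n. of_real (coeff (nodal \<epsilon> n) l) * (of_real (coeff (appell l) k) * z ^ k))"
      by (simp add: sum_distrib_right mult.assoc)
    also have "\<dots> = (\<Sum>l\<le>n. \<Sum>k\<le>n. of_real (coeff (nodal \<epsilon> n) l) * (of_real (coeff (appell l) k) * z ^ k))"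
      by (rule sum.swap)
    also have "\<dots> = (\<Sum>l\<le>n. of_real (coeff (nodal \<epsilon> n) l) * poly (map_poly complex_of_real (appell l)) z)"
      by (intro sum.cong) (simp_all add: * degree_appell flip: sum_distrib_left)
    finally show ?thesis .
  qed
  moreover have "((\<lambda>\<epsilon>. norm (\<Sum>l\<le>n. of_real (coeff (nodal \<epsilon> n) l) * poly (map_poly complex_of_real (appell l)) z)) \<longlongrightarrow>
      norm (\<Sum>l\<le>n. of_real (if l = n then 1 else 0) * poly (map_poly complex_of_real (appell l)) z)) (at_right 0)"
    by (intro tendsto_intros nodal_coeff_tendsto)
  moreover have "(\<Sum>l\<le>n. of_real (if l = n then 1 else 0) * poly (map_poly complex_of_real (appell l)) z) =
      poly (map_poly complex_of_real (appell n)) z"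
    by (simp add: if_distrib[of of_real] if_distrib[of "\<lambda>x. x * _"] cong: if_cong)
  ultimately have lim: "((\<lambda>\<epsilon>. norm (poly (map_poly complex_of_real (deconv (nodal \<epsilon> n))) z)) \<longlongrightarrow>
      norm (poly (map_poly complex_of_real (appell n)) z)) (at_right 0)" by simp
  have "\<forall>\<^sub>F \<epsilon> in at_right 0. \<bar>c 0\<bar> * \<bar>Im z\<bar> ^ n \<le> norm (poly (map_poly complex_of_real (deconv (nodal \<epsilon> n))) z)"
    using eventually_at_right_less[of 0] by eventually_elim (rule deconv_nodal_bound)
  then show ?thesis by (rule tendsto_lowerbound[OF lim]) simp
qed

text \<open>The weights vanish for \<open>i > n\<close>, so this is the polynomial \<open>\<Sum>i\<le>n. c i n! / ((n - i)! n\<^sup>i) z\<^sup>i\<close>.\<close>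
definition jensen :: "nat \<Rightarrow> complex \<Rightarrow> complex" where
  "jensen n z = (\<Sum>i. of_real (c i * (\<Prod>j<i. 1 - real j / real n)) * z ^ i)"

lemma jensen_weight: "i \<le> n \<Longrightarrow> n > 0 \<Longrightarrow> (\<Prod>j<i. 1 - real j / real n) = fact n / (fact (n - i) * real n ^ i)"
proof (induction i)
  case (Suc i)
  define r where "r = real (n - i)"
  have r: "r \<noteq> 0" using Suc.prems by (simp add: r_def)
  have F: "fact (n - i) = r * fact (n - Suc i)"
    unfolding r_def using Suc.prems by (metis Suc_diff_Suc Suc_le_lessD fact_Suc of_nat_fact of_nat_mult)
  have "1 - real i / real n = r / real n"
    unfolding r_def using Suc.prems by (simp add: field_simps of_nat_diff)
  then have "(\<Prod>j<Suc i. 1 - real j / real n) = fact n / (fact (n - i) * real n ^ i) * (r / real n)"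
    using Suc by simp
  also have "\<dots> = fact n / (fact (n - Suc i) * real n ^ Suc i)"
    unfolding F using r Suc.prems by (simp add: divide_simps)
  finally show ?case .
qed simp

lemma jensen_weight_0: "i > n \<Longrightarrow> n > 0 \<Longrightarrow> (\<Prod>j<i. 1 - real j / real n) = 0"
  by (rule prod_zero) auto

lemma jensen_weight_bounds: "0 \<le> (\<Prod>j<i. 1 - real j / real n)" "(\<Prod>j<i. 1 - real j / real n) \<le> 1" if "n > 0"
proof -
  have "0 \<le> (\<Prod>j<i. 1 - real j / real n) \<and> (\<Prod>j<i. 1 - real j / real n) \<le> 1"
  proof (cases "i \<le> n")
    case True
    then show ?thesis using that by (auto intro!: prod_nonneg prod_le_1)
  next
    case False
    then have z: "(\<Prod>j<i. 1 - real j / real n) = 0" using that by (intro jensen_weight_0) auto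
    show ?thesis unfolding z by simp
  qed
  then show "0 \<le> (\<Prod>j<i. 1 - real j / real n)" "(\<Prod>j<i. 1 - real j / real n) \<le> 1" by auto
qed

lemma jensen_eq_sum: "n > 0 \<Longrightarrow> jensen n z = (\<Sum>i\<le>n. of_real (c i * (\<Prod>j<i. 1 - real j / real n)) * z ^ i)"
  unfolding jensen_def by (rule suminf_finite) (auto simp: jensen_weight_0)

text \<open>Up to the factor (z / n)^n, \<open>jensen n\<close> at \<open>z\<close> is the n-th
  Appell polynomial at \<open>n / z\<close>, and inversion maps nonreal points to nonreal points,
  where that polynomial is bounded away from 0.\<close>

lemma jensen_nonzero:
  assumes n: "n > 0" and z: "Im z \<noteq> 0"
  shows "jensen n z \<noteq> 0"
proof -
  have z0: "z \<noteq> 0" using z by auto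
  have "poly (map_poly complex_of_real (appell n)) (of_nat n / z) =
      (\<Sum>i\<le>n. of_real (fact n * c i / fact (n - i)) * (of_nat n / z) ^ (n - i))"
  proof -
    have "map_poly complex_of_real (appell n) = (\<Sum>i\<le>n. monom (of_real (fact n * c i / fact (n - i))) (n - i))"
      by (rule poly_eqI) (simp add: coeff_map_poly appell_def coeff_sum atLeast0AtMost if_distrib[of of_real] cong: if_cong)
    then show ?thesis by (simp add: poly_sum poly_monom)
  qed
  also have "(z / of_nat n) ^ n * \<dots> = jensen n z"
    unfolding jensen_eq_sum[OF n] sum_distrib_left
  proof (intro sum.cong refl)
    fix i assume i: "i \<in> {..n}"
    then have i': "i \<le> n" by simp
    then have "(z / of_nat n) ^ n = (z / of_nat n) ^ i * (z / of_nat n) ^ (n - i)" by (simp flip: power_add)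
    moreover have "(z / of_nat n) ^ (n - i) * (of_nat n / z) ^ (n - i) = 1"
      using z0 n by (simp flip: power_mult_distrib)
    ultimately have h: "(z / of_nat n) ^ n * (of_real (fact n * c i / fact (n - i)) * (of_nat n / z) ^ (n - i)) =
        (z / of_nat n) ^ i * of_real (fact n * c i / fact (n - i))"
      by (simp add: mult_ac)
    show "(z / of_nat n) ^ n * (of_real (fact n * c i / fact (n - i)) * (of_nat n / z) ^ (n - i)) =
        of_real (c i * (\<Prod>j<i. 1 - real j / real n)) * z ^ i"
      unfolding h jensen_weight[OF i' n] by (simp add: power_divide mult_ac)
  qed
  finally have "jensen n z = (z / of_nat n) ^ n * poly (map_poly complex_of_real (appell n)) (of_nat n / z)" ..
  moreover have "Im (of_nat n / z) \<noteq> 0"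
    using z n by (simp add: Im_divide complex_neq_0 z0)
  then have "0 < \<bar>c 0\<bar> * \<bar>Im (of_nat n / z)\<bar> ^ n" using c_0 by simp
  then have "poly (map_poly complex_of_real (appell n)) (of_nat n / z) \<noteq> 0"
    using appell_bound[of "of_nat n / z" n] by auto
  ultimately show ?thesis using z0 n by simp
qed

text \<open>For each i the Jensen weights tend to 1 while staying between 0 and 1, so Tannery's
  theorem gives locally uniform convergence to \<open>f\<close>. Hurwitz's theorem is applied on the
  open half-plane, upper or lower, that contains \<open>w\<close>.\<close>

lemma real_zeros:
  assumes f: "f holomorphic_on UNIV" and sums: "\<And>z. (\<lambda>k. of_real (c k) * z ^ k) sums f z" and w: "f w = 0"
  shows "Im w = 0"
proof (rule ccontr)
  assume w': "Im w \<noteq> 0"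
  define S where "S = {z. sgn (Im w) * Im z > 0}"
  have S: "open S" "convex S"
  proof -
    have "S = {z. inner (of_real (sgn (Im w)) * \<i>) z > 0}" by (simp add: S_def inner_complex_def)
    then show "open S" "convex S" by (simp_all add: open_halfspace_gt convex_halfspace_gt)
  qed
  have wS: "w \<in> S" using w' by (simp add: S_def sgn_real_def)
  have "f 0 = of_real (c 0)"
    using sums_unique2[OF sums[of 0] powser_sums_zero[of "\<lambda>k. of_real (c k)"]] .
  then have f0: "f 0 \<noteq> 0" using c_0 by simp
  have "f w \<noteq> 0"
  proof (rule Hurwitz_no_zeros[of S "\<lambda>n. jensen (Suc n)" f])
    show "jensen (Suc n) holomorphic_on S" for n
    proof -
      have "jensen (Suc n) = (\<lambda>z. \<Sum>i\<le>Suc n. of_real (c i * (\<Prod>j<i. 1 - real j / real (Suc n))) * z ^ i)"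
        by (rule ext) (rule jensen_eq_sum, simp)
      then show ?thesis by (simp only:) (intro holomorphic_intros)
    qed
    show "f holomorphic_on S" using f by (rule holomorphic_on_subset) auto
    \<comment> \<open>Constancy would make \<open>f\<close> vanish on the half-plane and hence also
      at 0, where its value is \<open>c 0\<close>.\<close>
    show "\<not> f constant_on S"
    proof
      assume "f constant_on S"
      then have "f z = 0" if "z \<in> S" for z using w wS that by (auto simp: constant_on_def)
      then have "f 0 = 0"
        by (intro analytic_continuation_open[of S UNIV f "\<lambda>_. 0" 0])
           (use S wS f in \<open>auto intro!: holomorphic_intros\<close>)
      then show False using f0 by simp
    qed
    show "jensen (Suc n) z \<noteq> 0" if "z \<in> S" for n z
      using that by (intro jensen_nonzero) (auto simp: S_def)
    fix K assume K: "compact K" "K \<subseteq> S"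
    obtain r where r: "r > 0" "\<And>z. z \<in> K \<Longrightarrow> norm z \<le> r"
      using compact_imp_bounded[OF K(1)] unfolding bounded_pos by blast
    have summ: "summable (\<lambda>i. \<bar>c i\<bar> * r ^ i)"
      using powser_insidea[of "\<lambda>i. of_real (c i) :: complex" "of_real (r + 1)" "of_real r"] sums[of "of_real (r + 1)"] r
      by (simp add: sums_iff norm_mult norm_power)
    define W where "W i n = (\<Prod>j<i. 1 - real j / real (Suc n))" for i n
    have W: "0 \<le> W i n" "W i n \<le> 1" for i n using jensen_weight_bounds[of "Suc n" i] by (simp_all add: W_def)
    have "(\<lambda>n. \<Sum>i. \<bar>c i\<bar> * r ^ i * (1 - W i n)) \<longlonglongrightarrow> (\<Sum>i. 0)"
    proof (rule tannerys_theorem[THEN conjunct2, THEN conjunct2])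
      show "(\<lambda>n. \<bar>c i\<bar> * r ^ i * (1 - W i n)) \<longlonglongrightarrow> 0" for i
      proof -
        have "(\<lambda>n. real j / real (Suc n)) \<longlonglongrightarrow> 0" for j by real_asymp
        then have "(\<lambda>n. \<bar>c i\<bar> * r ^ i * (1 - W i n)) \<longlonglongrightarrow> \<bar>c i\<bar> * r ^ i * (1 - (\<Prod>j<i. 1 - 0))"
          unfolding W_def by (intro tendsto_intros)
        then show ?thesis by simp
      qed
      show "\<forall>\<^sub>F (k, n) in at_top \<times>\<^sub>F sequentially. norm (\<bar>c k\<bar> * r ^ k * (1 - W k n)) \<le> \<bar>c k\<bar> * r ^ k"
      proof (rule always_eventually, clarify)
        fix k n
        have "\<bar>1 - W k n\<bar> \<le> 1" using W[of k n] by simp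
        then show "norm (\<bar>c k\<bar> * r ^ k * (1 - W k n)) \<le> \<bar>c k\<bar> * r ^ k"
          using r by (simp add: abs_mult mult_left_le)
      qed
    qed (use summ in auto)
    then have lim: "(\<lambda>n. \<Sum>i. \<bar>c i\<bar> * r ^ i * (1 - W i n)) \<longlonglongrightarrow> 0" by simp
    have bound: "dist (jensen (Suc n) z) (f z) \<le> (\<Sum>i. \<bar>c i\<bar> * r ^ i * (1 - W i n))" if z: "z \<in> K" for n z
    proof -
      have le: "norm (of_real (c i * W i n) * z ^ i - of_real (c i) * z ^ i) \<le> \<bar>c i\<bar> * r ^ i * (1 - W i n)" for i
      proof -
        have "of_real (c i * W i n) * z ^ i - of_real (c i) * z ^ i = - (of_real (c i * (1 - W i n)) * z ^ i)"
          by (simp add: algebra_simps)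
        then have "norm (of_real (c i * W i n) * z ^ i - of_real (c i) * z ^ i) = \<bar>c i\<bar> * (1 - W i n) * norm z ^ i"
          using W[of i n] by (simp only: norm_minus_cancel norm_mult norm_power norm_of_real abs_mult)
        also have "\<dots> \<le> \<bar>c i\<bar> * (1 - W i n) * r ^ i"
          using W[of i n] r(2)[OF z] by (intro mult_left_mono power_mono) auto
        finally show ?thesis by (simp add: mult_ac)
      qed
      have s1: "summable (\<lambda>i. \<bar>c i\<bar> * r ^ i * (1 - W i n))"
        by (rule summable_comparison_test'[OF summ, of 0]) (use W r in \<open>auto simp: abs_mult mult_left_le\<close>)
      have s2: "summable (\<lambda>i. norm (of_real (c i * W i n) * z ^ i - of_real (c i) * z ^ i))"
        by (rule summable_comparison_test'[OF s1, of 0]) (use le in auto)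
      have "(\<lambda>i. (of_real (c i * W i n) * z ^ i - of_real (c i) * z ^ i) + of_real (c i) * z ^ i) sums
          ((\<Sum>i. of_real (c i * W i n) * z ^ i - of_real (c i) * z ^ i) + f z)"
        by (intro sums_add summable_sums summable_norm_cancel[OF s2] sums)
      then have "jensen (Suc n) z - f z = (\<Sum>i. of_real (c i * W i n) * z ^ i - of_real (c i) * z ^ i)"
        by (simp add: jensen_def sums_iff W_def)
      also have "norm \<dots> \<le> (\<Sum>i. \<bar>c i\<bar> * r ^ i * (1 - W i n))"
        by (rule norm_suminf_le[OF le s1])
      finally show ?thesis by (simp add: dist_norm)
    qed
    show "uniform_limit K (\<lambda>n. jensen (Suc n)) f sequentially"
    proof (rule uniform_limitI)
      fix e :: real assume "e > 0"
      then have "\<forall>\<^sub>F n in sequentially. (\<Sum>i. \<bar>c i\<bar> * r ^ i * (1 - W i n)) < e"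
        using order_tendstoD(2)[OF lim] by simp
      then show "\<forall>\<^sub>F n in sequentially. \<forall>z\<in>K. dist (jensen (Suc n) z) (f z) < e"
        by eventually_elim (use bound in \<open>auto intro: le_less_trans\<close>)
    qed
  qed (use S wS convex_connected in auto)
  then show False using w by simp
qed

end

lemma sum_power_fact_le_exp:
  fixes y :: real
  assumes "y \<ge> 0" "finite A"
  shows "(\<Sum>k\<in>A. y ^ k / fact k) \<le> exp y"
proof -
  have "(\<Sum>k\<in>A. y ^ k / fact k) \<le> (\<Sum>k. y ^ k / fact k)"
    using summable_exp[of y] assms by (intro sum_le_suminf) (auto simp: field_simps)
  then show ?thesis by (simp add: exp_def field_simps)
qed

text \<open>Because \<alpha> < 0 the kernel has an exponential moment, hence all moments, and its
  transform is a power series near 0. There it is compared with the Taylor series of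
  \<open>f\<close>: the two are inverse as formal power series.\<close>

lemma laplace_reciprocal_real_zeros:
  fixes f :: "complex \<Rightarrow> complex" and L :: "real \<Rightarrow> real"
  assumes f: "f holomorphic_on UNIV" and L: "tp_kernel L" "\<And>x. x < 0 \<Longrightarrow> L x = 0" and \<alpha>: "\<alpha> < 0"
    and nz: "\<And>s. Re s > \<alpha> \<Longrightarrow> f s \<noteq> 0"
    and int: "\<And>s. Re s > \<alpha> \<Longrightarrow> integrable lebesgue (\<lambda>x. complex_of_real (L x) * exp (- s * complex_of_real x))"
    and lap: "\<And>s. Re s > \<alpha> \<Longrightarrow> 1 / f s = (\<integral>x. complex_of_real (L x) * exp (- s * complex_of_real x) \<partial>lebesgue)"
    and w: "f w = 0"
  shows "Im w = 0"
proof -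
  \<comment> \<open>Any number strictly between 0 and \<open>- \<alpha>\<close> would serve.\<close>
  define \<beta> where "\<beta> = - \<alpha> / 2"
  have \<beta>: "\<beta> > 0" "- \<beta> > \<alpha>" using \<alpha> by (auto simp: \<beta>_def)
  have L_nonneg: "L x \<ge> 0" for x by (rule tp_kernel_nonneg[OF L(1)])
  have "integrable lebesgue (\<lambda>x. norm (complex_of_real (L x) * exp (- of_real (- \<beta>) * complex_of_real x)))"
    by (intro integrable_norm int) (use \<beta> in auto)
  then have int\<beta>: "integrable lebesgue (\<lambda>x. L x * exp (\<beta> * x))"
    using L_nonneg by (simp add: norm_mult)
  have "integrable lebesgue (\<lambda>x. norm (complex_of_real (L x) * exp (- 0 * complex_of_real x)))"
    by (intro integrable_norm int) (use \<alpha> in auto)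
  then have "integrable lebesgue L" using L_nonneg by (simp add: norm_mult)
  then have Lm [measurable]: "L \<in> borel_measurable lebesgue" by (rule borel_measurable_integrable)
  have pm [measurable]: "(\<lambda>x :: real. x ^ k) \<in> borel_measurable lebesgue" for k
    by (rule measurable_completion) measurable
  have moment: "integrable lebesgue (\<lambda>x. L x * x ^ k)" for k
  proof (rule Bochner_Integration.integrable_bound)
    show "integrable lebesgue (\<lambda>x. fact k / \<beta> ^ k * (L x * exp (\<beta> * x)))"
      by (intro integrable_mult_right int\<beta>)
    show "(\<lambda>x. L x * x ^ k) \<in> borel_measurable lebesgue" by measurable
    have "norm (L x * x ^ k) \<le> norm (fact k / \<beta> ^ k * (L x * exp (\<beta> * x)))" for x
    proof (cases "x \<ge> 0")
      case True
      have "(\<beta> * x) ^ k / fact k \<le> exp (\<beta> * x)"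
        using sum_power_fact_le_exp[of "\<beta> * x" "{k}"] True \<beta> by simp
      then have "x ^ k \<le> fact k / \<beta> ^ k * exp (\<beta> * x)" using \<beta> by (simp add: power_mult_distrib field_simps)
      then have "L x * x ^ k \<le> L x * (fact k / \<beta> ^ k * exp (\<beta> * x))" by (rule mult_left_mono) (rule L_nonneg)
      then show ?thesis using True \<beta> L_nonneg[of x] by (simp add: abs_mult mult_ac)
    qed (simp add: L)
    then show "AE x in lebesgue. norm (L x * x ^ k) \<le> norm (fact k / \<beta> ^ k * (L x * exp (\<beta> * x)))" by simp
  qed
  define m where "m k = (-1) ^ k * (\<integral>x. L x * x ^ k \<partial>lebesgue) / fact k" for k
  \<comment> \<open>The partial sums of the exponential series are dominated by
    \<open>L x * exp (\<beta> * x)\<close>, so the transform may be integrated term by term.\<close>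
  have msums: "(\<lambda>k. of_real (m k) * s ^ k) sums (1 / f s)" if s: "norm s \<le> \<beta>" for s
  proof -
    have Re: "Re s > \<alpha>" using abs_Re_le_cmod[of s] s \<beta> by linarith
    have "(\<lambda>n. \<integral>x. (\<Sum>k<n. of_real (L x) * ((- s * of_real x) ^ k / fact k)) \<partial>lebesgue) \<longlonglongrightarrow>
        (\<integral>x. of_real (L x) * exp (- s * of_real x) \<partial>lebesgue)"
    proof (rule integral_dominated_convergence[OF _ _ int\<beta>])
      show "(\<lambda>x. of_real (L x) * exp (- s * of_real x)) \<in> borel_measurable lebesgue"
        using int[OF Re] by (rule borel_measurable_integrable)
      show "(\<lambda>x. \<Sum>k<n. of_real (L x) * ((- s * of_real x) ^ k / fact k)) \<in> borel_measurable lebesgue" for n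
      proof -
        have "(\<lambda>x. (- s * of_real x) ^ k / fact k) \<in> borel_measurable lebesgue" for k
          by (rule measurable_completion) measurable
        then show ?thesis by measurable
      qed
      show "AE x in lebesgue. (\<lambda>n. \<Sum>k<n. of_real (L x) * ((- s * of_real x) ^ k / fact k)) \<longlonglongrightarrow>
          of_real (L x) * exp (- s * of_real x)"
      proof (rule AE_I2)
        fix x
        have "(\<lambda>k. (- s * of_real x) ^ k / fact k) sums exp (- s * of_real x)"
          using exp_converges[of "- s * of_real x"] by (simp add: scaleR_conv_of_real field_simps)
        then have "(\<lambda>k. of_real (L x) * ((- s * of_real x) ^ k / fact k)) sums (of_real (L x) * exp (- s * of_real x))"
          by (rule sums_mult)
        then show "(\<lambda>n. \<Sum>k<n. of_real (L x) * ((- s * of_real x) ^ k / fact k)) \<longlonglongrightarrow>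
          of_real (L x) * exp (- s * of_real x)" by (simp add: sums_def)
      qed
      fix n
      have "norm (\<Sum>k<n. of_real (L x) * ((- s * of_real x) ^ k / fact k)) \<le> L x * exp (\<beta> * x)" for x
      proof (cases "x \<ge> 0")
        case True
        have "norm (\<Sum>k<n. of_real (L x) * ((- s * of_real x) ^ k / fact k)) \<le>
            (\<Sum>k<n. L x * ((\<beta> * x) ^ k / fact k))"
        proof (rule sum_norm_le)
          fix k
          have "norm (of_real (L x) * ((- s * of_real x) ^ k / fact k)) = L x * ((norm s * x) ^ k / fact k)"
            using True L_nonneg[of x] by (simp add: norm_mult norm_divide norm_power)
          also have "\<dots> \<le> L x * ((\<beta> * x) ^ k / fact k)"
            using True s L_nonneg[of x] by (intro mult_left_mono divide_right_mono power_mono mult_right_mono) auto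
          finally show "norm (of_real (L x) * ((- s * of_real x) ^ k / fact k)) \<le> L x * ((\<beta> * x) ^ k / fact k)" .
        qed
        also have "\<dots> = L x * (\<Sum>k<n. (\<beta> * x) ^ k / fact k)" by (simp add: sum_distrib_left)
        also have "(\<Sum>k<n. (\<beta> * x) ^ k / fact k) \<le> exp (\<beta> * x)"
          using True \<beta> by (intro sum_power_fact_le_exp) auto
        then have "L x * (\<Sum>k<n. (\<beta> * x) ^ k / fact k) \<le> L x * exp (\<beta> * x)"
          by (rule mult_left_mono) (rule L_nonneg)
        finally show ?thesis .
      qed (simp add: L)
      then show "AE x in lebesgue. norm (\<Sum>k<n. of_real (L x) * ((- s * of_real x) ^ k / fact k)) \<le> L x * exp (\<beta> * x)"
        by simp
    qed
    moreover have "(\<integral>x. (\<Sum>k<n. of_real (L x) * ((- s * of_real x) ^ k / fact k)) \<partial>lebesgue) = (\<Sum>k<n. of_real (m k) * s ^ k)" for n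
    proof -
      have eq: "of_real (L x) * ((- s * of_real x) ^ k / fact k) = ((- s) ^ k / fact k) * complex_of_real (L x * x ^ k)" for x k
        unfolding power_mult_distrib[of "- s"] by simp
      have i: "integrable lebesgue (\<lambda>x. complex_of_real (L x * x ^ k))" for k
        by (intro integrable_of_real moment)
      have "(\<integral>x. (\<Sum>k<n. of_real (L x) * ((- s * of_real x) ^ k / fact k)) \<partial>lebesgue) =
          (\<Sum>k<n. \<integral>x. ((- s) ^ k / fact k) * complex_of_real (L x * x ^ k) \<partial>lebesgue)"
        unfolding eq by (rule Bochner_Integration.integral_sum) (intro integrable_mult_right i)
      also have "\<dots> = (\<Sum>k<n. ((- s) ^ k / fact k) * of_real (\<integral>x. L x * x ^ k \<partial>lebesgue))"
        by (simp only: integral_mult_right_zero integral_complex_of_real)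
      also have "\<dots> = (\<Sum>k<n. of_real (m k) * s ^ k)"
        by (intro sum.cong) (auto simp: m_def power_minus[of s])
      finally show ?thesis .
    qed
    ultimately show ?thesis using lap[OF Re] by (simp add: sums_def)
  qed
  define cc where "cc k = (deriv ^^ k) f 0 / fact k" for k
  have fsums: "(\<lambda>k. cc k * z ^ k) sums f z" for z
    using holomorphic_power_series[of f 0 "norm z + 1" z] holomorphic_on_subset[OF f]
    by (simp add: cc_def)
  define M where "M = Abs_fps (\<lambda>k. complex_of_real (m k))"
  have rM: "ereal \<beta> \<le> fps_conv_radius M"
    using conv_radius_geI[of "\<lambda>k. complex_of_real (m k)" "of_real \<beta>"] msums[of "of_real \<beta>"] \<beta>
    by (simp add: fps_conv_radius_def M_def sums_iff)
  have rC: "ereal \<beta> \<le> fps_conv_radius (Abs_fps cc)"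
    using conv_radius_geI[of cc "of_real \<beta>"] fsums[of "of_real \<beta>"] \<beta>
    by (simp add: fps_conv_radius_def sums_iff)
  have "Abs_fps cc * M = 1"
  proof (rule eval_fps_eqD)
    have pos: "0 < ereal \<beta>" using \<beta> by (simp add: zero_ereal_def)
    show "0 < fps_conv_radius (Abs_fps cc * M)"
      using rM rC by (intro less_le_trans[OF pos order.trans[OF _ fps_conv_radius_mult]]) simp
    have "\<forall>\<^sub>F z in nhds 0. z \<in> ball 0 \<beta>" using \<beta> by (intro eventually_nhds_in_open) auto
    then show "\<forall>\<^sub>F z in nhds 0. eval_fps (Abs_fps cc * M) z = eval_fps 1 z"
    proof eventually_elim
      case (elim z)
      then have z: "ereal (norm z) < ereal \<beta>" "norm z \<le> \<beta>" by auto
      have "eval_fps (Abs_fps cc * M) z = eval_fps (Abs_fps cc) z * eval_fps M z"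
        by (rule eval_fps_mult) (rule less_le_trans[OF z(1) rC] less_le_trans[OF z(1) rM])+
      also have "\<dots> = f z * (1 / f z)"
        using fsums[of z] msums[OF z(2)] by (simp add: eval_fps_def M_def sums_iff)
      also have "\<dots> = 1"
        using nz[of z] abs_Re_le_cmod[of z] z(2) \<beta> by fastforce
      finally show ?case by simp
    qed
  qed simp
  \<comment> \<open>The real series \<open>m\<close> has a real inverse; uniqueness of inverses
    identifies it with the Taylor series of \<open>f\<close>, whose coefficients are thereby
    real.\<close>
  define c where "c k = fps_nth (inverse (Abs_fps m)) k" for k
  have "of_real (m 0) * cc 0 = 1"
  proof -
    have "fps_nth (Abs_fps cc * M) 0 = 1" unfolding \<open>Abs_fps cc * M = 1\<close> by simp
    then show ?thesis by (simp add: fps_mult_nth M_def mult.commute)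
  qed
  then have "m 0 \<noteq> 0" by auto
  have "Abs_fps c = inverse (Abs_fps m)" by (rule fps_ext) (simp add: c_def)
  then have inv: "Abs_fps c * Abs_fps m = 1"
    using inverse_mult_eq_1[of "Abs_fps m"] \<open>m 0 \<noteq> 0\<close> by simp
  interpret reciprocal_moments L c
    using L(1) moment inv by unfold_locales (simp_all add: m_def[abs_def])
  have "Abs_fps (\<lambda>k. complex_of_real (c k)) * M = 1"
  proof (rule fps_ext)
    fix n
    have "fps_nth (Abs_fps (\<lambda>k. complex_of_real (c k)) * M) n = of_real (fps_nth (Abs_fps c * Abs_fps m) n)"
      by (simp add: fps_mult_nth M_def)
    then show "fps_nth (Abs_fps (\<lambda>k. complex_of_real (c k)) * M) n = fps_nth 1 n"
      unfolding inv by simp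
  qed
  then have "Abs_fps cc = Abs_fps (\<lambda>k. complex_of_real (c k))"
    using \<open>Abs_fps cc * M = 1\<close> by (metis mult.commute mult.left_commute mult_1_right)
  then have "cc = (\<lambda>k. complex_of_real (c k))" by (simp add: fps_eq_iff fun_eq_iff)
  then show ?thesis using real_zeros[OF f _ w] fsums by simp
qed

section \<open>Analytic continuation of the zeta function\<close>

lemma not_nonpos_Reals_of_real: "x > 0 \<Longrightarrow> complex_of_real x \<notin> \<real>\<^sub>\<le>\<^sub>0"
  by (simp add: complex_nonpos_Reals_iff)

text \<open>The coefficient of b^(1 - s - j) in the expansion of (b - 1)^(1 - s), that is, (-1)^j
  times a generalized binomial coefficient.\<close>

definition taylor_coeff :: "nat \<Rightarrow> complex \<Rightarrow> complex" where
  "taylor_coeff j s = (-1) ^ j / fact j * (\<Prod>i<j. 1 - s - of_nat i)"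

lemma taylor_coeff_0 [simp]: "taylor_coeff 0 s = 1"
  by (simp add: taylor_coeff_def)

definition taylor_rem :: "nat \<Rightarrow> nat \<Rightarrow> complex \<Rightarrow> complex" where
  "taylor_rem M k s = of_nat (Suc k) powr (1 - s) -
     (\<Sum>j\<le>M. taylor_coeff j s * of_nat (Suc (Suc k)) powr (1 - s - of_nat j))"

text \<open>The derivative in the Taylor remainder is of size x^(- Re s - M), largest at the left
  end of the segment. Each further Taylor term thus moves the half-plane of summability one unit to
  the left.\<close>

lemma taylor_rem_bound:
  assumes "Re s + real M \<ge> 0"
  shows "norm (taylor_rem M k s) \<le> (\<Prod>i\<le>M. norm (1 - s - of_nat i)) * real (Suc k) powr (- (Re s + real M))"
proof -
  define f where "f j x = (\<Prod>i<j. 1 - s - of_nat i) * x powr (1 - s - of_nat j)" for j and x :: complex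
  define a b where "a = complex_of_real (real (Suc k))" and "b = complex_of_real (real (Suc (Suc k)))"
  let ?S = "closed_segment a b"
  have S: "\<exists>t. x = of_real t \<and> real (Suc k) \<le> t" if "x \<in> ?S" for x
  proof -
    have "x \<in> of_real ` closed_segment (real (Suc k)) (real (Suc (Suc k)))"
      using that by (simp only: a_def b_def closed_segment_of_real)
    then show ?thesis by (auto simp: closed_segment_eq_real_ivl)
  qed
  define B where "B = (\<Prod>i\<le>M. norm (1 - s - of_nat i)) * real (Suc k) powr (- (Re s + real M))"
  have "norm (f 0 a - (\<Sum>j\<le>M. f j b * (a - b) ^ j / fact j)) \<le> B * norm (a - b) ^ Suc M / fact M"
  proof (rule complex_Taylor[of ?S])
    fix j x assume "x \<in> ?S"
    then obtain t where t: "x = of_real t" "real (Suc k) \<le> t" using S by blast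
    then have "x \<notin> \<real>\<^sub>\<le>\<^sub>0" by (simp add: not_nonpos_Reals_of_real)
    then have "((\<lambda>x. x powr (1 - s - of_nat j)) has_field_derivative
        (1 - s - of_nat j) * x powr (1 - s - of_nat j - 1)) (at x within ?S)"
      by (rule has_field_derivative_at_within[OF has_field_derivative_powr])
    from DERIV_cmult[OF this, of "\<Prod>i<j. 1 - s - of_nat i"]
    show "(f j has_field_derivative f (Suc j) x) (at x within ?S)"
      by (simp add: f_def[abs_def] mult_ac diff_diff_eq add.commute)
  next
    fix x assume "x \<in> ?S"
    then obtain t where t: "x = of_real t" "real (Suc k) \<le> t" using S by blast
    then have "norm (x powr (1 - s - of_nat (Suc M))) = t powr (- (Re s + real M))"
      by (subst norm_powr_real_powr) auto
    also have "\<dots> \<le> real (Suc k) powr (- (Re s + real M))"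
      using t assms by (intro powr_mono2') auto
    finally show "norm (f (Suc M) x) \<le> B"
      by (simp add: f_def B_def norm_mult prod_norm lessThan_Suc_atMost mult_left_mono prod_nonneg del: prod.lessThan_Suc)
  qed auto
  moreover have ab: "a - b = -1" by (simp add: a_def b_def)
  moreover have "f 0 a - (\<Sum>j\<le>M. f j b * (a - b) ^ j / fact j) = taylor_rem M k s"
    unfolding ab taylor_rem_def f_def taylor_coeff_def
    by (simp add: a_def b_def mult_ac)
  moreover have "B / fact M \<le> B"
  proof -
    have "B \<ge> 0" unfolding B_def by (intro mult_nonneg_nonneg prod_nonneg) auto
    then have "B * 1 \<le> B * fact M" by (rule mult_left_mono[rotated]) (rule fact_ge_1)
    then show ?thesis by (simp add: divide_le_eq)
  qed
  ultimately show ?thesis by (simp add: B_def)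
qed

lemma summable_powr: "c > 1 \<Longrightarrow> summable (\<lambda>k. real (Suc k) powr (- c))"
  using summable_real_powr_iff[of "- c"] by (subst (asm) summable_Suc_iff[symmetric]) simp

lemma taylor_rem_holomorphic: "taylor_rem M k holomorphic_on A"
  unfolding taylor_rem_def[abs_def] taylor_coeff_def by (intro holomorphic_intros) auto

lemma summable_taylor_rem:
  assumes "Re s + real M > 1"
  shows "summable (\<lambda>k. taylor_rem M k s)"
proof (rule summable_comparison_test')
  show "summable (\<lambda>k. (\<Prod>i\<le>M. norm (1 - s - of_nat i)) * real (Suc k) powr (- (Re s + real M)))"
    using assms by (intro summable_mult summable_powr)
  show "norm (taylor_rem M k s) \<le> (\<Prod>i\<le>M. norm (1 - s - of_nat i)) * real (Suc k) powr (- (Re s + real M))" for k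
    using assms by (intro taylor_rem_bound) auto
qed

lemma suminf_taylor_rem_holomorphic:
  "(\<lambda>s. \<Sum>k. taylor_rem M k s) holomorphic_on {s. Re s > 1 - real M}"
proof (rule holomorphic_uniform_sequence)
  show "open {s. Re s > 1 - real M}" by (rule open_halfspace_Re_gt)
  show "(\<lambda>s. \<Sum>k<n. taylor_rem M k s) holomorphic_on {s. Re s > 1 - real M}" for n
    by (intro holomorphic_intros taylor_rem_holomorphic)
  fix z :: complex assume z: "z \<in> {s. Re s > 1 - real M}"
  define d where "d = (Re z - (1 - real M)) / 2"
  have d: "d > 0" using z by (simp add: d_def)
  have Re: "Re s \<ge> 1 - real M + d" if "s \<in> cball z d" for s
    using that abs_Re_le_cmod[of "z - s"] by (simp add: d_def dist_norm abs_le_iff field_simps)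
  have "uniform_limit (cball z d) (\<lambda>n s. \<Sum>k<n. taylor_rem M k s) (\<lambda>s. \<Sum>k. taylor_rem M k s) sequentially"
  proof (rule Weierstrass_m_test)
    show "summable (\<lambda>k. (\<Prod>i\<le>M. 1 + norm z + d + real i) * real (Suc k) powr (- (1 + d)))"
      using d by (intro summable_mult summable_powr) auto
    fix k s assume s: "s \<in> cball z d"
    have "norm (1 - s - of_nat i) \<le> 1 + norm z + d + real i" for i
    proof -
      have "norm (1 - s - of_nat i) \<le> norm (1 - s) + norm (of_nat i :: complex)" by (rule norm_triangle_ineq4)
      also have "norm (1 - s) \<le> 1 + norm s" using norm_triangle_ineq4[of 1 s] by simp
      also have "norm s \<le> norm z + d"
        using s norm_triangle_ineq2[of s z] by (simp add: dist_norm norm_minus_commute)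
      finally show ?thesis by simp
    qed
    then have "(\<Prod>i\<le>M. norm (1 - s - of_nat i)) \<le> (\<Prod>i\<le>M. 1 + norm z + d + real i)"
      by (intro prod_mono) auto
    moreover have "real (Suc k) powr (- (Re s + real M)) \<le> real (Suc k) powr (- (1 + d))"
      using Re[OF s] by (intro powr_mono) auto
    ultimately have "(\<Prod>i\<le>M. norm (1 - s - of_nat i)) * real (Suc k) powr (- (Re s + real M)) \<le>
        (\<Prod>i\<le>M. 1 + norm z + d + real i) * real (Suc k) powr (- (1 + d))"
      using d by (intro mult_mono) (auto intro!: prod_nonneg)
    then show "norm (taylor_rem M k s) \<le> (\<Prod>i\<le>M. 1 + norm z + d + real i) * real (Suc k) powr (- (1 + d))"
      using taylor_rem_bound[of s M k] Re[OF s] d by simp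
  qed
  then show "\<exists>d>0. cball z d \<subseteq> {s. Re s > 1 - real M} \<and>
      uniform_limit (cball z d) (\<lambda>n s. \<Sum>k<n. taylor_rem M k s) (\<lambda>s. \<Sum>k. taylor_rem M k s) sequentially"
    using d Re by (intro exI[of _ d]) (auto simp: less_le_trans[OF less_add_same_cancel1[THEN iffD2]])
qed

text \<open>This is \<open>\<zeta>(s) - 1\<close> for \<open>Re s > 1\<close>.\<close>
definition zeta_tail :: "complex \<Rightarrow> complex" where
  "zeta_tail s = (\<Sum>k. of_nat (Suc (Suc k)) powr (- s))"

lemma zeta_tail_sums:
  assumes "Re s > 1"
  shows "(\<lambda>k. of_nat (Suc (Suc k)) powr (- s)) sums zeta_tail s"
  unfolding zeta_tail_def
proof (rule summable_sums, rule summable_comparison_test')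
  show "summable (\<lambda>k. real (Suc (Suc k)) powr (- Re s))"
    using summable_powr[OF assms] by (subst (asm) summable_Suc_iff[symmetric])
  show "norm (of_nat (Suc (Suc k)) powr (- s)) \<le> real (Suc (Suc k)) powr (- Re s)" for k
    by (subst norm_powr_real_powr) auto
qed

lemma zeta_tail_plus_1_sums:
  assumes "Re s > 1"
  shows "(\<lambda>n. 1 / of_nat (Suc n) powr s) sums (zeta_tail s + 1)"
proof -
  have "(\<lambda>n. 1 / of_nat (Suc (Suc n)) powr s) sums zeta_tail s"
    using zeta_tail_sums[OF assms] by (simp add: powr_minus divide_inverse)
  then show ?thesis
    using sums_Suc_iff[of "\<lambda>n. 1 / of_nat (Suc n) powr s" "zeta_tail s"] by simp
qed

lemma suminf_taylor_rem:
  assumes s: "Re s > 1"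
  shows "(\<Sum>k. taylor_rem M k s) = 1 - (\<Sum>j=1..M. taylor_coeff j s * zeta_tail (s + of_nat j - 1))"
proof -
  have tele: "(\<lambda>k. of_nat (Suc k) powr (1 - s) - of_nat (Suc (Suc k)) powr (1 - s)) sums
      (of_nat (Suc 0) powr (1 - s) - 0)"
  proof (rule telescope_sums')
    have "(\<lambda>k. real (Suc k) powr (1 - Re s)) \<longlonglongrightarrow> 0" using s by real_asymp
    moreover have "norm (of_nat (Suc k) powr (1 - s)) = real (Suc k) powr (1 - Re s)" for k
      by (subst norm_powr_real_powr) auto
    ultimately have "(\<lambda>k. norm (of_nat (Suc k) powr (1 - s))) \<longlonglongrightarrow> 0" by simp
    then show "(\<lambda>k. of_nat (Suc k) powr (1 - s)) \<longlonglongrightarrow> 0" by (rule tendsto_norm_zero_cancel)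
  qed
  have "(\<lambda>k. taylor_coeff j s * of_nat (Suc (Suc k)) powr (- (s + of_nat j - 1))) sums
      (taylor_coeff j s * zeta_tail (s + of_nat j - 1))" if "j \<in> {1..M}" for j
    by (intro sums_mult zeta_tail_sums) (use s that in auto)
  then have "(\<lambda>k. \<Sum>j=1..M. taylor_coeff j s * of_nat (Suc (Suc k)) powr (- (s + of_nat j - 1))) sums
      (\<Sum>j=1..M. taylor_coeff j s * zeta_tail (s + of_nat j - 1))"
    by (intro sums_sum)
  note S = sums_diff[OF tele this]
  have tr: "of_nat (Suc k) powr (1 - s) - of_nat (Suc (Suc k)) powr (1 - s) -
      (\<Sum>j=1..M. taylor_coeff j s * of_nat (Suc (Suc k)) powr (- (s + of_nat j - 1))) = taylor_rem M k s" for k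
  proof -
    have "(\<Sum>j\<le>M. taylor_coeff j s * of_nat (Suc (Suc k)) powr (1 - s - of_nat j)) =
        of_nat (Suc (Suc k)) powr (1 - s) + (\<Sum>j=1..M. taylor_coeff j s * of_nat (Suc (Suc k)) powr (1 - s - of_nat j))"
      by (simp add: sum.atMost_shift sum.atLeast1_atMost_eq)
    then show ?thesis by (simp add: taylor_rem_def algebra_simps)
  qed
  have "(\<lambda>k. taylor_rem M k s) sums (1 - (\<Sum>j=1..M. taylor_coeff j s * zeta_tail (s + of_nat j - 1)))"
    using S unfolding tr by simp
  then show ?thesis by (simp add: sums_iff)
qed

text \<open>\<open>taylor_coeff\<close> with the factor s' - 1 split off, where s' = s + j - 1. That
  factor is kept with \<open>zeta_tail\<close> at s' to cancel its pole, so that the recurrence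
  relates pole-free functions.\<close>

definition shift_coeff :: "nat \<Rightarrow> complex \<Rightarrow> complex" where
  "shift_coeff j s = - ((-1) ^ j) / fact j * (\<Prod>i<j - 1. 1 - s - of_nat i)"

lemma taylor_coeff_shift: "j \<ge> 1 \<Longrightarrow> taylor_coeff j s = shift_coeff j s * (s + of_nat j - 1 - 1)"
proof (cases j)
  case (Suc n)
  have *: "a / b * (P * x) = - a / b * P * (- x)" for a b P x :: complex by simp
  have e: "s + of_nat (Suc n) - 1 - 1 = - (1 - s - of_nat n)" by simp
  show ?thesis
    unfolding Suc taylor_coeff_def shift_coeff_def e diff_Suc_1 prod.lessThan_Suc by (rule *)
qed simp

text \<open>Expanding \<open>n\<^bsup>1-s\<^esup>\<close> about \<open>n + 1\<close> and summing expresses \<open>(s - 1) (\<zeta>(s) - 1)\<close> through its values at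
  \<open>s + 1, s + 2, \<dots>\<close> and a remainder that converges further to the left.\<close>
lemma zeta_tail_recurrence:
  assumes "Re s > 1" "M \<ge> 1"
  shows "(s - 1) * zeta_tail s = 1 - (\<Sum>j=2..M. shift_coeff j s * ((s + of_nat j - 1 - 1) * zeta_tail (s + of_nat j - 1)))
    - (\<Sum>k. taylor_rem M k s)"
proof -
  have "(\<Sum>j=1..M. taylor_coeff j s * zeta_tail (s + of_nat j - 1)) =
      taylor_coeff 1 s * zeta_tail s + (\<Sum>j=2..M. taylor_coeff j s * zeta_tail (s + of_nat j - 1))"
    using assms(2) by (subst sum.atLeast_Suc_atMost) (simp_all add: numeral_2_eq_2)
  also have "(\<Sum>j=2..M. taylor_coeff j s * zeta_tail (s + of_nat j - 1)) =
      (\<Sum>j=2..M. shift_coeff j s * ((s + of_nat j - 1 - 1) * zeta_tail (s + of_nat j - 1)))"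
    by (intro sum.cong) (simp_all add: taylor_coeff_shift)
  also have "taylor_coeff 1 s = s - 1" by (simp add: taylor_coeff_def)
  finally have E: "(\<Sum>j=1..M. taylor_coeff j s * zeta_tail (s + of_nat j - 1)) = (s - 1) * zeta_tail s +
      (\<Sum>j=2..M. shift_coeff j s * ((s + of_nat j - 1 - 1) * zeta_tail (s + of_nat j - 1)))" .
  have *: "x = 1 - S - (1 - (x + S))" for x S :: complex by simp
  show ?thesis unfolding suminf_taylor_rem[OF assms(1)] E by (rule *)
qed

text \<open>On the right of the recurrence only the arguments s + j - 1 with j \<ge> 2 occur, at
  least one unit further right, so each use of it extends the domain by a strip of width 1.\<close>

lemma zeta_tail_continuation_step:
  "\<exists>G. G holomorphic_on {s. Re s > 1 - real m} \<and> (\<forall>s. Re s > 1 \<longrightarrow> G s = (s - 1) * zeta_tail s)"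
proof (induction m)
  case 0
  define G where "G s = 1 - (\<Sum>k. taylor_rem 1 k s)" for s
  have "G holomorphic_on {s. Re s > 1 - real 1}"
    unfolding G_def by (intro holomorphic_intros suminf_taylor_rem_holomorphic)
  then have "G holomorphic_on {s. Re s > 1 - real 0}" by (rule holomorphic_on_subset) auto
  moreover have "G s = (s - 1) * zeta_tail s" if "Re s > 1" for s
    using zeta_tail_recurrence[OF that, of 1] by (simp add: G_def)
  ultimately show ?case by blast
next
  case (Suc m)
  then obtain G where G: "G holomorphic_on {s. Re s > 1 - real m}"
    "\<And>s. Re s > 1 \<Longrightarrow> G s = (s - 1) * zeta_tail s" by blast
  define H where "H s = 1 - (\<Sum>j=2..Suc m. shift_coeff j s * G (s + of_nat j - 1)) - (\<Sum>k. taylor_rem (Suc m) k s)" for s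
  have "(\<lambda>s. G (s + of_nat j - 1)) holomorphic_on {s. Re s > 1 - real (Suc m)}" if "j \<ge> 2" for j
    by (rule holomorphic_on_compose_gen[OF _ G(1), of "\<lambda>s. s + of_nat j - 1", unfolded o_def])
       (use that in \<open>auto intro!: holomorphic_intros\<close>)
  then have "H holomorphic_on {s. Re s > 1 - real (Suc m)}"
    unfolding H_def shift_coeff_def
    by (intro holomorphic_intros suminf_taylor_rem_holomorphic) auto
  moreover have "H s = (s - 1) * zeta_tail s" if "Re s > 1" for s
  proof -
    have "(\<Sum>j=2..Suc m. shift_coeff j s * G (s + of_nat j - 1)) =
        (\<Sum>j=2..Suc m. shift_coeff j s * ((s + of_nat j - 1 - 1) * zeta_tail (s + of_nat j - 1)))"
      using that by (intro sum.cong) (auto simp: G(2))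
    then show ?thesis using zeta_tail_recurrence[OF that, of "Suc m"] by (simp add: H_def)
  qed
  ultimately show ?case by blast
qed

lemma halfspace_Re_gt_agree:
  assumes "f holomorphic_on {s. Re s > c}" "g holomorphic_on {s. Re s > c}"
    and "\<And>s. Re s > 1 \<Longrightarrow> f s = g s" and "Re z > c"
  shows "f z = g z"
proof (rule analytic_continuation_open[of "{s. Re s > max 1 c}" "{s. Re s > c}" f g z])
  have "of_real (max 1 c + 1) \<in> {s. Re s > max 1 c}" by (simp add: max_def)
  then show "{s. Re s > max 1 c} \<noteq> {}" by blast
  show "connected {s. Re s > c}" by (intro convex_connected convex_halfspace_Re_gt)
  show "open {s. Re s > max 1 c}" "open {s. Re s > c}" by (rule open_halfspace_Re_gt)+
qed (use assms in auto)

lemma zeta_tail_continuation: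
  obtains G where "G holomorphic_on UNIV" "\<And>s. Re s > 1 \<Longrightarrow> G s = (s - 1) * zeta_tail s"
proof -
  have "\<forall>m. \<exists>G. G holomorphic_on {s. Re s > 1 - real m} \<and> (\<forall>s. Re s > 1 \<longrightarrow> G s = (s - 1) * zeta_tail s)"
    using zeta_tail_continuation_step by blast
  then obtain Gm where Gm: "\<And>m. Gm m holomorphic_on {s. Re s > 1 - real m}"
    "\<And>m s. Re s > 1 \<Longrightarrow> Gm m s = (s - 1) * zeta_tail s"
    by (auto dest!: choice)
  define N where "N s = nat \<lceil>2 - Re s\<rceil>" for s
  have N: "Re s > 1 - real (N s)" for s unfolding N_def by linarith
  define G where "G s = Gm (N s) s" for s
  have eq: "Gm m s = Gm n s" if "Re s > 1 - real m" "Re s > 1 - real n" for m n s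
  proof (rule halfspace_Re_gt_agree[of "Gm m" "max (1 - real m) (1 - real n)" "Gm n" s])
    show "Gm m holomorphic_on {s. Re s > max (1 - real m) (1 - real n)}"
      by (rule holomorphic_on_subset[OF Gm(1)]) auto
    show "Gm n holomorphic_on {s. Re s > max (1 - real m) (1 - real n)}"
      by (rule holomorphic_on_subset[OF Gm(1)]) auto
  qed (use that Gm(2) in auto)
  have "G holomorphic_on (\<Union>m. {s. Re s > 1 - real m})"
  proof (rule holomorphic_on_UN_open)
    fix m :: nat
    have "G s = Gm m s" if "s \<in> {s. Re s > 1 - real m}" for s
      unfolding G_def using that N by (intro eq) auto
    then show "G holomorphic_on {s. Re s > 1 - real m}"
      using Gm(1)[of m] holomorphic_cong by blast
  qed (rule open_halfspace_Re_gt)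
  moreover have "(\<Union>m. {s. Re s > 1 - real m}) = UNIV" using N by blast
  ultimately show thesis using Gm(2) by (intro that[of G]) (auto simp: G_def)
qed

text \<open>The definite description becomes usable: existence comes from the continuation just
  built, uniqueness from the identity theorem on the connected punctured plane together with the
  convention at 1.\<close>

lemma zeta_spec:
  "zeta holomorphic_on UNIV - {1} \<and> zeta 1 = 0 \<and>
    (\<forall>s. Re s > 1 \<longrightarrow> (\<lambda>n. 1 / of_nat (Suc n) powr s) sums zeta s)"
proof -
  obtain G where G: "G holomorphic_on UNIV" "\<And>s. Re s > 1 \<Longrightarrow> G s = (s - 1) * zeta_tail s"
    using zeta_tail_continuation by blast
  define f where "f s = (if s = 1 then 0 else 1 + G s / (s - 1))" for s
  have "(\<lambda>s. 1 + G s / (s - 1)) holomorphic_on UNIV - {1}"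
    by (intro holomorphic_intros holomorphic_on_subset[OF G(1)]) auto
  then have f1: "f holomorphic_on UNIV - {1}"
    by (rule holomorphic_transform) (auto simp: f_def)
  have f2: "(\<lambda>n. 1 / of_nat (Suc n) powr s) sums f s" if s: "Re s > 1" for s
  proof -
    have "s \<noteq> 1" using s by auto
    then have "f s = zeta_tail s + 1" using G(2)[OF s] by (simp add: f_def)
    then show ?thesis using zeta_tail_plus_1_sums[OF s] by simp
  qed
  have "\<exists>!f. f holomorphic_on UNIV - {1} \<and> f 1 = 0 \<and>
      (\<forall>s. Re s > 1 \<longrightarrow> (\<lambda>n. 1 / of_nat (Suc n) powr s) sums f s)"
  proof (rule ex1I[of _ f])
    show "f holomorphic_on UNIV - {1} \<and> f 1 = 0 \<and>
      (\<forall>s. Re s > 1 \<longrightarrow> (\<lambda>n. 1 / of_nat (Suc n) powr s) sums f s)"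
      using f1 f2 by (simp add: f_def)
    fix g assume g: "g holomorphic_on UNIV - {1} \<and> g 1 = 0 \<and>
      (\<forall>s. Re s > 1 \<longrightarrow> (\<lambda>n. 1 / of_nat (Suc n) powr s) sums g s)"
    show "g = f"
    proof
      fix s
      show "g s = f s"
      proof (cases "s = 1")
        case False
        show ?thesis
        proof (rule analytic_continuation_open[of "{s. Re s > 1}" "UNIV - {1}" g f s])
          have "(2 :: complex) \<in> {s. Re s > 1}" by simp
          then show "{s. Re s > (1 :: real)} \<noteq> {}" by blast
          show "connected (UNIV - {1 :: complex})"
            by (intro connected_open_delete) auto
          show "g z = f z" if "z \<in> {s. Re s > 1}" for z
            by (rule sums_unique2[of "\<lambda>n. 1 / of_nat (Suc n) powr z"]) (use g f2 that in auto)
        qed (use g f1 False in \<open>auto simp: open_halfspace_Re_gt open_delete\<close>)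
      qed (use g in \<open>simp add: f_def\<close>)
    qed
  qed
  then show ?thesis unfolding zeta_def by (rule theI')
qed

section \<open>The entire function (s - 1) zeta(s): continuity, growth, special values\<close>

definition entire_zeta :: "complex \<Rightarrow> complex" where
  "entire_zeta s = (if s = 1 then 1 else (s - 1) * zeta s)"

text \<open>The recurrence with \<open>M = 1\<close> involves no shifted arguments, and the first
  Dirichlet term adds \<open>s - 1\<close>. At 1 the remainder terms vanish, which gives the value
  1, the residue of zeta.\<close>

lemma entire_zeta_eq:
  assumes s: "Re s > 0"
  shows "entire_zeta s = s - (\<Sum>k. taylor_rem 1 k s)"
proof (cases "s = 1")
  case True
  have "taylor_rem 1 k 1 = 0" for k
    by (simp add: taylor_rem_def taylor_coeff_def of_nat_neq_0 del: of_nat_Suc)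
  then show ?thesis using True by (simp add: entire_zeta_def)
next
  case False
  have "(s - 1) * zeta s = s - (\<Sum>k. taylor_rem 1 k s)"
  proof (rule analytic_continuation_open[of "{s. Re s > 1}" "{s. Re s > 0} - {1}"
        "\<lambda>s. (s - 1) * zeta s" "\<lambda>s. s - (\<Sum>k. taylor_rem 1 k s)" s])
    have "(2 :: complex) \<in> {s. Re s > 1}" by simp
    then show "{s. Re s > (1 :: real)} \<noteq> {}" by blast
    show "connected ({s. Re s > 0} - {1})"
      by (intro connected_open_delete open_halfspace_Re_gt convex_connected convex_halfspace_Re_gt) auto
    show "(\<lambda>s. (s - 1) * zeta s) holomorphic_on {s. Re s > 0} - {1}"
      using zeta_spec by (intro holomorphic_intros) (auto elim: holomorphic_on_subset)
    show "(\<lambda>s. s - (\<Sum>k. taylor_rem 1 k s)) holomorphic_on {s. Re s > 0} - {1}"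
      using suminf_taylor_rem_holomorphic[of 1]
      by (intro holomorphic_intros) (auto elim!: holomorphic_on_subset)
    fix z :: complex assume z: "z \<in> {s. Re s > 1}"
    have "(\<lambda>n. 1 / of_nat (Suc n) powr z) sums (zeta_tail z + 1)"
      using z by (intro zeta_tail_plus_1_sums) simp
    moreover have "(\<lambda>n. 1 / of_nat (Suc n) powr z) sums zeta z" using zeta_spec z by blast
    ultimately have "zeta z = zeta_tail z + 1" by (rule sums_unique2[symmetric])
    then show "(z - 1) * zeta z = z - (\<Sum>k. taylor_rem 1 k z)"
      using zeta_tail_recurrence[of z 1] z by (simp add: algebra_simps)
  qed (use s False in \<open>auto simp: open_halfspace_Re_gt open_delete\<close>)
  then show ?thesis using False by (simp add: entire_zeta_def)
qed

lemma isCont_entire_zeta: "isCont entire_zeta s"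
proof -
  have "(\<lambda>s. s - (\<Sum>k. taylor_rem 1 k s)) holomorphic_on {s. Re s > 0}"
    using suminf_taylor_rem_holomorphic[of 1] by (intro holomorphic_intros) simp
  then have "entire_zeta holomorphic_on {s. Re s > 0}"
    by (rule holomorphic_transform) (simp add: entire_zeta_eq)
  moreover have "(\<lambda>s. (s - 1) * zeta s) holomorphic_on UNIV - {1}"
    using zeta_spec by (intro holomorphic_intros) auto
  then have "entire_zeta holomorphic_on UNIV - {1}"
    by (rule holomorphic_transform) (simp add: entire_zeta_def)
  ultimately have "continuous_on {s. Re s > 0} entire_zeta" "continuous_on (UNIV - {1}) entire_zeta"
    by (auto intro: holomorphic_on_imp_continuous_on)
  then show ?thesis
    by (cases "s = 1") (auto simp: continuous_on_eq_continuous_at open_halfspace_Re_gt open_delete)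
qed

text \<open>The exponent 3/2 is the decay of the first remainder on the line Re s = 1/2. A
  polynomial bound is ample, as the Gamma factor dominates the growth of xi.\<close>

lemma entire_zeta_bound:
  obtains K where "K > 0" "\<And>s. Re s \<ge> 1 / 2 \<Longrightarrow> norm (entire_zeta s) \<le> K * (1 + norm s) ^ 2"
proof -
  define T where "T = (\<Sum>k. real (Suc k) powr (- (3 / 2)))"
  have summ: "summable (\<lambda>k. real (Suc k) powr (- (3 / 2)))" by (rule summable_powr) simp
  have T: "T \<ge> 0" unfolding T_def by (intro suminf_nonneg summ) auto
  show thesis
  proof (rule that[of "1 + T"])
    fix s :: complex assume s: "Re s \<ge> 1 / 2"
    have le: "norm (taylor_rem 1 k s) \<le> (1 + norm s) ^ 2 * real (Suc k) powr (- (3 / 2))" for k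
    proof -
      have "norm (taylor_rem 1 k s) \<le> (\<Prod>i\<le>1. norm (1 - s - of_nat i)) * real (Suc k) powr (- (Re s + real 1))"
        using s by (intro taylor_rem_bound) auto
      also have "(\<Prod>i\<le>1. norm (1 - s - of_nat i)) = norm (1 - s) * norm s"
        by (simp add: atMost_Suc norm_minus_cancel[symmetric, of s] del: norm_minus_cancel)
      also have "norm (1 - s) * norm s \<le> (1 + norm s) ^ 2"
        unfolding power2_eq_square using norm_triangle_ineq4[of 1 s] by (intro mult_mono) auto
      also have "real (Suc k) powr (- (Re s + real 1)) \<le> real (Suc k) powr (- (3 / 2))"
        using s by (intro powr_mono) auto
      finally show ?thesis by (simp add: mult_right_mono mult_left_mono)
    qed
    have "norm (\<Sum>k. taylor_rem 1 k s) \<le> (\<Sum>k. (1 + norm s) ^ 2 * real (Suc k) powr (- (3 / 2)))"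
      by (rule norm_suminf_le[OF le]) (intro summable_mult summ)
    also have "\<dots> = (1 + norm s) ^ 2 * T" unfolding T_def by (rule suminf_mult[OF summ])
    finally have "norm (\<Sum>k. taylor_rem 1 k s) \<le> (1 + norm s) ^ 2 * T" .
    moreover have "norm s \<le> (1 + norm s) ^ 2" by (simp add: power2_eq_square algebra_simps)
    ultimately have "norm s + norm (\<Sum>k. taylor_rem 1 k s) \<le> (1 + T) * (1 + norm s) ^ 2"
      by (simp add: algebra_simps)
    then show "norm (entire_zeta s) \<le> (1 + T) * (1 + norm s) ^ 2"
      using s norm_triangle_ineq4[of s "\<Sum>k. taylor_rem 1 k s"] by (simp add: entire_zeta_eq)
  qed (use T in simp)
qed

text \<open>At 1/2 the remainder terms are nonpositive, by concavity of the square root, so the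
  value is at least 1/2. This is what excludes 0 as a zero of \<open>Xi1\<close>.\<close>

lemma entire_zeta_half: "\<exists>x>0. entire_zeta (1 / 2) = complex_of_real x"
proof -
  define r where "r k = sqrt (real (Suc k)) - sqrt (real (Suc (Suc k))) + 1 / (2 * sqrt (real (Suc (Suc k))))" for k
  have eq: "taylor_rem 1 k (1 / 2) = of_real (r k)" for k
  proof -
    have p: "complex_of_real x powr (1 / 2) = of_real (sqrt x)" if "x > 0" for x
      using that powr_of_real[of x "1 / 2"] by (simp add: powr_half_sqrt)
    have m: "complex_of_real x powr (- (1 / 2)) = of_real (1 / sqrt x)" if "x > 0" for x
      unfolding powr_minus p[OF that] by (simp add: divide_inverse)
    have e: "(1 - 1 / 2 :: complex) = 1 / 2" "(1 / 2 - 1 :: complex) = - (1 / 2)" by simp_all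
    have "taylor_rem 1 k (1 / 2) = complex_of_real (real (Suc k)) powr (1 / 2) -
        (complex_of_real (real (Suc (Suc k))) powr (1 / 2) +
         (- (1 / 2)) * complex_of_real (real (Suc (Suc k))) powr (- (1 / 2)))"
      unfolding taylor_rem_def One_nat_def sum.atMost_Suc atMost_0 e
      by (simp only: e of_real_of_nat_eq sum.insert sum.empty finite.emptyI empty_iff taylor_coeff_0 mult_1_left
          of_nat_0 diff_zero of_nat_Suc add_0_right not_False_eq_True taylor_coeff_def[of "Suc 0"]) simp
    then show ?thesis
      unfolding p[of "real (Suc (Suc k))", OF of_nat_0_less_iff[THEN iffD2, OF zero_less_Suc]]
        p[of "real (Suc k)", OF of_nat_0_less_iff[THEN iffD2, OF zero_less_Suc]]
        m[of "real (Suc (Suc k))", OF of_nat_0_less_iff[THEN iffD2, OF zero_less_Suc]]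
      by (simp add: r_def)
  qed
  have "r k \<le> 0" for k
  proof -
    define a b where "a = sqrt (real (Suc k))" and "b = sqrt (real (Suc (Suc k)))"
    have ab: "0 < a" "a \<le> b" "b\<^sup>2 = a\<^sup>2 + 1" by (simp_all add: a_def b_def)
    then have "(b - a) * (b + a) = 1" by (simp add: power2_eq_square algebra_simps)
    moreover have "(b - a) * (b + a) \<le> (b - a) * (2 * b)" using ab by (intro mult_left_mono) auto
    ultimately have "1 / (2 * b) \<le> b - a" using ab by (simp add: field_simps)
    then show ?thesis by (simp add: r_def a_def b_def)
  qed
  moreover have "summable (\<lambda>k. taylor_rem 1 k (1 / 2))" by (rule summable_taylor_rem) simp
  then have summ: "summable r" unfolding eq summable_of_real_iff .
  ultimately have "suminf r \<le> 0" by (intro suminf_le_const sum_nonpos) auto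
  moreover have "entire_zeta (1 / 2) = of_real (1 / 2 - suminf r)"
    using entire_zeta_eq[of "1 / 2"] suminf_of_real[OF summ, where 'a = complex] unfolding eq by simp
  ultimately show ?thesis by (intro exI[of _ "1 / 2 - suminf r"]) simp
qed

lemma entire_zeta_even_ge:
  assumes "m \<ge> 1"
  shows "norm (entire_zeta (2 * of_nat m)) \<ge> 1"
proof -
  let ?s = "2 * of_nat m :: complex"
  have s: "Re ?s > 1" using assms by simp
  have "(\<lambda>n. 1 / of_nat (Suc n) powr ?s) sums zeta ?s" using zeta_spec s by blast
  moreover have "1 / of_nat (Suc n) powr ?s = of_real (1 / real (Suc n) ^ (2 * m))" for n
  proof -
    have "(of_nat (Suc n) :: complex) powr of_nat (2 * m) = of_nat (Suc n) ^ (2 * m)"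
      by (rule powr_complexpow) (use of_nat_neq_0 in blast)
    then show ?thesis by simp
  qed
  ultimately have "(\<lambda>n. complex_of_real (1 / real (Suc n) ^ (2 * m))) sums zeta ?s" by simp
  then have R: "(\<lambda>n. 1 / real (Suc n) ^ (2 * m)) sums Re (zeta ?s)" using sums_Re by fastforce
  have "(\<Sum>n\<in>{0}. 1 / real (Suc n) ^ (2 * m)) \<le> Re (zeta ?s)"
    unfolding sums_unique[OF R] by (rule sum_le_suminf[OF sums_summable[OF R]]) auto
  then have "1 \<le> norm (zeta ?s)" using complex_Re_le_cmod[of "zeta ?s"] by simp
  moreover have "1 \<le> norm (?s - 1)" using complex_Re_le_cmod[of "?s - 1"] assms by simp
  ultimately have "1 * 1 \<le> norm (?s - 1) * norm (zeta ?s)" by (intro mult_mono) auto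
  moreover have "?s \<noteq> 1" using s by (metis less_irrefl one_complex.simps(1))
  ultimately show ?thesis by (simp add: entire_zeta_def norm_mult)
qed

section \<open>The xi-function\<close>

text \<open>Absorbing s / 2 into Gamma and s - 1 into zeta removes the degeneracies at 0 and 1. The
  right-hand side is continuous at \<open>s\<close> and agrees with the defining product on a
  punctured neighbourhood, so it is the value that \<open>remove_sings\<close> assigns.\<close>

lemma Riemann_xi_eq:
  assumes s: "s / 2 + 1 \<notin> \<int>\<^sub>\<le>\<^sub>0"
  shows "Riemann_xi s = complex_of_real pi powr (- s / 2) * Gamma (s / 2 + 1) * entire_zeta s"
  unfolding Riemann_xi_def
proof (rule remove_sings_eqI)
  let ?g = "\<lambda>s. complex_of_real pi powr (- s / 2) * Gamma (s / 2 + 1) * entire_zeta s"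
  let ?f = "\<lambda>s. 1 / 2 * s * (s - 1) * complex_of_real pi powr (- s / 2) * Gamma (s / 2) * zeta s"
  have "isCont ?g s"
    using s isCont_entire_zeta[of s] by (intro continuous_intros) auto
  then have "?g \<midarrow>s\<rightarrow> ?g s" by (rule isContD)
  moreover have "\<forall>\<^sub>F w in at s. ?g w = ?f w"
  proof -
    have "isCont (\<lambda>w. w / 2 + 1) s" by (intro continuous_intros) auto
    then have "((\<lambda>w. w / 2 + 1) \<longlongrightarrow> s / 2 + 1) (at s)" by (rule isContD)
    then have "\<forall>\<^sub>F w in at s. w / 2 + 1 \<in> - \<int>\<^sub>\<le>\<^sub>0"
      by (rule topological_tendstoD) (use s in \<open>auto simp: open_Compl closed_nonpos_Ints\<close>)
    then show ?thesis
      using eventually_neq_at_within[of 0 s UNIV] eventually_neq_at_within[of 1 s UNIV]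
    proof eventually_elim
      case (elim w)
      have "w / 2 \<notin> \<int>\<^sub>\<le>\<^sub>0"
      proof
        assume "w / 2 \<in> \<int>\<^sub>\<le>\<^sub>0"
        then obtain n where n: "w / 2 = - of_nat n" by (auto elim: nonpos_Ints_cases')
        with elim have "n \<noteq> 0" by auto
        then obtain k where k: "n = Suc k" by (cases n) auto
        have "w / 2 + 1 = - of_nat k" unfolding n k by simp
        then show False using elim by auto
      qed
      then have "Gamma (w / 2 + 1) = w / 2 * Gamma (w / 2)" by (rule Gamma_plus1)
      then show ?case using elim by (simp add: entire_zeta_def)
    qed
  qed
  ultimately show "?f \<midarrow>s\<rightarrow> ?g s" by (rule Lim_transform_eventually)
qed

lemma not_nonpos_Ints_Re: "Re z > 0 \<Longrightarrow> z \<notin> \<int>\<^sub>\<le>\<^sub>0"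
  by (auto elim!: nonpos_Ints_cases')

lemma Riemann_xi_eq_right:
  "Re s > 0 \<Longrightarrow> Riemann_xi s = complex_of_real pi powr (- s / 2) * Gamma (s / 2 + 1) * entire_zeta s"
  by (intro Riemann_xi_eq not_nonpos_Ints_Re) simp

text \<open>The points excluded from the product formula, with s / 2 + 1 a nonpositive integer, are
  just the trivial zeros.\<close>

lemma Riemann_xi_nontrivial_zero:
  assumes "zeta_nontrivial_zero s"
  shows "Riemann_xi s = 0"
proof -
  have "s / 2 + 1 \<notin> \<int>\<^sub>\<le>\<^sub>0"
  proof
    assume "s / 2 + 1 \<in> \<int>\<^sub>\<le>\<^sub>0"
    then obtain n where "s / 2 + 1 = - of_nat n" by (auto elim: nonpos_Ints_cases')
    then have "s / 2 = - of_nat n - 1" by (simp add: eq_diff_eq)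
    then have "s = - (2 * of_nat (Suc n))" by simp
    then show False using assms unfolding zeta_nontrivial_zero_def by (metis le_add1 plus_1_eq_Suc)
  qed
  then show ?thesis using assms by (simp add: Riemann_xi_eq zeta_nontrivial_zero_def entire_zeta_def)
qed

text \<open>The right half-plane suffices, since every argument of \<open>Xi1\<close> has a square
  root with nonnegative real part.\<close>

lemma nontrivial_zero_of_Riemann_xi:
  assumes "Riemann_xi s = 0" "Re s > 0"
  shows "zeta_nontrivial_zero s"
proof -
  have "s / 2 + 1 \<notin> \<int>\<^sub>\<le>\<^sub>0" by (rule not_nonpos_Ints_Re) (use assms in simp)
  then have "entire_zeta s = 0"
    using assms by (simp add: Riemann_xi_eq_right Gamma_eq_zero_iff)
  moreover have "s \<noteq> - (2 * of_nat n)" for n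
  proof
    assume "s = - (2 * of_nat n)"
    then have "Re s = - (2 * real n)" by simp
    then show False using assms(2) by simp
  qed
  ultimately show ?thesis by (auto simp: entire_zeta_def zeta_nontrivial_zero_def split: if_splits)
qed

text \<open>In the limit formula for Gamma the modulus of the numerator depends only on Re z, while
  each factor of the denominator satisfies |z + i| \<ge> Re z + i.\<close>

lemma norm_Gamma_le:
  fixes z :: complex
  assumes z: "Re z > 0"
  shows "norm (Gamma z) \<le> Gamma (Re z)"
proof (rule LIMSEQ_le)
  show "(\<lambda>n. norm (Gamma_series z n)) \<longlonglongrightarrow> norm (Gamma z)"
    by (intro tendsto_norm Gamma_series_LIMSEQ)
  show "(\<lambda>n. Gamma_series (Re z) n) \<longlonglongrightarrow> Gamma (Re z)" by (rule Gamma_series_LIMSEQ)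
  have "norm (Gamma_series z n) \<le> Gamma_series (Re z) n" for n
  proof -
    have pos: "pochhammer (Re z) (n + 1) > 0" using z by (rule pochhammer_pos)
    have "pochhammer (Re z) (n + 1) = (\<Prod>i=0..<n+1. Re z + real i)" by (simp add: pochhammer_prod)
    also have "\<dots> \<le> (\<Prod>i=0..<n+1. norm (z + of_nat i))"
      using z complex_Re_le_cmod[of "z + of_nat i" for i] by (intro prod_mono) auto
    also have "\<dots> = norm (pochhammer z (n + 1))" by (simp add: pochhammer_prod prod_norm)
    finally have "fact n * exp (Re z * ln (real n)) / norm (pochhammer z (n + 1)) \<le>
        fact n * exp (Re z * ln (real n)) / pochhammer (Re z) (n + 1)"
      using pos by (intro divide_left_mono) (auto intro!: mult_pos_pos)
    then show ?thesis by (simp add: Gamma_series_def norm_divide norm_mult)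
  qed
  then show "\<exists>N. \<forall>n\<ge>N. norm (Gamma_series z n) \<le> Gamma_series (Re z) n" by blast
qed

text \<open>Gamma is compared with a factorial. Just after 1 it still decreases, so the argument is
  first moved to x + 1, which lies in the increasing range.\<close>

lemma Gamma_real_le:
  fixes x :: real
  assumes x: "x \<ge> 1"
  shows "Gamma x \<le> exp ((x + 1) * ln (x + 1))"
proof -
  define N where "N = nat \<lceil>x\<rceil>"
  have N: "x \<le> real N" "real N \<le> x + 1" using x unfolding N_def by linarith+
  have "Gamma (x + 1) = x * Gamma x" by (rule Gamma_plus1) (use x in \<open>auto elim!: nonpos_Ints_cases'\<close>)
  moreover have "Gamma x > 0" using x by (intro Gamma_real_pos) auto
  ultimately have "Gamma x \<le> Gamma (x + 1)" using x by simp
  also have "\<dots> \<le> Gamma (real N + 1)"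
    using N x Gamma_real_strict_mono[of "x + 1" "real N + 1"] by (cases "x = real N") auto
  also have "\<dots> = fact N" using Gamma_fact[of N, where 'a = real] by (simp add: add.commute)
  also have "\<dots> \<le> real N ^ N" using fact_le_power[of N, where 'a = real] by simp
  also have "\<dots> = exp (real N * ln (real N))" using N x by (simp add: exp_of_nat_mult)
  also have "\<dots> \<le> exp ((x + 1) * ln (x + 1))"
    using N x by (intro iffD2[OF exp_le_cancel_iff] mult_mono) auto
  finally show ?thesis .
qed

text \<open>Multiplying out gives 1 + \<Sum> u k \<le> \<Prod> (1 + u k). Thus the convergence of
  the Hadamard product at the single point 1 will yield summability of \<open>1 / a k\<close>,
  without counting zeros.\<close>

lemma summable_of_bounded_prod:
  fixes u :: "nat \<Rightarrow> real"
  assumes u: "\<And>k. u k \<ge> 0" and bound: "\<And>n. (\<Prod>k<n. 1 + u k) \<le> C"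
  shows "summable u"
proof (rule summableI_nonneg_bounded)
  show "(\<Sum>k<n. u k) \<le> C" for n
  proof -
    have "1 + (\<Sum>k<n. u k) \<le> (\<Prod>k<n. 1 + u k)"
    proof (induction n)
      case (Suc n)
      have "1 + (\<Sum>k<Suc n. u k) = (1 + (\<Sum>k<n. u k)) + u n" by simp
      also have "\<dots> \<le> (1 + (\<Sum>k<n. u k)) + (1 + (\<Sum>k<n. u k)) * u n"
        using u sum_nonneg[of "{..<n}" u] by (simp add: algebra_simps)
      also have "\<dots> = (1 + (\<Sum>k<n. u k)) * (1 + u n)" by (simp add: algebra_simps)
      also have "\<dots> \<le> (\<Prod>k<n. 1 + u k) * (1 + u n)"
        using u by (intro mult_right_mono Suc) (simp add: add_nonneg_nonneg)
      finally show ?case by simp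
    qed simp
    then show ?thesis using bound[of n] by linarith
  qed
qed (rule u)

section \<open>The function Xi1: zeros, growth, and the two implications\<close>

locale Xi1 =
  fixes Xi1 :: "complex \<Rightarrow> complex"
  assumes hol: "Xi1 holomorphic_on UNIV"
    and Xi: "\<And>s. Riemann_Xi s = Xi1 (- (s\<^sup>2))"
begin

lemma xi: "Riemann_xi z = Xi1 ((z - 1 / 2)\<^sup>2)"
proof -
  have "Riemann_xi z = Riemann_Xi (- \<i> * (z - 1 / 2))"
    by (simp add: Riemann_Xi_def algebra_simps)
  then show ?thesis by (simp add: Xi power_mult_distrib)
qed

text \<open>With the principal root, all values of \<open>Xi1\<close> are read off from xi on the
  half-plane Re \<ge> 1/2, where the formula and the bounds for zeta are available.\<close>

lemma Xi1_csqrt: "Xi1 w = Riemann_xi (1 / 2 + csqrt w)"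
  by (simp add: xi)

lemma Riemann_hypothesis_iff: "Riemann_hypothesis \<longleftrightarrow> (\<forall>w. Xi1 w = 0 \<longrightarrow> (\<exists>a>0. w = - complex_of_real a))"
proof
  assume RH: Riemann_hypothesis
  show "\<forall>w. Xi1 w = 0 \<longrightarrow> (\<exists>a>0. w = - complex_of_real a)"
  proof (intro allI impI)
    fix w assume w: "Xi1 w = 0"
    define z where "z = csqrt w"
    have "Re z \<ge> 0" using csqrt_principal[of w] by (auto simp: z_def)
    moreover have "Riemann_xi (1 / 2 + z) = 0" using w by (simp add: Xi1_csqrt z_def)
    ultimately have "zeta_nontrivial_zero (1 / 2 + z)" by (intro nontrivial_zero_of_Riemann_xi) simp_all
    then have "Re (1 / 2 + z) = 1 / 2" using RH unfolding Riemann_hypothesis_def by blast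
    then have z: "z = \<i> * of_real (Im z)" by (simp add: complex_eq_iff)
    have "w = z\<^sup>2" by (simp add: z_def)
    also have "\<dots> = - complex_of_real ((Im z)\<^sup>2)" by (subst z) (simp add: power_mult_distrib)
    finally have eq: "w = - complex_of_real ((Im z)\<^sup>2)" .
    \<comment> \<open>A zero of xi at 1/2 would lie on the critical line, so the Riemann hypothesis
      alone does not exclude it.\<close>
    have "Im z \<noteq> 0"
    proof
      assume "Im z = 0"
      then have "Riemann_xi (1 / 2) = 0" using w eq by (simp add: Xi1_csqrt)
      moreover obtain x where "x > 0" "entire_zeta (1 / 2) = complex_of_real x" using entire_zeta_half by blast
      moreover have "(1 / 2 / 2 + 1 :: complex) \<notin> \<int>\<^sub>\<le>\<^sub>0" by (rule not_nonpos_Ints_Re) simp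
      ultimately show False by (simp add: Riemann_xi_eq_right Gamma_eq_zero_iff)
    qed
    then show "\<exists>a>0. w = - complex_of_real a" using eq by (intro exI[of _ "(Im z)\<^sup>2"]) simp
  qed
next
  assume zeros: "\<forall>w. Xi1 w = 0 \<longrightarrow> (\<exists>a>0. w = - complex_of_real a)"
  show Riemann_hypothesis
    unfolding Riemann_hypothesis_def
  proof (intro allI impI)
    fix s assume "zeta_nontrivial_zero s"
    then have "Xi1 ((s - 1 / 2)\<^sup>2) = 0" using Riemann_xi_nontrivial_zero[of s] by (simp add: xi)
    then obtain a where a: "a > 0" "(s - 1 / 2)\<^sup>2 = - complex_of_real a" using zeros by blast
    define x y where "x = Re (s - 1 / 2)" and "y = Im (s - 1 / 2)"
    have "x\<^sup>2 - y\<^sup>2 = - a" "2 * x * y = 0"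
      using arg_cong[OF a(2), of Re] arg_cong[OF a(2), of Im] by (simp_all add: x_def y_def Re_power2 Im_power2)
    moreover have "x\<^sup>2 \<ge> 0" by simp
    ultimately have "x = 0" using a(1) by (cases "y = 0") auto
    then show "Re s = 1 / 2" by (simp add: x_def)
  qed
qed

lemma Xi1_0: "\<exists>x>0. Xi1 0 = complex_of_real x"
proof -
  obtain x where x: "x > 0" "entire_zeta (1 / 2) = complex_of_real x" using entire_zeta_half by blast
  have e: "- (1 / 2) / 2 = complex_of_real (- 1 / 4)" "1 / 2 / 2 + 1 = complex_of_real (5 / 4)" by simp_all
  have "Xi1 0 = Riemann_xi (1 / 2)" by (simp add: xi)
  also have "\<dots> = complex_of_real pi powr (complex_of_real (- 1 / 4)) * Gamma (complex_of_real (5 / 4)) * of_real x"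
    by (subst Riemann_xi_eq_right) (simp_all only: e x, simp)
  also have "\<dots> = of_real (pi powr (- 1 / 4) * Gamma (5 / 4) * x)"
    by (simp only: powr_of_real[OF pi_ge_zero] Gamma_complex_of_real of_real_mult)
  finally show ?thesis using x by (intro exI[of _ "pi powr (- 1 / 4) * Gamma (5 / 4) * x"]) (simp add: Gamma_real_pos)
qed

lemma Xi1_growth:
  obtains B where "\<And>z. norm (Xi1 z) \<le> exp (B (norm z))" "((\<lambda>R. B R / R) \<longlongrightarrow> 0) at_top"
proof -
  obtain K where K: "K > 0" "\<And>s. Re s \<ge> 1 / 2 \<Longrightarrow> norm (entire_zeta s) \<le> K * (1 + norm s) ^ 2"
    using entire_zeta_bound by blast
  \<comment> \<open>The size of the argument of xi is about sqrt |w|; the 3 absorbs the shift by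
    1/2, the shifts in the Gamma bound and the 1 in the zeta bound.\<close>
  define B where "B r = ln K + 2 * ln (sqrt r + 3) + (sqrt r + 3) * ln (sqrt r + 3)" for r
  have "norm (Xi1 w) \<le> exp (B (norm w))" for w
  proof -
    define z where "z = 1 / 2 + csqrt w"
    define y where "y = sqrt (norm w) + 3"
    have y: "y \<ge> 3" by (simp add: y_def)
    have Re: "Re z \<ge> 1 / 2" using csqrt_principal[of w] by (auto simp: z_def)
    have "(norm (csqrt w))\<^sup>2 = norm w" by (simp flip: norm_power)
    then have "norm (csqrt w) = sqrt (norm w)" by (metis norm_ge_zero real_sqrt_unique)
    then have nz: "norm z \<le> 1 / 2 + sqrt (norm w)"
      using norm_triangle_ineq[of "1 / 2" "csqrt w"] by (simp add: z_def)
    have Rez: "Re z \<le> norm z" by (rule complex_Re_le_cmod)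
    have "Xi1 w = complex_of_real pi powr (- z / 2) * Gamma (z / 2 + 1) * entire_zeta z"
      unfolding Xi1_csqrt z_def[symmetric] using Re by (intro Riemann_xi_eq_right) simp
    then have "norm (Xi1 w) = norm (complex_of_real pi powr (- z / 2)) * norm (Gamma (z / 2 + 1)) * norm (entire_zeta z)"
      by (simp only: norm_mult)
    also have "\<dots> \<le> 1 * exp (y * ln y) * (K * y ^ 2)"
    proof (intro mult_mono)
      have "norm (complex_of_real pi powr (- z / 2)) = pi powr (- Re z / 2)"
        by (subst norm_powr_real_powr) auto
      also have "\<dots> \<le> pi powr 0" using Re pi_gt3 by (intro powr_mono) auto
      finally show "norm (complex_of_real pi powr (- z / 2)) \<le> 1" using pi_gt3 by simp
      have "norm (Gamma (z / 2 + 1)) \<le> Gamma (Re (z / 2 + 1))" using Re by (intro norm_Gamma_le) simp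
      also have "\<dots> \<le> exp ((Re (z / 2 + 1) + 1) * ln (Re (z / 2 + 1) + 1))"
        using Re by (intro Gamma_real_le) simp
      also have "\<dots> \<le> exp (y * ln y)"
      proof -
        have "Re (z / 2 + 1) + 1 \<le> y" "1 \<le> Re (z / 2 + 1) + 1"
          using Rez nz Re by (simp_all add: y_def)
        then show ?thesis by (intro iffD2[OF exp_le_cancel_iff] mult_mono) auto
      qed
      finally show "norm (Gamma (z / 2 + 1)) \<le> exp (y * ln y)" .
      have "norm (entire_zeta z) \<le> K * (1 + norm z) ^ 2" by (rule K(2)[OF Re])
      also have "\<dots> \<le> K * y ^ 2"
        using K(1) nz by (intro mult_left_mono power_mono) (auto simp: y_def)
      finally show "norm (entire_zeta z) \<le> K * y ^ 2" .
    qed (use K in auto)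
    also have "\<dots> = exp (B (norm w))"
    proof -
      have "exp (ln y) = y" "exp (ln K) = K" using y K(1) by simp_all
      moreover have "B (norm w) = ln K + (ln y + ln y) + y * ln y" by (simp add: B_def y_def)
      ultimately have "exp (B (norm w)) = K * (y * y) * exp (y * ln y)" by (simp only: exp_add)
      then show ?thesis by (simp add: power2_eq_square)
    qed
    finally show ?thesis .
  qed
  moreover have "((\<lambda>R. B R / R) \<longlongrightarrow> 0) at_top" unfolding B_def by real_asymp
  ultimately show thesis by (rule that)
qed

text \<open>At the points (2 m - 1/2)^2 the values are xi(2 m), of modulus at least m! / \<pi>^m,
  which outgrows every power of m.\<close>

lemma Xi1_not_polynomial:
  fixes n :: nat
  shows "\<exists>z. Xi1 z \<noteq> c * (\<Prod>k<n. 1 + z / a k)"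
proof (rule ccontr)
  assume "\<not> ?thesis"
  then have eq: "Xi1 z = c * (\<Prod>k<n. 1 + z / a k)" for z by blast
  \<comment> \<open>Chosen so that |1 + z / a k| \<le> A m^2 whenever |z| \<le> 4 m^2 and m \<ge> 1.
    A vanishing \<open>a k\<close> is harmless, as division by 0 gives 0.\<close>
  define A where "A = 1 + (\<Sum>k<n. 4 / norm (a k))"
  have A: "A \<ge> 1" by (simp add: A_def sum_nonneg)
  \<comment> \<open>The factorial comes from m^(2 n) \<le> (2 n)! exp m, which trades the power of m
    for a geometric factor.\<close>
  define C where "C = norm c * A ^ n * fact (2 * n)"
  have bound: "1 \<le> C * ((pi * exp 1) ^ m / fact m)" if m: "m \<ge> 1" for m
  proof -
    define z where "z = (2 * of_nat m - 1 / 2 :: complex)\<^sup>2"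
    have "norm (2 * of_nat m - 1 / 2 :: complex) \<le> 2 * real m"
    proof -
      have "2 * of_nat m - 1 / 2 = complex_of_real (2 * real m - 1 / 2)" by simp
      then have "norm (2 * of_nat m - 1 / 2 :: complex) = \<bar>2 * real m - 1 / 2\<bar>" by (simp only: norm_of_real)
      then show ?thesis using m by simp
    qed
    then have "norm z \<le> (2 * real m)\<^sup>2" unfolding z_def norm_power by (intro power_mono) auto
    then have nz: "norm z \<le> 4 * real m ^ 2" by (simp add: power_mult_distrib)
    have "Xi1 z = Riemann_xi (2 * of_nat m)" by (simp add: xi z_def)
    also have "\<dots> = complex_of_real pi powr (- of_nat m) * Gamma (1 + of_nat m) * entire_zeta (2 * of_nat m)"
      using m by (subst Riemann_xi_eq_right) (simp_all add: add.commute)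
    finally have "norm (Xi1 z) = pi powr (- real m) * fact m * norm (entire_zeta (2 * of_nat m))"
      by (simp add: norm_mult norm_powr_real_powr Gamma_fact)
    moreover have "pi powr (- real m) * fact m * 1 \<le> pi powr (- real m) * fact m * norm (entire_zeta (2 * of_nat m))"
      by (intro mult_left_mono entire_zeta_even_ge m) auto
    ultimately have "fact m / pi ^ m \<le> norm (Xi1 z)"
      by (simp add: powr_minus powr_realpow divide_inverse mult.commute)
    also have "\<dots> = norm c * (\<Prod>k<n. norm (1 + z / a k))" by (simp add: eq norm_mult prod_norm)
    also have "\<dots> \<le> norm c * (\<Prod>k<n. A * real m ^ 2)"
    proof (intro mult_left_mono prod_mono conjI)
      fix k assume k: "k \<in> {..<n}"
      have "norm (1 + z / a k) \<le> 1 + norm z / norm (a k)"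
        using norm_triangle_ineq[of 1 "z / a k"] by (simp add: norm_divide)
      also have "\<dots> \<le> real m ^ 2 + 4 / norm (a k) * real m ^ 2"
        using nz m by (intro add_mono) (auto simp: divide_right_mono)
      also have "4 / norm (a k) \<le> (\<Sum>k<n. 4 / norm (a k))"
        by (rule member_le_sum[OF k]) auto
      then have "4 / norm (a k) * real m ^ 2 \<le> (\<Sum>k<n. 4 / norm (a k)) * real m ^ 2"
        by (rule mult_right_mono) simp
      then have "real m ^ 2 + 4 / norm (a k) * real m ^ 2 \<le> A * real m ^ 2"
        unfolding A_def distrib_right by simp
      finally show "norm (1 + z / a k) \<le> A * real m ^ 2" .
    qed auto
    also have "(\<Prod>k<n. A * real m ^ 2) = A ^ n * real m ^ (2 * n)"
      by (simp add: power_mult_distrib power_mult)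
    also have "norm c * (A ^ n * real m ^ (2 * n)) \<le> norm c * (A ^ n * (fact (2 * n) * exp (real m)))"
    proof (intro mult_left_mono)
      have "real m ^ (2 * n) / fact (2 * n) \<le> exp (real m)"
        using sum_power_fact_le_exp[of "real m" "{2 * n}"] by simp
      then show "real m ^ (2 * n) \<le> fact (2 * n) * exp (real m)" by (simp add: divide_le_eq mult.commute)
    qed (use A in auto)
    also have "\<dots> = C * exp 1 ^ m" by (simp add: C_def exp_of_nat_mult[of m 1, simplified])
    finally show ?thesis by (simp add: power_mult_distrib divide_simps mult_ac)
  qed
  have "(\<lambda>m. C * ((pi * exp 1) ^ m / fact m)) \<longlonglongrightarrow> C * 0"
    using summable_LIMSEQ_zero[OF summable_exp[of "pi * exp 1 :: real"]]
    by (intro tendsto_mult_left) (simp add: divide_inverse mult.commute)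
  then have "\<forall>\<^sub>F m in sequentially. C * ((pi * exp 1) ^ m / fact m) < 1"
    by (rule order_tendstoD) simp
  then have "\<forall>\<^sub>F m in sequentially. C * ((pi * exp 1) ^ m / fact m) < 1 \<and> 1 \<le> m"
    using eventually_ge_at_top[of "1 :: nat"] by eventually_elim simp
  then have "\<exists>m. C * ((pi * exp 1) ^ m / fact m) < 1 \<and> 1 \<le> m"
    by (rule eventually_happens'[OF sequentially_bot])
  then obtain m where "C * ((pi * exp 1) ^ m / fact m) < 1" "m \<ge> 1" by blast
  then show False using bound[of m] by simp
qed

lemma indicator_atLeast_scaleR:
  fixes L :: "real \<Rightarrow> real"
  assumes "\<And>x. x < 0 \<Longrightarrow> L x = 0"
  shows "indicator {0..} x *\<^sub>R (complex_of_real (L x) * c) = complex_of_real (L x) * c"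
  using assms[of x] by (auto simp: indicator_def)

lemma exists_Polya_frequency:
  assumes RH: Riemann_hypothesis
  shows "\<exists>(L :: real \<Rightarrow> real) (\<alpha> :: real).
       Polya_frequency L \<and> closure {x. L x \<noteq> 0} \<subseteq> {0..} \<and> \<alpha> < 0 \<and>
       (\<forall>s::complex. Re s > \<alpha> \<longrightarrow>
          Xi1 s \<noteq> 0 \<and>
          set_integrable lebesgue {0..} (\<lambda>x. complex_of_real (L x) * exp (- s * complex_of_real x)) \<and>
          1 / Xi1 s =
            set_lebesgue_integral lebesgue {0..} (\<lambda>x. complex_of_real (L x) * exp (- s * complex_of_real x)))"
proof -
  obtain x0 where x0: "x0 > 0" "Xi1 0 = complex_of_real x0" using Xi1_0 by blast
  obtain B where B: "\<And>z. norm (Xi1 z) \<le> exp (B (norm z))" "((\<lambda>R. B R / R) \<longlongrightarrow> 0) at_top"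
    using Xi1_growth by blast
  have Xi1_0_nz: "Xi1 0 \<noteq> 0" using x0 by simp
  obtain b where "\<And>k. b k \<noteq> 0" and b: "\<And>k. Xi1 (- b k) = 0" "\<And>k. norm (b k) \<le> norm (b (Suc k))"
    "\<And>z. (\<lambda>n. Xi1 0 * (\<Prod>k<n. 1 + z / b k)) \<longlonglongrightarrow> Xi1 z"
    by (rule hadamard_small_order[OF hol Xi1_0_nz B Xi1_not_polynomial]) (rule that)
  \<comment> \<open>Under the Riemann hypothesis each \<open>b k\<close> is a positive real and
    hence equal to its norm.\<close>
  define a where "a k = norm (b k)" for k
  have ba: "b k = complex_of_real (a k)" and a_pos: "a k > 0" for k
  proof -
    obtain r where "r > 0" "- b k = - complex_of_real r"
      using RH b(1)[of k] unfolding Riemann_hypothesis_iff by blast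
    then show "b k = complex_of_real (a k)" "a k > 0" by (simp_all add: a_def)
  qed
  have a_mono: "a 0 \<le> a k" for k
    by (rule lift_Suc_mono_le[of a]) (simp_all add: a_def b(2))
  have summ: "summable (\<lambda>k. 1 / a k)"
  proof -
    have "(\<lambda>n. norm (Xi1 0 * (\<Prod>k<n. 1 + 1 / b k))) \<longlonglongrightarrow> norm (Xi1 1)"
      by (intro tendsto_norm b(3))
    moreover have "norm (Xi1 0 * (\<Prod>k<n. 1 + 1 / b k)) = x0 * (\<Prod>k<n. 1 + 1 / a k)" for n
    proof -
      have "Xi1 0 * (\<Prod>k<n. 1 + 1 / b k) = complex_of_real (x0 * (\<Prod>k<n. 1 + 1 / a k))" by (simp add: x0 ba)
      moreover have "x0 * (\<Prod>k<n. 1 + 1 / a k) \<ge> 0"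
        using x0 a_pos by (intro mult_nonneg_nonneg prod_nonneg) (auto simp: less_imp_le add_nonneg_nonneg)
      ultimately show ?thesis by (simp only: norm_of_real abs_of_nonneg)
    qed
    ultimately have "(\<lambda>n. x0 * (\<Prod>k<n. 1 + 1 / a k)) \<longlonglongrightarrow> norm (Xi1 1)" by simp
    then obtain C where C: "\<And>n. norm (x0 * (\<Prod>k<n. 1 + 1 / a k)) \<le> C"
      using convergent_imp_Bseq[of "\<lambda>n. x0 * (\<Prod>k<n. 1 + 1 / a k)"] unfolding Bseq_def convergent_def by blast
    show ?thesis
    proof (rule summable_of_bounded_prod)
      show "1 / a k \<ge> 0" for k using a_pos[of k] by simp
      show "(\<Prod>k<n. 1 + 1 / a k) \<le> C / x0" for n
        using C[of n] x0 by (simp add: pos_le_divide_eq mult.commute abs_le_iff)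
    qed
  qed
  obtain L \<delta> where \<delta>: "0 < \<delta>" "\<delta> < a 0" and L: "L \<in> borel_measurable borel" "integrable lborel L" "tp_kernel L"
    "\<And>x. x < 0 \<Longrightarrow> L x = 0"
    and int: "\<And>s :: complex. Re s > - \<delta> \<Longrightarrow> integrable lborel (\<lambda>x. laplace_term s L x)"
    and lim: "\<And>s :: complex. Re s > - \<delta> \<Longrightarrow> (\<lambda>n. \<Prod>k<n. a k / (a k + s)) \<longlonglongrightarrow>
        (\<integral>x. laplace_term s L x \<partial>lborel)"
    by (rule polya_frequency_limit[OF a_pos a_mono summ]) (rule that)
  \<comment> \<open>The limit of the products is 1 at 0, whereas the reciprocal of
    \<open>Xi1\<close> has the value \<open>1 / x0\<close> there.\<close>
  define L' where "L' x = L x / x0" for x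
  have L'0: "L' x = 0" if "x < 0" for x using L(4)[OF that] by (simp add: L'_def)
  have "tp_kernel (\<lambda>x. 1 / x0 * exp (0 * x) * L x)" using x0 by (intro tp_kernel_exp_mult L) simp
  then have tp: "tp_kernel L'" by (simp add: L'_def[abs_def])
  have "L' \<in> borel_measurable borel" using L(1) unfolding L'_def by measurable
  then have "L' \<in> borel_measurable lebesgue" by (intro measurable_completion) simp
  then have "totally_positive L'" using tp by (simp add: totally_positive_def tp_kernel_def)
  moreover have "integrable lborel L'" using L(2) by (simp add: L'_def[abs_def])
  then have "integrable lebesgue L'" by (simp add: integrable_completion borel_measurable_integrable)
  ultimately have "Polya_frequency L'" by (simp add: Polya_frequency_def)
  moreover have "closure {x. L' x \<noteq> 0} \<subseteq> {0..}"
    by (rule closure_minimal) (use L'0 in \<open>auto simp: not_less[symmetric]\<close>)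
  moreover have "Xi1 s \<noteq> 0 \<and>
          set_integrable lebesgue {0..} (\<lambda>x. complex_of_real (L' x) * exp (- s * complex_of_real x)) \<and>
          1 / Xi1 s = set_lebesgue_integral lebesgue {0..} (\<lambda>x. complex_of_real (L' x) * exp (- s * complex_of_real x))"
    if s: "Re s > - \<delta>" for s
  proof -
    define I where "I = (\<integral>x. laplace_term s L x \<partial>lborel)"
    have as: "complex_of_real (a k) + s \<noteq> 0" for k
    proof
      assume "complex_of_real (a k) + s = 0"
      then have "Re (complex_of_real (a k) + s) = 0" by simp
      then show False using s \<delta> a_mono[of k] by simp
    qed
    \<comment> \<open>The partial Hadamard products and the transforms of the finite convolutions
      are reciprocal up to \<open>x0\<close>. Multiplying them before passing to the limit also
      shows that \<open>Xi1 s\<close> is not 0.\<close>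
    have "(\<lambda>n. (Xi1 0 * (\<Prod>k<n. 1 + s / b k)) * (\<Prod>k<n. a k / (a k + s))) \<longlonglongrightarrow> Xi1 s * I"
      unfolding I_def by (intro tendsto_mult b(3) lim s)
    moreover have "(Xi1 0 * (\<Prod>k<n. 1 + s / b k)) * (\<Prod>k<n. a k / (a k + s)) = of_real x0" for n
    proof -
      have "(1 + s / complex_of_real (a k)) * (a k / (a k + s)) = 1" for k
      proof -
        have "1 + s / complex_of_real (a k) = (a k + s) / a k" using a_pos[of k] by (simp add: add_divide_distrib)
        then show ?thesis using as[of k] a_pos[of k] by simp
      qed
      then have "(\<Prod>k<n. 1 + s / b k) * (\<Prod>k<n. a k / (a k + s)) = 1"
        by (simp only: prod.distrib[symmetric] ba prod.neutral_const)
      then show ?thesis by (simp only: mult.assoc x0 mult_1_right)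
    qed
    ultimately have "(\<lambda>n. complex_of_real x0) \<longlonglongrightarrow> Xi1 s * I" by simp
    then have XI: "Xi1 s * I = of_real x0" by (simp add: LIMSEQ_const_iff)
    have eq: "complex_of_real (L' x) * exp (- s * complex_of_real x) =
        (laplace_term s L x) / of_real x0" for x
      by (simp add: L'_def)
    have i: "integrable lborel (\<lambda>x. complex_of_real (L' x) * exp (- s * complex_of_real x))"
      unfolding eq by (intro integrable_divide_zero impI int s)
    have v: "(\<integral>x. complex_of_real (L' x) * exp (- s * complex_of_real x) \<partial>lborel) = I / of_real x0"
      unfolding eq I_def by (rule integral_divide_zero)
    have m: "(\<lambda>x. complex_of_real (L' x) * exp (- s * complex_of_real x)) \<in> borel_measurable lborel"
      using i by (rule borel_measurable_integrable)
    have "set_integrable lebesgue {0..} (\<lambda>x. complex_of_real (L' x) * exp (- s * complex_of_real x))"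
      unfolding set_integrable_def
      by (simp only: indicator_atLeast_scaleR[of L', OF L'0] integrable_completion[OF m] i)
    moreover have "set_lebesgue_integral lebesgue {0..} (\<lambda>x. complex_of_real (L' x) * exp (- s * complex_of_real x)) = I / of_real x0"
      unfolding set_lebesgue_integral_def
      by (simp only: indicator_atLeast_scaleR[of L', OF L'0] integral_completion[OF m] v)
    moreover have "Xi1 s \<noteq> 0" using XI x0 by auto
    moreover have "1 / Xi1 s = I / of_real x0" using XI x0 \<open>Xi1 s \<noteq> 0\<close> by (simp add: field_simps)
    ultimately show ?thesis by metis
  qed
  moreover have "- \<delta> < 0" using \<delta> by simp
  ultimately show ?thesis by blast
qed

text \<open>Total positivity makes the zeros real; their sign comes from the half-plane, since
  \<open>Xi1\<close> has no zero with real part above \<alpha>, and \<alpha> < 0.\<close>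

lemma Riemann_hypothesis_of_Polya_frequency:
  fixes L :: "real \<Rightarrow> real" and \<alpha> :: real
  assumes L: "Polya_frequency L" "closure {x. L x \<noteq> 0} \<subseteq> {0..}" and \<alpha>: "\<alpha> < 0"
    and lap: "\<And>s::complex. Re s > \<alpha> \<Longrightarrow>
          Xi1 s \<noteq> 0 \<and>
          set_integrable lebesgue {0..} (\<lambda>x. complex_of_real (L x) * exp (- s * complex_of_real x)) \<and>
          1 / Xi1 s =
            set_lebesgue_integral lebesgue {0..} (\<lambda>x. complex_of_real (L x) * exp (- s * complex_of_real x))"
  shows Riemann_hypothesis
  unfolding Riemann_hypothesis_iff
proof (intro allI impI)
  fix w assume w: "Xi1 w = 0"
  have "{x. L x \<noteq> 0} \<subseteq> {0..}" using closure_subset L(2) by (rule order.trans)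
  then have L0: "L x = 0" if "x < 0" for x using that by force
  have nz: "Xi1 s \<noteq> 0" if "Re s > \<alpha>" for s using lap[OF that] by (rule conjunct1)
  have tp: "tp_kernel L" using L(1) by (simp add: Polya_frequency_def totally_positive_def tp_kernel_def)
  have "Im w = 0"
  proof (rule laplace_reciprocal_real_zeros[OF hol tp L0 \<alpha> _ _ _ w])
    fix s :: complex assume s: "Re s > \<alpha>"
    have eq: "indicator {0..} x *\<^sub>R (complex_of_real (L x) * c) = complex_of_real (L x) * c" for x c
      by (rule indicator_atLeast_scaleR[OF L0])
    show "Xi1 s \<noteq> 0" by (rule nz[OF s])
    have "set_integrable lebesgue {0..} (\<lambda>x. complex_of_real (L x) * exp (- s * complex_of_real x))"
      using lap[OF s] by blast
    then show "integrable lebesgue (\<lambda>x. complex_of_real (L x) * exp (- s * complex_of_real x))"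
      by (simp only: set_integrable_def eq)
    have "1 / Xi1 s = set_lebesgue_integral lebesgue {0..} (\<lambda>x. complex_of_real (L x) * exp (- s * complex_of_real x))"
      using lap[OF s] by blast
    then show "1 / Xi1 s = (\<integral>x. complex_of_real (L x) * exp (- s * complex_of_real x) \<partial>lebesgue)"
      by (simp only: set_lebesgue_integral_def eq)
  qed
  moreover have "Re w \<le> \<alpha>" using nz[of w] w by (auto simp: not_less[symmetric])
  ultimately show "\<exists>a>0. w = - complex_of_real a"
    using \<alpha> by (intro exI[of _ "- Re w"]) (auto simp: complex_eq_iff)
qed

end

theorem theorem5:
  fixes Xi1 :: "complex \<Rightarrow> complex"
  assumes "Xi1 holomorphic_on UNIV"
    and "\<forall>s. Riemann_Xi s = Xi1 (- (s\<^sup>2))"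
  shows "Riemann_hypothesis \<longleftrightarrow>
    (\<exists>(L :: real \<Rightarrow> real) (\<alpha> :: real).
       Polya_frequency L \<and> closure {x. L x \<noteq> 0} \<subseteq> {0..} \<and> \<alpha> < 0 \<and>
       (\<forall>s::complex. Re s > \<alpha> \<longrightarrow>
          Xi1 s \<noteq> 0 \<and>
          set_integrable lebesgue {0..} (\<lambda>x. complex_of_real (L x) * exp (- s * complex_of_real x)) \<and>
          1 / Xi1 s =
            set_lebesgue_integral lebesgue {0..} (\<lambda>x. complex_of_real (L x) * exp (- s * complex_of_real x))))"
proof -
  interpret Xi1 Xi1 using assms by unfold_locales auto
  show ?thesis
    using exists_Polya_frequency Riemann_hypothesis_of_Polya_frequency by blast
qed

end
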